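(* Let $\Delta\ge 2$ and $0\le\alpha<\pi/2$, and let $U_{\Delta,\alpha}\subseteq\mathbb{C}$ be an open set containing the interval $[1,\infty)$ such that $Z_{L(G)}(\lambda,b)\neq 0$ for every graph $G$ of maximum degree at most $\Delta$, every $b\in U_{\Delta,\alpha}$ and every $\lambda\in\{z\in\mathbb{C} : |\arg(z)|<\pi-2\alpha\}$. Let $b\in U_{\Delta,\alpha}$ and $\xi\in\{z\in\mathbb{C} : |\arg(z)|<\pi-2\alpha\}$. Then for any $\varepsilon>0$, there exists an algorithm that, given an $n$-vertex graph $G$ of maximum degree at most $\Delta$, computes a multiplicative $\varepsilon$-approximation to $Z_{L(G)}(\xi,b)$ in time polynomial in $n/\varepsilon$.
   Context: For a finite simple graph $H=(V,E)$ and $z,b\in\mathbb{C}$, the partition function of the Ising model is $Z_H(z,b)=\sum_{U\subseteq V} z^{|U|}\, b^{|\delta(U)|}$, where $\delta(U)$ denotes the set of edges of $H$ with one endpoint in $U$ and one endpoint in $V\setminus U$. The line graph $L(G)$ of a graph $G$ is the graph whose vertices are the edges of $G$, two edges of $G$ being adjacent in $L(G)$ if they share a common vertex. Graphs are finite and simple. Here $\arg(z)\in(-\pi,\pi]$ is the principal argument of a nonzero complex number $z$. A multiplicative $\varepsilon$-approximation to a nonzero complex number $e^{a}$ is a number $e^{c}$ such that $|a-c|\le\varepsilon$. *)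

theory Defs
  imports "HOL-Analysis.Analysis" "HOL-Computational_Algebra.Polynomial"
begin

section \<open>Graphs and the Ising partition function\<close>

record 'a graph =
  verts :: "'a set"
  edges :: "'a set set"

definition simple_graph :: "'a graph \<Rightarrow> bool" where
  "simple_graph G \<longleftrightarrow> finite (verts G) \<and> (\<forall>e\<in>edges G. e \<subseteq> verts G \<and> card e = 2)"

definition vertex_degree :: "'a graph \<Rightarrow> 'a \<Rightarrow> nat" where
  "vertex_degree G v = card {e \<in> edges G. v \<in> e}"

definition max_degree_at_most :: "'a graph \<Rightarrow> nat \<Rightarrow> bool" where
  "max_degree_at_most G \<Delta> \<longleftrightarrow> (\<forall>v\<in>verts G. vertex_degree G v \<le> \<Delta>)"

definition line_graph :: "'a graph \<Rightarrow> 'a set graph" where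
  "line_graph G = \<lparr>verts = edges G,
     edges = {{e, f} |e f. e \<in> edges G \<and> f \<in> edges G \<and> e \<noteq> f \<and> e \<inter> f \<noteq> {}}\<rparr>"

definition edge_boundary :: "'a graph \<Rightarrow> 'a set \<Rightarrow> 'a set set" where
  "edge_boundary G U = {e \<in> edges G. \<exists>u\<in>U. \<exists>v\<in>verts G - U. e = {u, v}}"

definition ising_Z :: "'a graph \<Rightarrow> complex \<Rightarrow> complex \<Rightarrow> complex" where
  "ising_Z G z b = (\<Sum>U\<in>Pow (verts G). z ^ card U * b ^ card (edge_boundary G U))"

text \<open>The condition \<open>z \<noteq> 0\<close> is explicit because the library sets \<open>Arg 0 = 0\<close>,
  whereas the argument is only meant for nonzero numbers.\<close>

definition arg_sector :: "real \<Rightarrow> complex set" where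
  "arg_sector \<theta> = {z. z \<noteq> 0 \<and> \<bar>Arg z\<bar> < \<theta>}"

definition mult_approx :: "real \<Rightarrow> complex \<Rightarrow> complex \<Rightarrow> bool" where
  "mult_approx \<epsilon> x y \<longleftrightarrow> (\<exists>a c. y = exp a \<and> x = exp c \<and> cmod (a - c) \<le> \<epsilon>)"


section \<open>Model of computation\<close>

text \<open>
  The parameters \<open>b\<close> and \<open>\<xi>\<close> are arbitrary (possibly non-computable) complex numbers, so running
  time is counted in exact arithmetic operations. The machine is a random access machine with two
  kinds of cells. Discrete cells hold natural numbers; they are used for control and addressing and
  support addition, truncated subtraction and comparison at unit cost. Unit-cost multiplication of
  natural numbers is deliberately absent: a discrete value then has bit length at most linear in the
  running time and the input size, so that the discrete part is polynomially equivalent to a Turing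
  machine. Algebraic cells hold complex numbers and support the field operations and equality tests
  (as in the Blum-Shub-Smale model over the complex numbers); there is no rounding, no order
  comparison, and no passage from complex to natural values except through equality tests. Programs
  contain no complex constants besides those obtained from natural numbers.

  Programs are structured. Every evaluated node of an expression, and every command executed,
  is charged one unit.
\<close>

record state =
  nreg :: "nat \<Rightarrow> nat"
  nmem :: "nat \<Rightarrow> nat"
  creg :: "nat \<Rightarrow> complex"
  cmem :: "nat \<Rightarrow> complex"

datatype nexp =
    NLit nat
  | NReg nat
  | NMem nexp
  | NAdd nexp nexp
  | NSub nexp nexp

datatype cexp =
    COfNat nexp
  | CReg nat
  | CMem nexp
  | CAdd cexp cexp
  | CSub cexp cexp
  | CMul cexp cexp
  | CDiv cexp cexp

datatype test =
    NLess nexp nexp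
  | CEq cexp cexp

datatype com =
    Skip
  | SetNReg nat nexp
  | SetNMem nexp nexp
  | SetCReg nat cexp
  | SetCMem nexp cexp
  | Seq com com
  | If_Then_Else test com com
  | While test com

primrec nval :: "nexp \<Rightarrow> state \<Rightarrow> nat" where
  "nval (NLit k) s = k"
| "nval (NReg r) s = nreg s r"
| "nval (NMem e) s = nmem s (nval e s)"
| "nval (NAdd e f) s = nval e s + nval f s"
| "nval (NSub e f) s = nval e s - nval f s"

primrec cval :: "cexp \<Rightarrow> state \<Rightarrow> complex" where
  "cval (COfNat e) s = of_nat (nval e s)"
| "cval (CReg r) s = creg s r"
| "cval (CMem e) s = cmem s (nval e s)"
| "cval (CAdd e f) s = cval e s + cval f s"
| "cval (CSub e f) s = cval e s - cval f s"
| "cval (CMul e f) s = cval e s * cval f s"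
| "cval (CDiv e f) s = cval e s / cval f s"

primrec tval :: "test \<Rightarrow> state \<Rightarrow> bool" where
  "tval (NLess e f) s \<longleftrightarrow> nval e s < nval f s"
| "tval (CEq e f) s \<longleftrightarrow> cval e s = cval f s"

primrec ncost :: "nexp \<Rightarrow> nat" where
  "ncost (NLit k) = 1"
| "ncost (NReg r) = 1"
| "ncost (NMem e) = 1 + ncost e"
| "ncost (NAdd e f) = 1 + ncost e + ncost f"
| "ncost (NSub e f) = 1 + ncost e + ncost f"

primrec ccost :: "cexp \<Rightarrow> nat" where
  "ccost (COfNat e) = 1 + ncost e"
| "ccost (CReg r) = 1"
| "ccost (CMem e) = 1 + ncost e"
| "ccost (CAdd e f) = 1 + ccost e + ccost f"
| "ccost (CSub e f) = 1 + ccost e + ccost f"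
| "ccost (CMul e f) = 1 + ccost e + ccost f"
| "ccost (CDiv e f) = 1 + ccost e + ccost f"

primrec tcost :: "test \<Rightarrow> nat" where
  "tcost (NLess e f) = 1 + ncost e + ncost f"
| "tcost (CEq e f) = 1 + ccost e + ccost f"

text \<open>\<open>runs c s t s'\<close>: started in \<open>s\<close>, the program \<open>c\<close> terminates in \<open>s'\<close> after \<open>t\<close> units of time.\<close>

inductive runs :: "com \<Rightarrow> state \<Rightarrow> nat \<Rightarrow> state \<Rightarrow> bool" where
  runs_Skip: "runs Skip s 1 s"
| runs_SetNReg:
    "runs (SetNReg r e) s (1 + ncost e) (s\<lparr>nreg := (nreg s)(r := nval e s)\<rparr>)"
| runs_SetNMem:
    "runs (SetNMem a e) s (1 + ncost a + ncost e) (s\<lparr>nmem := (nmem s)(nval a s := nval e s)\<rparr>)"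
| runs_SetCReg:
    "runs (SetCReg r e) s (1 + ccost e) (s\<lparr>creg := (creg s)(r := cval e s)\<rparr>)"
| runs_SetCMem:
    "runs (SetCMem a e) s (1 + ncost a + ccost e) (s\<lparr>cmem := (cmem s)(nval a s := cval e s)\<rparr>)"
| runs_Seq:
    "runs c s t s' \<Longrightarrow> runs d s' u s'' \<Longrightarrow> runs (Seq c d) s (1 + t + u) s''"
| runs_IfTrue:
    "tval p s \<Longrightarrow> runs c s t s' \<Longrightarrow> runs (If_Then_Else p c d) s (1 + tcost p + t) s'"
| runs_IfFalse:
    "\<not> tval p s \<Longrightarrow> runs d s t s' \<Longrightarrow> runs (If_Then_Else p c d) s (1 + tcost p + t) s'"
| runs_WhileFalse:
    "\<not> tval p s \<Longrightarrow> runs (While p c) s (1 + tcost p) s"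
| runs_WhileTrue:
    "tval p s \<Longrightarrow> runs c s t s' \<Longrightarrow> runs (While p c) s' u s'' \<Longrightarrow>
     runs (While p c) s (1 + tcost p + t + u) s''"

text \<open>
  A graph on the vertex set \<open>{0, \<dots>, n - 1}\<close> is given by \<open>n\<close> and its adjacency matrix, stored row by
  row. The numbers \<open>b\<close> and \<open>\<xi>\<close> are supplied exactly, in two algebraic registers.
\<close>

definition input_state :: "nat \<Rightarrow> nat graph \<Rightarrow> complex \<Rightarrow> complex \<Rightarrow> state" where
  "input_state n G b \<xi> =
    \<lparr>nreg = (\<lambda>_. 0)(0 := n),
     nmem = (\<lambda>p. if \<exists>i<n. \<exists>j<n. p = i * n + j \<and> {i, j} \<in> edges G then 1 else 0),
     creg = (\<lambda>_. 0)(0 := b, 1 := \<xi>),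
     cmem = (\<lambda>_. 0)\<rparr>"

definition outputs_within :: "com \<Rightarrow> state \<Rightarrow> real \<Rightarrow> complex \<Rightarrow> bool" where
  "outputs_within c s T w \<longleftrightarrow> (\<exists>t s'. runs c s t s' \<and> real t \<le> T \<and> creg s' 0 = w)"

end

theory Submission
  imports Defs "HOL-Computational_Algebra.Polynomial_FPS" "HOL-Computational_Algebra.Fundamental_Theorem_Algebra"
begin

text \<open>
  Write \<open>H = L(G)\<close> and give every vertex \<open>u\<close> of \<open>H\<close> its own weight \<open>l u\<close>; weight \<open>0\<close> pins \<open>u\<close>
  outside the chosen set. Switching the edges at \<open>v\<close> one at a time shows that the ratio
  \<open>R\<^sub>v = Z(v inside) / Z(v outside)\<close> equals \<open>l v\<close> times a product of \<open>(b + r) / (1 + b r)\<close> over the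
  neighbours \<open>u\<close> of \<open>v\<close>, where \<open>r\<close> is the ratio at \<open>u\<close> after pinning \<open>v\<close> and rescaling the other weights
  at \<open>v\<close> by powers of \<open>1 / b\<close>. Moreover \<open>Z\<close> is the product of the \<open>1 + R\<^sub>v\<close> while the vertices are pinned
  one after another. If all weights are multiples of a power series \<open>z(t)\<close> with \<open>z(0) = 0\<close>, each level
  of the recursion gains one power of \<open>t\<close>, so a tree of depth \<open>K\<close> and bounded degree yields \<open>Z\<close> modulo
  \<open>t\<^bsup>K + 1\<^esup>\<close> exactly.

  With absolute values, the same recursion shows that \<open>Z\<close> has no zeros near \<open>0\<close>, uniformly in \<open>G\<close>. Hence,
  for fixed \<open>b\<close>, it is zero-free on a neighbourhood of the segment from \<open>0\<close> to \<open>\<xi>\<close>. Choose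
  \<open>z(t) = \<xi> \<phi>(t)\<close> with a rational polynomial \<open>\<phi>\<close> mapping a disc of radius \<open>\<beta> > 1\<close> into a thin
  neighbourhood of \<open>[0, 1]\<close>, with \<open>\<phi>(0) = 0\<close> and \<open>\<phi>(1) = 1\<close>. Then \<open>Z\<close> is a polynomial in \<open>t\<close> without
  zeros in that disc, so the Taylor series of its logarithm at \<open>t = 1\<close> may be cut off after \<open>O(log (n / \<epsilon>))\<close>
  terms (Barvinok). The exponential is replaced by \<open>(1 + x / 2\<^sup>K)\<close> raised to the power \<open>2\<^sup>K\<close>.

  The case \<open>b = 0\<close> cannot occur: for a path with \<open>k\<close> edges the partition function is then \<open>1 + z\<^sup>k\<close>,
  which vanishes in the sector for large \<open>k\<close>.
\<close>

subsection \<open>Weighted partition functions and pinning ratios\<close>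

text \<open>The ring stays open because the same identities are needed twice: over the complex
  numbers for the zero-free disc, and over power series for the algorithm. In power series all
  denominators have constant term 1. So the algorithm never divides by a value of a partition
  function, and pinned or rescaled graphs need not be zero-free at the actual parameters; apart from
  \<open>b \<noteq> 0\<close>, zero-freeness matters only for the error estimate. Powers of
  \<open>1 / b\<close> arise as follows. Next to an outside \<open>v\<close>, a neighbour pays 1
  when outside and b when inside; next to an inside \<open>v\<close> it pays b and 1. The second is
  b times the first, with the weight of the neighbour multiplied by \<open>1 / b^2\<close>. The
  sector does not contain 0, where the segment to \<open>\<xi>\<close> starts; this is why a disc
  around 0 has to be handled by hand. The machine has no exponential and no multiplication of
  naturals, and \<open>\<epsilon>\<close> is not an input. Hence squarings replace the exponential,
  the logarithm of n is found by doubling, and that of \<open>1 / \<epsilon>\<close> is a literal of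
  the program. The tree is affordable since its depth is logarithmic:
  \<open>(2 * \<Delta> + 1) ^ K\<close> is polynomial in \<open>n / \<epsilon>\<close>.\<close>

definition cut_size :: "(nat \<Rightarrow> nat \<Rightarrow> bool) \<Rightarrow> nat \<Rightarrow> nat set \<Rightarrow> nat" where
  "cut_size A m U = card {(u, w). u \<in> U \<and> w < m \<and> w \<notin> U \<and> A u w}"

definition wZ :: "(nat \<Rightarrow> nat \<Rightarrow> bool) \<Rightarrow> nat \<Rightarrow> 'a::comm_ring_1 \<Rightarrow> (nat \<Rightarrow> 'a) \<Rightarrow> 'a" where
  "wZ A m b l = (\<Sum>U\<in>Pow {..<m}. (\<Prod>u\<in>U. l u) * b ^ cut_size A m U)"

text \<open>A state of the switching process, with \<open>d = 1 / b\<close>: neighbours of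
  \<open>v\<close> below \<open>j\<close> already see \<open>v\<close> inside, the others still see
  it outside. The power of b that goes with each switch is collected separately.\<close>

definition nbr_scale :: "(nat \<Rightarrow> nat \<Rightarrow> bool) \<Rightarrow> 'a::comm_ring_1 \<Rightarrow> (nat \<Rightarrow> 'a) \<Rightarrow> nat \<Rightarrow> nat \<Rightarrow> nat \<Rightarrow> 'a" where
  "nbr_scale A d l v j = (\<lambda>w. if A v w \<and> w < j then l w * d ^ 2 else l w)"

text \<open>The state halfway through the switch of the edge from \<open>v\<close> to
  \<open>u\<close>: one factor \<open>d\<close> at \<open>u\<close> cancels the b that an inside
  \<open>u\<close> pays for its edge to the pinned \<open>v\<close>, so this edge is in effect
  deleted.\<close>

definition child_weight :: "(nat \<Rightarrow> nat \<Rightarrow> bool) \<Rightarrow> 'a::comm_ring_1 \<Rightarrow> (nat \<Rightarrow> 'a) \<Rightarrow> nat \<Rightarrow> nat \<Rightarrow> nat \<Rightarrow> 'a" where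
  "child_weight A d l v u = (nbr_scale A d (l(v := 0)) v u)(u := l u * d)"

text \<open>Z(v inside) / Z(v outside) without division, meaningful in every commutative ring and
  also where the denominator vanishes.\<close>

definition is_ratio :: "(nat \<Rightarrow> nat \<Rightarrow> bool) \<Rightarrow> nat \<Rightarrow> 'a::comm_ring_1 \<Rightarrow> (nat \<Rightarrow> 'a) \<Rightarrow> nat \<Rightarrow> 'a \<Rightarrow> bool" where
  "is_ratio A m b l v r \<longleftrightarrow> wZ A m b l = (1 + r) * wZ A m b (l(v := 0))"

lemma Pow_insert_split:
  fixes m v :: nat and f :: "nat set \<Rightarrow> 'a::comm_monoid_add"
  assumes "v < m"
  shows "(\<Sum>U\<in>Pow {..<m}. f U) = (\<Sum>U\<in>Pow ({..<m} - {v}). f U + f (insert v U))"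
proof -
  let ?V = "Pow ({..<m} - {v})"
  have "{..<m} = insert v ({..<m} - {v})" using assms by auto
  then have P: "Pow {..<m} = ?V \<union> insert v ` ?V" by (metis Pow_insert)
  have "inj_on (insert v) ?V" by (auto simp: inj_on_def)
  moreover have "sum f (?V \<union> insert v ` ?V) = sum f ?V + sum f (insert v ` ?V)"
    by (rule sum.union_disjoint) auto
  ultimately show ?thesis
    by (simp add: P sum.reindex sum.distrib)
qed

text \<open>The coefficient of \<open>l v\<close>; the partition function is affine in each single
  weight.\<close>

definition wJ :: "(nat \<Rightarrow> nat \<Rightarrow> bool) \<Rightarrow> nat \<Rightarrow> 'a::comm_ring_1 \<Rightarrow> (nat \<Rightarrow> 'a) \<Rightarrow> nat \<Rightarrow> 'a" where
  "wJ A m b l v = (\<Sum>U\<in>Pow ({..<m} - {v}). (\<Prod>u\<in>U. l u) * b ^ cut_size A m (insert v U))"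

lemma wZ_zero:
  assumes "v < m"
  shows "wZ A m b (l(v := 0)) = (\<Sum>U\<in>Pow ({..<m} - {v}). (\<Prod>u\<in>U. l u) * b ^ cut_size A m U)"
proof -
  have *: "(\<Prod>u\<in>insert v U. (l(v := 0)) u) = 0" "(\<Prod>u\<in>U. (l(v := 0)) u) = (\<Prod>u\<in>U. l u)"
    if "U \<in> Pow ({..<m} - {v})" for U
  proof -
    have "finite U" using that by (auto intro: finite_subset)
    then show "(\<Prod>u\<in>insert v U. (l(v := 0)) u) = 0" using that by (subst prod.insert) auto
    show "(\<Prod>u\<in>U. (l(v := 0)) u) = (\<Prod>u\<in>U. l u)" using that by (intro prod.cong) auto
  qed
  show ?thesis
    unfolding wZ_def Pow_insert_split[OF assms] by (intro sum.cong refl) (simp only: *, simp)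
qed

lemma wZ_upd:
  assumes "v < m"
  shows "wZ A m b (l(v := x)) = wZ A m b (l(v := 0)) + x * wJ A m b l v"
proof -
  have *: "(\<Prod>u\<in>insert v U. (l(v := x)) u) = x * (\<Prod>u\<in>U. l u)"
    "(\<Prod>u\<in>U. (l(v := x)) u) = (\<Prod>u\<in>U. l u)"
    if "U \<in> Pow ({..<m} - {v})" for U
  proof -
    have f: "finite U" "v \<notin> U" using that by (auto intro: finite_subset)
    have e: "(\<Prod>u\<in>U. (l(v := x)) u) = (\<Prod>u\<in>U. l u)" using that by (intro prod.cong) auto
    show "(\<Prod>u\<in>insert v U. (l(v := x)) u) = x * (\<Prod>u\<in>U. l u)"
      using f e by (subst prod.insert) auto
    show "(\<Prod>u\<in>U. (l(v := x)) u) = (\<Prod>u\<in>U. l u)" by (rule e)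
  qed
  have "wZ A m b (l(v := x)) = (\<Sum>U\<in>Pow ({..<m} - {v}).
      (\<Prod>u\<in>U. l u) * b ^ cut_size A m U + x * ((\<Prod>u\<in>U. l u) * b ^ cut_size A m (insert v U)))"
    unfolding wZ_def Pow_insert_split[OF assms]
    by (intro sum.cong refl) (simp only: *, simp add: algebra_simps)
  then show ?thesis
    by (simp add: wZ_zero[OF assms] wJ_def sum.distrib sum_distrib_left)
qed

lemma wZ_eq_wJ:
  assumes "v < m"
  shows "wZ A m b l = wZ A m b (l(v := 0)) + l v * wJ A m b l v"
  using wZ_upd[OF assms, of A b l "l v"] by simp

locale adjacency =
  fixes A :: "nat \<Rightarrow> nat \<Rightarrow> bool" and m :: nat
  assumes sym: "A u v \<Longrightarrow> A v u" and irrefl: "\<not> A v v"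
begin

text \<open>Inserting \<open>v\<close> creates its edges to the outside and destroys those into
  \<open>U\<close>; the remaining cut pairs \<open>?C\<close> are common to both sides.\<close>

lemma cut_size_insert:
  assumes U: "U \<subseteq> {..<m}" and v: "v < m" "v \<notin> U"
  shows "cut_size A m (insert v U) + 2 * card {u\<in>U. A v u} = cut_size A m U + card {u. u < m \<and> A v u}"
proof -
  have fU: "finite U" using U by (auto intro: finite_subset)
  let ?C = "{(u, w). u \<in> U \<and> w < m \<and> w \<notin> U \<and> w \<noteq> v \<and> A u w}"
  have fC: "finite ?C" by (rule finite_subset[of _ "U \<times> {..<m}"]) (use fU in auto)
  have "{(u, w). u \<in> insert v U \<and> w < m \<and> w \<notin> insert v U \<and> A u w}
      = ?C \<union> Pair v ` {w. w < m \<and> w \<notin> U \<and> A v w}"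
    using v irrefl by auto
  moreover have "card (?C \<union> Pair v ` {w. w < m \<and> w \<notin> U \<and> A v w})
      = card ?C + card (Pair v ` {w. w < m \<and> w \<notin> U \<and> A v w})"
    by (rule card_Un_disjoint) (use fC v in auto)
  ultimately have 1: "cut_size A m (insert v U) = card ?C + card {w. w < m \<and> w \<notin> U \<and> A v w}"
    unfolding cut_size_def by (simp add: card_image inj_on_def)
  have "{(u, w). u \<in> U \<and> w < m \<and> w \<notin> U \<and> A u w} = ?C \<union> (\<lambda>u. (u, v)) ` {u\<in>U. A v u}"
    using v sym by auto
  moreover have "card (?C \<union> (\<lambda>u. (u, v)) ` {u\<in>U. A v u})
      = card ?C + card ((\<lambda>u. (u, v)) ` {u\<in>U. A v u})"
    by (rule card_Un_disjoint) (use fC fU in auto)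
  ultimately have 2: "cut_size A m U = card ?C + card {u\<in>U. A v u}"
    unfolding cut_size_def by (simp add: card_image inj_on_def)
  have "{u. u < m \<and> A v u} = {w. w < m \<and> w \<notin> U \<and> A v w} \<union> {u\<in>U. A v u}" using U by auto
  then have 3: "card {u. u < m \<and> A v u} = card {w. w < m \<and> w \<notin> U \<and> A v w} + card {u\<in>U. A v u}"
    using fU by (simp add: card_Un_disjoint disjoint_iff)
  show ?thesis using 1 2 3 by simp
qed

lemma wJ_eq:
  fixes b d :: "'a::comm_ring_1"
  assumes bd: "b * d = 1" and v: "v < m"
  shows "wJ A m b l v = b ^ card {u. u < m \<and> A v u} * wZ A m b (nbr_scale A d (l(v := 0)) v m)"
proof -
  let ?l = "nbr_scale A d l v m"
  have eq: "nbr_scale A d (l(v := 0)) v m = ?l(v := 0)"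
    using irrefl by (auto simp: nbr_scale_def fun_eq_iff)
  have "(\<Prod>u\<in>U. l u) * b ^ cut_size A m (insert v U)
      = b ^ card {u. u < m \<and> A v u} * ((\<Prod>u\<in>U. ?l u) * b ^ cut_size A m U)"
    if "U \<in> Pow ({..<m} - {v})" for U
  proof -
    have U: "U \<subseteq> {..<m}" "v \<notin> U" and fU: "finite U" using that by (auto intro: finite_subset)
    have "(\<Prod>u\<in>U. ?l u) = (\<Prod>u\<in>U. l u * (if A v u then d ^ 2 else 1))"
      using U by (intro prod.cong) (auto simp: nbr_scale_def)
    also have "\<dots> = (\<Prod>u\<in>U. l u) * d ^ (2 * card {u\<in>U. A v u})"
      using fU by (simp add: prod.distrib prod.If_cases Int_def power_mult)
    finally have p: "(\<Prod>u\<in>U. ?l u) = (\<Prod>u\<in>U. l u) * d ^ (2 * card {u\<in>U. A v u})" .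
    let ?k = "2 * card {u\<in>U. A v u}"
    have one: "b ^ ?k * d ^ ?k = 1" using bd by (metis power_mult_distrib power_one)
    have "b ^ card {u. u < m \<and> A v u} * ((\<Prod>u\<in>U. ?l u) * b ^ cut_size A m U)
        = (\<Prod>u\<in>U. l u) * d ^ ?k * b ^ (cut_size A m U + card {u. u < m \<and> A v u})"
      by (simp add: p power_add algebra_simps)
    also have "\<dots> = (\<Prod>u\<in>U. l u) * b ^ cut_size A m (insert v U) * (b ^ ?k * d ^ ?k)"
      by (simp add: cut_size_insert[OF U(1) v U(2), symmetric] power_add algebra_simps)
    finally show ?thesis using one by simp
  qed
  then show ?thesis
    unfolding eq wZ_zero[OF v] wJ_def sum_distrib_left by (intro sum.cong) auto
qed

text \<open>Let \<open>Z0\<close> be the part with \<open>u\<close> outside and let \<open>r\<close>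
  be the ratio with the edge deleted. Restoring the edge to an outside \<open>v\<close> gives
  \<open>Z0 * (1 + b * r)\<close>; restoring it to an inside \<open>v\<close> gives
  \<open>Z0 * (b + r)\<close>.\<close>

lemma is_ratio_step:
  fixes b d :: "'a::comm_ring_1"
  assumes bd: "b * d = 1" and v: "v < m" and u: "u < m" "A v u"
    and r: "is_ratio A m b (child_weight A d l v u) u r"
  shows "b * wZ A m b (nbr_scale A d (l(v := 0)) v (Suc u)) * (1 + b * r)
       = wZ A m b (nbr_scale A d (l(v := 0)) v u) * (b + r)"
proof -
  let ?s = "nbr_scale A d (l(v := 0)) v u"
  have uv: "u \<noteq> v" using u irrefl by auto
  have su: "?s u = l u" using uv by (simp add: nbr_scale_def)
  have Suc: "nbr_scale A d (l(v := 0)) v (Suc u) = ?s(u := l u * d ^ 2)"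
    using uv u by (auto simp: nbr_scale_def fun_eq_iff less_Suc_eq)
  define Z0 where "Z0 = wZ A m b (?s(u := 0))"
  define J where "J = wJ A m b ?s u"
  have a: "wZ A m b (?s(u := l u * d)) = Z0 + l u * d * J"
    unfolding Z0_def J_def by (rule wZ_upd[OF u(1)])
  have c: "wZ A m b (?s(u := l u * d ^ 2)) = Z0 + l u * d ^ 2 * J"
    unfolding Z0_def J_def by (rule wZ_upd[OF u(1)])
  have e: "wZ A m b ?s = Z0 + l u * J"
    using wZ_eq_wJ[OF u(1), of A b ?s] by (simp add: Z0_def J_def su)
  have ratio: "l u * d * J = r * Z0"
    using r a by (simp add: is_ratio_def child_weight_def Z0_def algebra_simps)
  have "b * (Z0 + l u * d ^ 2 * J) = b * Z0 + (b * d) * (l u * d * J)"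
    by (simp add: algebra_simps power2_eq_square)
  then have c': "b * (Z0 + l u * d ^ 2 * J) = b * Z0 + r * Z0" using bd ratio by simp
  have "Z0 + l u * J = Z0 + b * (l u * d * J)"
    using bd by (metis mult.assoc mult.commute mult_1)
  then have e': "Z0 + l u * J = Z0 + b * (r * Z0)" using ratio by simp
  show ?thesis unfolding Suc c e c' e' by (simp add: algebra_simps)
qed

text \<open>The single switches telescope over the neighbours in increasing order. The identity is
  cross-multiplied, since nothing is known yet about the factors \<open>1 + b * r u\<close>.\<close>

lemma is_ratio_prefix:
  fixes b d :: "'a::comm_ring_1"
  assumes bd: "b * d = 1" and v: "v < m" and j: "j \<le> m"
    and r: "\<And>u. u < m \<Longrightarrow> A v u \<Longrightarrow> is_ratio A m b (child_weight A d l v u) u (r u)"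
  shows "b ^ card {u. u < j \<and> A v u} * wZ A m b (nbr_scale A d (l(v := 0)) v j) * (\<Prod>u | u < j \<and> A v u. 1 + b * r u)
       = wZ A m b (l(v := 0)) * (\<Prod>u | u < j \<and> A v u. b + r u)"
  using j
proof (induction j)
  case 0
  then show ?case by (simp add: nbr_scale_def)
next
  case (Suc j)
  show ?case
  proof (cases "A v j")
    case True
    have S: "{u. u < Suc j \<and> A v u} = insert j {u. u < j \<and> A v u}" using True by auto
    have IH: "b ^ card {u. u < j \<and> A v u} * wZ A m b (nbr_scale A d (l(v := 0)) v j) * (\<Prod>u | u < j \<and> A v u. 1 + b * r u)
       = wZ A m b (l(v := 0)) * (\<Prod>u | u < j \<and> A v u. b + r u)" using Suc by (simp del: fun_upd_apply)
    have st: "b * wZ A m b (nbr_scale A d (l(v := 0)) v (Suc j)) * (1 + b * r j)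
       = wZ A m b (nbr_scale A d (l(v := 0)) v j) * (b + r j)"
      using Suc.prems True by (intro is_ratio_step[OF bd v]) (auto intro: r)
    have "b ^ card {u. u < Suc j \<and> A v u} * wZ A m b (nbr_scale A d (l(v := 0)) v (Suc j)) * (\<Prod>u | u < Suc j \<and> A v u. 1 + b * r u)
       = (b ^ card {u. u < j \<and> A v u} * (\<Prod>u | u < j \<and> A v u. 1 + b * r u)) * (b * wZ A m b (nbr_scale A d (l(v := 0)) v (Suc j)) * (1 + b * r j))"
      by (simp add: S algebra_simps)
    also have "\<dots> = (b + r j) * (b ^ card {u. u < j \<and> A v u} * wZ A m b (nbr_scale A d (l(v := 0)) v j) * (\<Prod>u | u < j \<and> A v u. 1 + b * r u))"
      unfolding st by (simp add: algebra_simps)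
    finally show ?thesis unfolding IH S by (simp add: algebra_simps del: fun_upd_apply)
  next
    case False
    have S: "{u. u < Suc j \<and> A v u} = {u. u < j \<and> A v u}" using False by (auto simp: less_Suc_eq)
    have "nbr_scale A d (l(v := 0)) v (Suc j) = nbr_scale A d (l(v := 0)) v j"
      using False by (auto simp: nbr_scale_def fun_eq_iff less_Suc_eq)
    then show ?thesis using Suc unfolding S by (simp del: fun_upd_apply)
  qed
qed

text \<open>The integral domain is there to cancel the product of the denominators. The quotients
  \<open>q\<close> are given by their equation, so that both division of complex numbers and
  inverses of power series fit.\<close>

lemma is_ratio_recursion:
  fixes b d :: "'a::idom"
  assumes bd: "b * d = 1" and v: "v < m"
    and r: "\<And>u. u < m \<Longrightarrow> A v u \<Longrightarrow> is_ratio A m b (child_weight A d l v u) u (r u)"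
    and q: "\<And>u. u < m \<Longrightarrow> A v u \<Longrightarrow> q u * (1 + b * r u) = b + r u"
    and nz: "\<And>u. u < m \<Longrightarrow> A v u \<Longrightarrow> 1 + b * r u \<noteq> 0"
  shows "is_ratio A m b l v (l v * (\<Prod>u | u < m \<and> A v u. q u))"
proof -
  let ?N = "{u. u < m \<and> A v u}"
  have "(\<Prod>u\<in>?N. q u) * (\<Prod>u\<in>?N. 1 + b * r u) = (\<Prod>u\<in>?N. b + r u)"
    unfolding prod.distrib[symmetric] by (intro prod.cong) (auto simp: q)
  moreover have "b ^ card ?N * wZ A m b (nbr_scale A d (l(v := 0)) v m) * (\<Prod>u\<in>?N. 1 + b * r u)
       = wZ A m b (l(v := 0)) * (\<Prod>u\<in>?N. b + r u)"
    by (rule is_ratio_prefix[OF bd v order.refl r])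
  ultimately have "wJ A m b l v * (\<Prod>u\<in>?N. 1 + b * r u)
      = (wZ A m b (l(v := 0)) * (\<Prod>u\<in>?N. q u)) * (\<Prod>u\<in>?N. 1 + b * r u)"
    unfolding wJ_eq[OF bd v] by (simp add: mult.assoc)
  moreover have "(\<Prod>u\<in>?N. 1 + b * r u) \<noteq> 0" using nz by (subst prod_zero_iff) auto
  ultimately have "wJ A m b l v = wZ A m b (l(v := 0)) * (\<Prod>u\<in>?N. q u)" by simp
  then show ?thesis
    unfolding is_ratio_def by (subst wZ_eq_wJ[OF v]) (simp add: algebra_simps)
qed

end

subsection \<open>Power series of the ratios\<close>

text \<open>Edges of the tree use \<open>a = c = b\<close>. The choice \<open>a = 1\<close>,
  \<open>c = 0\<close> yields \<open>1 + r\<close>, so that the final product over all vertices can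
  be treated as one more node.\<close>

definition edge_factor :: "complex fps \<Rightarrow> complex fps \<Rightarrow> complex fps \<Rightarrow> complex fps" where
  "edge_factor a c r = (a + r) * inverse (1 + c * r)"

text \<open>All weights are scalar multiples of one series \<open>z\<close>, so only the scalars
  \<open>\<mu>\<close> are carried along. At depth 0 all that matters is that the constant term
  vanishes.\<close>

primrec ratio_approx :: "(nat \<Rightarrow> nat \<Rightarrow> bool) \<Rightarrow> nat \<Rightarrow> complex \<Rightarrow> complex fps \<Rightarrow> nat \<Rightarrow> nat \<Rightarrow> (nat \<Rightarrow> complex) \<Rightarrow> complex fps" where
  "ratio_approx A m b z 0 v \<mu> = fps_const (\<mu> v) * z"
| "ratio_approx A m b z (Suc k) v \<mu> = fps_const (\<mu> v) * z *
     (\<Prod>u | u < m \<and> A v u. edge_factor (fps_const b) (fps_const b)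
        (ratio_approx A m b z k u (child_weight A (1 / b) \<mu> v u)))"

lemma ratio_approx_nth_0: "fps_nth z 0 = 0 \<Longrightarrow> fps_nth (ratio_approx A m b z k v \<mu>) 0 = 0"
  by (cases k) simp_all

lemma inverse_one_plus:
  fixes c r :: "complex fps"
  shows "fps_nth r 0 = 0 \<Longrightarrow> inverse (1 + c * r) * (1 + c * r) = 1"
  by (rule inverse_mult_eq_1) simp

text \<open>The two values differ by \<open>(r - r') * (1 - a * c)\<close> times the inverses of
  both denominators, which are units.\<close>

lemma edge_factor_cong:
  fixes c r r' :: "complex fps"
  assumes "fps_nth r 0 = 0" "fps_nth r' 0 = 0" "p dvd r - r'"
  shows "p dvd edge_factor a c r - edge_factor a c r'"
proof -
  let ?i = "inverse (1 + c * r)" and ?j = "inverse (1 + c * r')"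
  have i: "?i * (1 + c * r) = 1" and j: "?j * (1 + c * r') = 1"
    using assms by (simp_all add: inverse_one_plus)
  have "edge_factor a c r - edge_factor a c r'
      = (a + r) * ?i * (?j * (1 + c * r')) - (a + r') * ?j * (?i * (1 + c * r))"
    by (simp add: i j edge_factor_def)
  also have "\<dots> = (r - r') * ((1 - a * c) * ?i * ?j)" by (simp add: algebra_simps)
  finally show ?thesis using assms by simp
qed

lemma dvd_diff_prod:
  fixes f g :: "'b \<Rightarrow> 'a::comm_ring_1"
  assumes "\<And>x. x \<in> S \<Longrightarrow> p dvd f x - g x"
  shows "p dvd prod f S - prod g S"
  using assms
proof (induction S rule: infinite_finite_induct)
  case (insert x F)
  have "prod f (insert x F) - prod g (insert x F)
      = (f x - g x) * prod f F + g x * (prod f F - prod g F)"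
    using insert.hyps by (simp add: algebra_simps)
  then show ?case using insert by (auto intro!: dvd_add)
qed auto

lemma fps_X_power_dvd_imp_nth_0:
  fixes f :: "complex fps"
  shows "fps_X ^ n dvd f \<Longrightarrow> i < n \<Longrightarrow> fps_nth f i = 0"
  by (auto simp: dvd_def fps_X_power_mult_nth)

context adjacency
begin

lemma wZ_nth_0:
  fixes l :: "nat \<Rightarrow> complex fps"
  assumes "\<And>u. fps_nth (l u) 0 = 0"
  shows "fps_nth (wZ A m b l) 0 = 1"
proof -
  have "fps_nth (\<Prod>u\<in>U. l u) 0 = (if U = {} then 1 else 0)" if "U \<in> Pow {..<m}" for U
  proof (cases "U = {}")
    case False
    have "finite U" using that by (auto intro: finite_subset)
    then show ?thesis using False
      by (induction U rule: finite_ne_induct) (auto simp: assms)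
  qed simp
  then have "fps_nth (wZ A m b l) 0 = (\<Sum>U\<in>Pow {..<m}. if U = {} then (fps_nth b 0) ^ cut_size A m {} else 0)"
    unfolding wZ_def fps_sum_nth by (intro sum.cong) (auto simp: fps_power_zeroth)
  also have "\<dots> = 1" by (subst sum.delta) (auto simp: cut_size_def)
  finally show ?thesis .
qed

lemma child_weight_hom:
  assumes "h 0 = 0" "\<And>x y. h (x * y) = h x * g y" "g (d ^ 2) = e ^ 2" "g d = e"
  shows "child_weight A e (\<lambda>w. h (\<mu> w)) v u = (\<lambda>w. h (child_weight A d \<mu> v u w))"
  using assms by (auto simp: child_weight_def nbr_scale_def fun_eq_iff)

lemma child_weight_fps:
  "child_weight A (fps_const d) (\<lambda>w. fps_const (\<mu> w) * z) v u
   = (\<lambda>w. fps_const (child_weight A d \<mu> v u w) * z)"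
  by (rule child_weight_hom[where g = fps_const])
     (auto simp: fps_const_mult[symmetric] power2_eq_square simp del: fps_const_mult)

text \<open>The denominator \<open>Z(v outside)\<close> has constant term 1, because only the empty
  set contributes to it, and is therefore a unit.\<close>

lemma ratio_exists:
  fixes l :: "nat \<Rightarrow> complex fps"
  assumes "\<And>u. fps_nth (l u) 0 = 0"
  shows "\<exists>r. is_ratio A m b l v r \<and> fps_nth r 0 = 0"
proof (intro exI conjI)
  let ?Z0 = "wZ A m b (l(v := 0))"
  let ?r = "(wZ A m b l - ?Z0) * inverse ?Z0"
  have 1: "fps_nth ?Z0 0 = 1" "fps_nth (wZ A m b l) 0 = 1" using assms by (auto intro!: wZ_nth_0)
  then have "inverse ?Z0 * ?Z0 = 1" by (intro inverse_mult_eq_1) simp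
  then show "is_ratio A m b l v ?r" by (simp add: is_ratio_def algebra_simps)
  show "fps_nth ?r 0 = 0" using 1 by simp
qed

lemma is_ratio_unique:
  fixes l :: "nat \<Rightarrow> complex fps"
  assumes "\<And>u. fps_nth (l u) 0 = 0" "is_ratio A m b l v r" "is_ratio A m b l v r'"
  shows "r = r'"
proof -
  have "fps_nth (wZ A m b (l(v := 0))) 0 = 1" using assms by (auto intro!: wZ_nth_0)
  then have "wZ A m b (l(v := 0)) \<noteq> 0" by auto
  then show ?thesis using assms by (auto simp: is_ratio_def)
qed

text \<open>By induction the factors of the children agree modulo \<open>fps_X ^ Suc k\<close>; the
  prefactor \<open>z\<close> contributes one further \<open>fps_X\<close>.\<close>

lemma ratio_approx_correct:
  assumes b: "b \<noteq> 0" and z: "fps_nth z 0 = 0" and v: "v < m"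
    and r: "is_ratio A m (fps_const b) (\<lambda>w. fps_const (\<mu> w) * z) v r"
  shows "fps_X ^ Suc k dvd r - ratio_approx A m b z k v \<mu>"
  using v r
proof (induction k arbitrary: v \<mu> r)
  case (0 v \<mu> r)
  let ?l = "\<lambda>w. fps_const (\<mu> w) * z"
  have "\<exists>r'. is_ratio A m (fps_const b) ?l v r' \<and> fps_nth r' 0 = 0"
    by (rule ratio_exists) (simp add: z)
  then have "fps_nth r 0 = 0" using is_ratio_unique[OF _ 0(2)] z by (metis fps_mult_nth_0 mult_zero_right)
  then have "(r - fps_const (\<mu> v) * z) = fps_X * fps_shift 1 (r - fps_const (\<mu> v) * z)"
    using z by (intro fps_ext) (auto simp: fps_X_mult_nth)
  then have "fps_X dvd r - fps_const (\<mu> v) * z" by (rule dvdI)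
  then show ?case by simp
next
  case (Suc k v \<mu> r)
  let ?l = "\<lambda>w. fps_const (\<mu> w) * z" and ?b = "fps_const b" and ?d = "fps_const (1 / b)"
  have bd: "?b * ?d = 1" using b by simp
  let ?c = "\<lambda>u. child_weight A (1 / b) \<mu> v u"
  have "\<exists>r'. is_ratio A m ?b (\<lambda>w. fps_const (?c u w) * z) u r' \<and> fps_nth r' 0 = 0" for u
    by (rule ratio_exists) (simp add: z)
  then obtain R where R: "\<And>u. is_ratio A m ?b (\<lambda>w. fps_const (?c u w) * z) u (R u)" "\<And>u. fps_nth (R u) 0 = 0"
    by metis
  have "is_ratio A m ?b ?l v (?l v * (\<Prod>u | u < m \<and> A v u. edge_factor ?b ?b (R u)))"
  proof (rule is_ratio_recursion[OF bd Suc.prems(1)])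
    show "is_ratio A m ?b (child_weight A ?d ?l v u) u (R u)" for u
      unfolding child_weight_fps by (rule R)
    show "edge_factor ?b ?b (R u) * (1 + ?b * R u) = ?b + R u" for u
      using inverse_one_plus[OF R(2)] by (simp add: edge_factor_def mult.assoc)
    show "1 + ?b * R u \<noteq> 0" for u
      using inverse_one_plus[OF R(2)] by (metis mult_zero_right zero_neq_one)
  qed
  then have req: "r = ?l v * (\<Prod>u | u < m \<and> A v u. edge_factor ?b ?b (R u))"
    by (intro is_ratio_unique[OF _ Suc.prems(2)]) (simp_all add: z)
  have "fps_X ^ Suc k dvd (\<Prod>u | u < m \<and> A v u. edge_factor ?b ?b (R u)) -
      (\<Prod>u | u < m \<and> A v u. edge_factor ?b ?b (ratio_approx A m b z k u (?c u)))" (is "_ dvd ?D")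
    using Suc.IH R by (intro dvd_diff_prod edge_factor_cong) (auto simp: z ratio_approx_nth_0)
  moreover have "z = fps_X * fps_shift 1 z"
    using z by (intro fps_ext) (auto simp: fps_X_mult_nth)
  then have "fps_X dvd fps_const (\<mu> v) * z" by (intro dvd_mult dvdI)
  ultimately have "fps_X * fps_X ^ Suc k dvd (fps_const (\<mu> v) * z) * ?D" by (rule mult_dvd_mono[rotated])
  then show ?case by (simp add: req algebra_simps)
qed

lemma wZ_telescope:
  assumes j: "j \<le> m" and r: "\<And>v. v < m \<Longrightarrow> is_ratio A m b (\<lambda>w. if w < v then 0 else l w) v (r v)"
  shows "wZ A m b l = (\<Prod>v<j. 1 + r v) * wZ A m b (\<lambda>w. if w < j then 0 else l w)"
  using j
proof (induction j)
  case (Suc j)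
  have "(\<lambda>w. if w < Suc j then 0 else l w) = (\<lambda>w. if w < j then 0 else l w)(j := 0)"
    by (auto simp: fun_eq_iff less_Suc_eq)
  then show ?case using Suc r[of j] by (simp add: is_ratio_def mult.assoc del: fun_upd_apply)
qed simp

lemma wZ_all_zero:
  assumes "\<And>u. u < m \<Longrightarrow> l u = 0"
  shows "wZ A m b l = 1"
proof -
  have "(\<Prod>u\<in>U. l u) * b ^ cut_size A m U = (if U = {} then 1 else 0)" if "U \<in> Pow {..<m}" for U
  proof (cases "U = {}")
    case False
    then obtain u where "u \<in> U" by auto
    moreover have "finite U" using that by (auto intro: finite_subset)
    moreover have "l u = 0" using that \<open>u \<in> U\<close> assms by auto
    ultimately have "(\<Prod>u\<in>U. l u) = 0" by (meson prod_zero)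
    then show ?thesis using False by simp
  qed (simp add: cut_size_def)
  then have "wZ A m b l = (\<Sum>U\<in>Pow {..<m}. if U = {} then 1 else 0)"
    unfolding wZ_def by (intro sum.cong) auto
  then show ?thesis by (subst (asm) sum.delta) auto
qed

lemma wZ_fps_approx:
  assumes b: "b \<noteq> 0" and z: "fps_nth z 0 = 0" and i: "i \<le> k"
  shows "fps_nth (wZ A m (fps_const b) (\<lambda>_. z)) i =
    fps_nth (\<Prod>v<m. 1 + ratio_approx A m b z k v (\<lambda>w. if w < v then 0 else 1)) i"
proof -
  let ?\<mu> = "\<lambda>v w. if w < v then 0 else 1 :: complex"
  have "\<exists>r'. is_ratio A m (fps_const b) (\<lambda>w. fps_const (?\<mu> v w) * z) v r'" for v
using ratio_exists[of "\<lambda>w. fps_const (?\<mu> v w) * z" "fps_const b" v] by (simp add: z) blast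
  then obtain r where r: "\<And>v. is_ratio A m (fps_const b) (\<lambda>w. fps_const (?\<mu> v w) * z) v (r v)"
    by metis
  have eq: "(\<lambda>w. fps_const (?\<mu> v w) * z) = (\<lambda>w. if w < v then 0 else z)" for v by auto
  have Z: "wZ A m (fps_const b) (\<lambda>_. z) = (\<Prod>v<m. 1 + r v)"
    using wZ_telescope[of m "fps_const b" "\<lambda>_. z" r] r unfolding eq
    by (simp add: wZ_all_zero)
  have "fps_X ^ Suc k dvd (\<Prod>v<m. 1 + r v) - (\<Prod>v<m. 1 + ratio_approx A m b z k v (?\<mu> v))"
    using ratio_approx_correct[OF b z _ r] by (intro dvd_diff_prod) auto
  then show ?thesis using fps_X_power_dvd_imp_nth_0[of "Suc k" _ i] i unfolding Z by fastforce
qed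

text \<open>The recursion rescales a weight only when it pins a further neighbour, and then by at most \<open>B\<^sup>2\<close>;
  hence the weights stay below \<open>x * B ^ (2 * D)\<close>.\<close>

lemma ratio_bound:
  fixes b :: complex
  assumes b: "b \<noteq> 0" and B: "B \<ge> 1" "cmod (1 / b) \<le> B"
    and D: "\<And>u. u < m \<Longrightarrow> card {w. w < m \<and> A u w} \<le> D"
    and \<rho>: "0 < \<rho>" "\<rho> \<le> 1 / 2" "cmod b * \<rho> \<le> 1 / 2"
    and x: "x \<ge> 0" "x * B ^ (2 * D) * (2 * (cmod b + 1)) ^ D \<le> \<rho>"
    and l: "\<And>u. u < m \<Longrightarrow> cmod (l u) \<le> x * B ^ (2 * card {w. w < m \<and> A u w \<and> l w = 0})"
  shows "wZ A m b l \<noteq> 0 \<and> (\<forall>v<m. \<exists>r. is_ratio A m b l v r \<and> cmod r \<le> \<rho>)"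
  using l
\<comment> \<open>Pinning a vertex and passing to a child both turn a nonzero weight into 0 and
  never revive a zero weight, so the number of unpinned vertices decreases.\<close>
proof (induction "card {u. u < m \<and> l u \<noteq> 0}" arbitrary: l rule: less_induct)
  case less
  let ?d = "1 / b"
  have bd: "b * ?d = 1" using b by simp
  let ?good = "\<lambda>l. \<forall>u<m. cmod (l u) \<le> x * B ^ (2 * card {w. w < m \<and> A u w \<and> l w = 0})"
  have zero_good: "?good (l(v := 0))" for v
  proof (intro allI impI)
    fix u assume u: "u < m"
    have "card {w. w < m \<and> A u w \<and> l w = 0} \<le> card {w. w < m \<and> A u w \<and> (l(v := 0)) w = 0}"
      by (rule card_mono) auto
    then have "B ^ (2 * card {w. w < m \<and> A u w \<and> l w = 0}) \<le> B ^ (2 * card {w. w < m \<and> A u w \<and> (l(v := 0)) w = 0})"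
      using B by (intro power_increasing) auto
    then have "x * B ^ (2 * card {w. w < m \<and> A u w \<and> l w = 0}) \<le> x * B ^ (2 * card {w. w < m \<and> A u w \<and> (l(v := 0)) w = 0})"
      using x(1) by (rule mult_left_mono)
    then show "cmod ((l(v := 0)) u) \<le> x * B ^ (2 * card {w. w < m \<and> A u w \<and> (l(v := 0)) w = 0})"
      using less.prems[OF u] x B by (cases "u = v") auto
  qed
  have smaller: "card {u. u < m \<and> l' u \<noteq> 0} < card {u. u < m \<and> l u \<noteq> 0}"
    if "v < m" "l v \<noteq> 0" "\<And>u. l u = 0 \<Longrightarrow> l' u = 0" "l' v = 0" for v and l' :: "nat \<Rightarrow> complex"
    using that by (intro psubset_card_mono) auto
  have "\<exists>r. is_ratio A m b l v r \<and> cmod r \<le> \<rho>" if v: "v < m" for v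
  proof (cases "l v = 0")
    case True
    then have "l(v := 0) = l" by auto
    then show ?thesis using \<rho> by (intro exI[of _ 0]) (simp add: is_ratio_def del: fun_upd_apply)
  next
    case False
    have "\<exists>r. is_ratio A m b (child_weight A ?d l v u) u r \<and> cmod r \<le> \<rho>" if u: "u < m" "A v u" for u
    proof -
      let ?c = "child_weight A ?d l v u"
      have uv: "u \<noteq> v" using u irrefl by auto
      have cv: "?c v = 0" using uv by (auto simp: child_weight_def nbr_scale_def)
      have c0: "?c w = 0" if "l w = 0" for w using that by (auto simp: child_weight_def nbr_scale_def)
      have "?good ?c"
      proof (intro allI impI)
        fix w assume w: "w < m"
        let ?S = "{y. y < m \<and> A w y \<and> l y = 0}" and ?S' = "{y. y < m \<and> A w y \<and> ?c y = 0}"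
        have sub: "?S \<subseteq> ?S'" using c0 by auto
        show "cmod (?c w) \<le> x * B ^ (2 * card ?S')"
        proof (cases "w \<noteq> v \<and> A v w")
          case True
          \<comment> \<open>\<open>v\<close> had a nonzero weight before and is pinned now. The
            allowed exponent at its neighbour \<open>w\<close> thus grows by 2, which pays for the
            factor of at most \<open>B ^ 2\<close>.\<close>
          have "insert v ?S \<subseteq> ?S'" using sub cv True sym v by auto
          then have "card (insert v ?S) \<le> card ?S'" by (intro card_mono) auto
          then have cS: "Suc (card ?S) \<le> card ?S'" using False by simp
          have "cmod (?c w) \<le> cmod (l w) * B ^ 2"
          proof -
            have "cmod (l w) * cmod ?d ^ 2 \<le> cmod (l w) * B ^ 2"
              using B by (intro mult_left_mono power_mono) auto
            moreover have "cmod (l w) * cmod ?d \<le> cmod (l w) * B ^ 2"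
            proof (intro mult_left_mono)
              have "B * 1 \<le> B * B" using B by (intro mult_left_mono) auto
              then show "cmod ?d \<le> B ^ 2" using B(2) unfolding power2_eq_square by linarith
            qed auto
            moreover have "cmod (l w) * 1 \<le> cmod (l w) * B ^ 2"
              using B by (intro mult_left_mono) auto
            ultimately show ?thesis using True
              by (auto simp: child_weight_def nbr_scale_def norm_mult norm_power norm_divide)
          qed
          also have "\<dots> \<le> x * B ^ (2 * card ?S) * B ^ 2"
            using less.prems[OF w] B by (intro mult_right_mono) auto
          also have "\<dots> = x * B ^ (2 * Suc (card ?S))" by (simp add: power_add power2_eq_square)
          also have "\<dots> \<le> x * B ^ (2 * card ?S')"
            using x B cS by (intro mult_left_mono power_increasing) auto
          finally show ?thesis .
        next
          case F: False
          then have "cmod (?c w) \<le> cmod (l w)"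
            using u uv by (auto simp: child_weight_def nbr_scale_def)
          also have "\<dots> \<le> x * B ^ (2 * card ?S)" using less.prems[OF w] .
          also have "\<dots> \<le> x * B ^ (2 * card ?S')"
            using x B sub by (intro mult_left_mono power_increasing mult_left_mono card_mono) auto
          finally show ?thesis .
        qed
      qed
      then show ?thesis using less.hyps[of ?c] smaller[OF v False, of ?c] cv c0 u by blast
    qed
    then obtain r where r: "\<And>u. u < m \<Longrightarrow> A v u \<Longrightarrow> is_ratio A m b (child_weight A ?d l v u) u (r u)"
      "\<And>u. u < m \<Longrightarrow> A v u \<Longrightarrow> cmod (r u) \<le> \<rho>" by metis
    have den: "1 / 2 \<le> cmod (1 + b * r u)" if "u < m" "A v u" for u
    proof -
      have "cmod (b * r u) \<le> cmod b * \<rho>" using r(2)[OF that] by (simp add: norm_mult mult_left_mono)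
      then show ?thesis using \<rho> norm_triangle_ineq2[of 1 "- (b * r u)"] by simp
    qed
    let ?q = "\<lambda>u. (b + r u) / (1 + b * r u)"
    have ratio: "is_ratio A m b l v (l v * (\<Prod>u | u < m \<and> A v u. ?q u))"
    proof (rule is_ratio_recursion[OF bd v r(1)])
      fix u assume "u < m" "A v u"
      then show "1 + b * r u \<noteq> 0" using den by force
      then show "?q u * (1 + b * r u) = b + r u" by simp
    qed
    have q: "cmod (?q u) \<le> 2 * (cmod b + 1)" if "u < m" "A v u" for u
    proof -
      have "cmod (b + r u) \<le> cmod b + 1" using r(2)[OF that] \<rho> norm_triangle_ineq[of b "r u"] by simp
      then have "cmod (b + r u) / cmod (1 + b * r u) \<le> (cmod b + 1) / (1 / 2)"
        using den[OF that] by (intro frac_le) auto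
      then show ?thesis by (simp add: norm_divide)
    qed
    have "cmod (\<Prod>u | u < m \<and> A v u. ?q u) \<le> (2 * (cmod b + 1)) ^ card {u. u < m \<and> A v u}"
      unfolding prod_norm[symmetric] using prod_mono[of "{u. u < m \<and> A v u}" "\<lambda>u. cmod (?q u)" "\<lambda>_. 2 * (cmod b + 1)"] q
      by simp
    also have "\<dots> \<le> (2 * (cmod b + 1)) ^ D"
      using D[OF v] norm_ge_zero[of b] by (intro power_increasing) (auto simp del: norm_ge_zero)
    finally have Q: "cmod (\<Prod>u | u < m \<and> A v u. ?q u) \<le> (2 * (cmod b + 1)) ^ D" .
    have "card {w. w < m \<and> A v w \<and> l w = 0} \<le> card {w. w < m \<and> A v w}"
      by (rule card_mono) auto
    then have "card {w. w < m \<and> A v w \<and> l w = 0} \<le> D" using D[OF v] by simp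
    then have "x * B ^ (2 * card {w. w < m \<and> A v w \<and> l w = 0}) \<le> x * B ^ (2 * D)"
      using x B by (intro mult_left_mono power_increasing) auto
    then have lv: "cmod (l v) \<le> x * B ^ (2 * D)" using less.prems[OF v] by linarith
    have "cmod (l v * (\<Prod>u | u < m \<and> A v u. ?q u)) \<le> (x * B ^ (2 * D)) * (2 * (cmod b + 1)) ^ D"
      unfolding norm_mult using lv Q x B by (intro mult_mono) auto
    then show ?thesis using ratio x by fastforce
  qed
  moreover have "wZ A m b l \<noteq> 0"
  proof (cases "\<exists>v<m. l v \<noteq> 0")
    case True
    then obtain v where v: "v < m" "l v \<noteq> 0" by auto
    obtain r where r: "is_ratio A m b l v r" "cmod r \<le> \<rho>" using calculation v by blast
    have "1 + r \<noteq> 0"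
    proof
      assume "1 + r = 0"
      then have "r = - 1" by (simp add: add_eq_0_iff)
      then show False using r \<rho> by simp
    qed
    moreover have "wZ A m b (l(v := 0)) \<noteq> 0"
      using less.hyps[of "l(v := 0)"] smaller[OF v, of "l(v := 0)"] zero_good[of v] by auto
    ultimately show ?thesis using r by (simp add: is_ratio_def del: fun_upd_apply)
  qed (simp add: wZ_all_zero)
  ultimately show ?case by blast
qed

end

subsection \<open>Logarithms of zero-free polynomials\<close>

lemma Ln_taylor_bound:
  fixes w :: complex
  assumes w: "cmod w \<le> q" and q: "q < 1"
  shows "cmod (Ln (1 - w) + (\<Sum>k=1..K. w ^ k / of_nat k)) \<le> q ^ Suc K / (1 - q)"
proof -
  have q0: "0 \<le> q" using w norm_ge_zero order_trans by blast
  define f where "f = (\<lambda>n. - (w ^ n / of_nat n))"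
  have "f sums Ln (1 - w)"
    using Ln_series'[of "- w"] w q by (simp add: f_def)
  then have "(\<lambda>n. f (n + Suc K)) sums (Ln (1 - w) - (\<Sum>n<Suc K. f n))"
    by (rule sums_split_initial_segment)
  moreover have "(\<Sum>n<Suc K. f n) = - (\<Sum>k=1..K. w ^ k / of_nat k)"
  proof -
    have "(\<Sum>n<Suc K. f n) = f 0 + (\<Sum>k=1..K. f k)"
      by (simp add: lessThan_Suc_atMost atMost_atLeast0 sum.atLeast_Suc_atMost)
    then show ?thesis by (simp add: f_def sum_negf)
  qed
  ultimately have s: "(\<lambda>n. f (n + Suc K)) sums (Ln (1 - w) + (\<Sum>k=1..K. w ^ k / of_nat k))" by simp
  have g: "(\<lambda>n. q ^ Suc K * q ^ n) sums (q ^ Suc K * (1 / (1 - q)))"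
    using q q0 by (intro sums_mult geometric_sums) auto
  have "norm (f (n + Suc K)) \<le> q ^ Suc K * q ^ n" for n
  proof -
    have "norm (f (n + Suc K)) \<le> cmod w ^ (n + Suc K) / 1"
      unfolding f_def norm_minus_cancel norm_divide norm_power norm_of_nat by (intro frac_le) auto
    also have "\<dots> \<le> q ^ (n + Suc K)" using w by (simp del: power_Suc add: power_mono)
    finally show ?thesis by (simp add: power_add mult_ac)
  qed
  then have "norm (suminf (\<lambda>n. f (n + Suc K))) \<le> suminf (\<lambda>n. q ^ Suc K * q ^ n)"
    using g by (intro norm_suminf_le) (auto simp: sums_iff)
  then show ?thesis using s g by (simp add: sums_iff)
qed

text \<open>The k-th coefficient is k times that of the logarithm of \<open>f\<close>. For a product
  of factors \<open>1 - w t\<close> it is minus the k-th power sum of the \<open>w\<close>.\<close>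

definition log_deriv :: "complex fps \<Rightarrow> complex fps" where
  "log_deriv f = fps_X * fps_deriv f * inverse f"

lemma log_deriv_mult:
  assumes "fps_nth f 0 = 1" "fps_nth g 0 = 1"
  shows "log_deriv (f * g) = log_deriv f + log_deriv g"
proof -
  have "inverse f * f = 1" "inverse g * g = 1" using assms by (auto intro: inverse_mult_eq_1)
  moreover have "log_deriv (f * g) = fps_X * fps_deriv f * inverse f * (inverse g * g) + fps_X * fps_deriv g * inverse g * (inverse f * f)"
    by (simp add: log_deriv_def fps_inverse_mult algebra_simps)
  ultimately show ?thesis by (simp add: log_deriv_def)
qed

lemma log_deriv_linear:
  "fps_nth (log_deriv (fps_of_poly [:1, - w:])) k = (if k = 0 then 0 else - (w ^ k))"
proof -
  define G where "G = Abs_fps (\<lambda>k. if k = 0 then 0 else - (w ^ k))"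
  let ?f = "fps_of_poly [:1, - w:]"
  have f: "?f = 1 - fps_const w * fps_X" by (simp add: fps_of_poly_linear' fps_const_neg[symmetric] del: fps_const_neg)
  have i: "?f * inverse ?f = 1" by (intro inverse_mult_eq_1') simp
  have "G * ?f = fps_X * fps_deriv ?f"
  proof (rule fps_ext)
    fix k
    show "fps_nth (G * ?f) k = fps_nth (fps_X * fps_deriv ?f) k"
      unfolding f by (cases k rule: nat.exhaust)
        (auto simp: G_def right_diff_distrib mult.assoc[symmetric] fps_X_mult_nth gr0_conv_Suc)
  qed
  then have "log_deriv ?f = G * (?f * inverse ?f)" by (simp add: log_deriv_def mult.assoc)
  then show ?thesis by (simp add: i G_def)
qed

text \<open>Newton's identities, in the form in which \<open>log_exp\<close> evaluates them.\<close>

lemma log_deriv_nth: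
  assumes "fps_nth f 0 = 1"
  shows "fps_nth (log_deriv f) k = of_nat k * fps_nth f k - (\<Sum>j=1..<k. fps_nth (log_deriv f) j * fps_nth f (k - j))"
proof (cases k)
  case 0
  then show ?thesis by (simp add: log_deriv_def)
next
  case (Suc n)
  let ?g = "log_deriv f"
  have "inverse f * f = 1" using assms by (auto intro: inverse_mult_eq_1)
  then have "?g * f = fps_X * fps_deriv f" by (simp add: log_deriv_def mult.assoc)
  then have "fps_nth (?g * f) k = of_nat k * fps_nth f k" using Suc by simp
  moreover have "fps_nth (?g * f) k = (\<Sum>j=1..<k. fps_nth ?g j * fps_nth f (k - j)) + fps_nth ?g k"
  proof -
    have "{0..k} = insert 0 (insert k {1..<k})" using Suc by auto
    then show ?thesis unfolding fps_mult_nth using Suc assms by (simp add: log_deriv_def)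
  qed
  ultimately show ?thesis by (simp add: algebra_simps)
qed

definition log_sum :: "complex fps \<Rightarrow> nat \<Rightarrow> complex" where
  "log_sum f K = (\<Sum>k=1..K. fps_nth (log_deriv f) k / of_nat k)"

text \<open>One root \<open>x\<close> is split off at a time, leaving a factor
  \<open>1 - w t\<close> with \<open>w = 1 / x\<close> of modulus at most
  \<open>1 / \<beta>\<close>. The logarithm \<open>a\<close> is the sum of the values
  \<open>Ln (1 - w)\<close> and need not be the principal one. The last bound is needed later, to
  compare the exponential with a power.\<close>

lemma log_sum_approx:
  fixes f :: "complex poly"
  assumes "poly f 0 = 1" "\<beta> > 1" "\<And>t. cmod t \<le> \<beta> \<Longrightarrow> poly f t \<noteq> 0"
  shows "\<exists>a. exp a = poly f 1 \<and>
    cmod (a - log_sum (fps_of_poly f) K) \<le> degree f * ((1 / \<beta>) ^ Suc K / (1 - 1 / \<beta>)) \<and>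
    cmod (log_sum (fps_of_poly f) K) \<le> degree f * (1 / (\<beta> - 1))"
  using assms(1,3)
proof (induction "degree f" arbitrary: f)
  case 0
  then obtain c where "f = [:c:]" by (metis degree_eq_zeroE)
  then have "f = 1" using 0 by (simp add: one_pCons)
  then show ?case by (intro exI[of _ 0]) (simp add: log_sum_def log_deriv_def)
next
  case (Suc d f)
  obtain x where x: "poly f x = 0"
    using Suc(2) by (metis fundamental_theorem_of_algebra constant_degree nat.distinct(1))
  then obtain g where g: "f = [:- x, 1:] * g" by (metis poly_eq_0_iff_dvd dvdE)
  have xb: "cmod x > \<beta>" using Suc(4) x by force
  then have x0: "x \<noteq> 0" using \<open>\<beta> > 1\<close> by auto
  define w where "w = 1 / x"
  define h where "h = smult (- x) g"
  have fh: "f = [:1, - w:] * h" using x0 by (simp add: g h_def w_def smult_add_right)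
  have w: "cmod w \<le> 1 / \<beta>" "1 / \<beta> < 1"
    using xb x0 \<open>\<beta> > 1\<close> by (auto simp: w_def norm_divide intro!: divide_left_mono mult_pos_pos)
  have "f \<noteq> 0" using Suc(2) by auto
  then have "h \<noteq> 0" using fh by auto
  then have deg: "degree f = Suc (degree h)" unfolding fh using x0 by (subst degree_mult_eq) (auto simp: w_def)
  have h0: "poly h 0 = 1" using Suc(3) by (simp add: fh)
  have "poly h t \<noteq> 0" if "cmod t \<le> \<beta>" for t using Suc(4)[OF that] by (auto simp: fh)
  then obtain a where a: "exp a = poly h 1"
    "cmod (a - log_sum (fps_of_poly h) K) \<le> degree h * ((1 / \<beta>) ^ Suc K / (1 - 1 / \<beta>))"
    "cmod (log_sum (fps_of_poly h) K) \<le> degree h * (1 / (\<beta> - 1))"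
    using Suc(1)[of h] Suc(2) deg h0 by auto
  let ?S = "\<Sum>k=1..K. w ^ k / of_nat k"
  have ls: "log_sum (fps_of_poly f) K = log_sum (fps_of_poly h) K - ?S"
  proof -
    have "log_deriv (fps_of_poly f) = log_deriv (fps_of_poly [:1, - w:]) + log_deriv (fps_of_poly h)"
      unfolding fh fps_of_poly_mult by (rule log_deriv_mult) (use h0 in \<open>simp_all add: poly_0_coeff_0\<close>)
    then have "log_sum (fps_of_poly f) K = (\<Sum>k=1..K. - (w ^ k / of_nat k) + fps_nth (log_deriv (fps_of_poly h)) k / of_nat k)"
      unfolding log_sum_def by (intro sum.cong) (auto simp: log_deriv_linear diff_divide_distrib)
    then show ?thesis by (simp add: log_sum_def sum_subtractf)
  qed
  have tail: "cmod (Ln (1 - w) + ?S) \<le> (1 / \<beta>) ^ Suc K / (1 - 1 / \<beta>)"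
    using w by (rule Ln_taylor_bound)
  have S: "cmod ?S \<le> 1 / (\<beta> - 1)"
  proof -
    have "cmod ?S \<le> (\<Sum>k=1..K. (1 / \<beta>) ^ k)"
    proof (rule sum_norm_le)
      fix k assume "k \<in> {1..K}"
      then have "cmod (w ^ k / of_nat k) \<le> cmod w ^ k / 1"
        unfolding norm_divide norm_power norm_of_nat by (intro frac_le) auto
      also have "\<dots> \<le> (1 / \<beta>) ^ k" using w by (simp add: power_mono del: power_one_over)
      finally show "cmod (w ^ k / of_nat k) \<le> (1 / \<beta>) ^ k" .
    qed
    also have "\<dots> = (\<Sum>k<K. (1 / \<beta>) * (1 / \<beta>) ^ k)"
      by (rule sum.reindex_bij_witness[of _ Suc "\<lambda>k. k - 1"]) (auto simp: power_Suc[symmetric] simp del: power_Suc)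
    also have "\<dots> = (1 / \<beta>) * (\<Sum>k<K. (1 / \<beta>) ^ k)" by (simp add: sum_distrib_left)
    also have "\<dots> \<le> (1 / \<beta>) * (1 / (1 - 1 / \<beta>))"
    proof (intro mult_left_mono)
      have "(\<Sum>k<K. (1 / \<beta>) ^ k) \<le> suminf (\<lambda>k. (1 / \<beta>) ^ k)"
        using w \<open>\<beta> > 1\<close> by (intro sum_le_suminf summable_geometric) auto
      then show "(\<Sum>k<K. (1 / \<beta>) ^ k) \<le> 1 / (1 - 1 / \<beta>)"
        using w \<open>\<beta> > 1\<close> by (subst (asm) suminf_geometric) auto
    qed (use \<open>\<beta> > 1\<close> in auto)
    also have "\<dots> = 1 / (\<beta> - 1)" using \<open>\<beta> > 1\<close> by (simp add: field_simps)
    finally show ?thesis .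
  qed
  have w1: "1 - w \<noteq> 0" using w by auto
  show ?case
  proof (intro exI[of _ "Ln (1 - w) + a"] conjI)
    show "exp (Ln (1 - w) + a) = poly f 1" using w1 a by (simp add: exp_add fh algebra_simps)
    have "Ln (1 - w) + a - log_sum (fps_of_poly f) K = (Ln (1 - w) + ?S) + (a - log_sum (fps_of_poly h) K)"
      by (simp add: ls)
    then have "cmod (Ln (1 - w) + a - log_sum (fps_of_poly f) K)
        \<le> cmod (Ln (1 - w) + ?S) + cmod (a - log_sum (fps_of_poly h) K)"
      by (simp only: norm_triangle_ineq)
    also have "\<dots> \<le> (1 / \<beta>) ^ Suc K / (1 - 1 / \<beta>) + degree h * ((1 / \<beta>) ^ Suc K / (1 - 1 / \<beta>))"
      using tail a(2) by (rule add_mono)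
    also have "\<dots> = degree f * ((1 / \<beta>) ^ Suc K / (1 - 1 / \<beta>))"
      unfolding deg of_nat_Suc by (simp only: distrib_right mult_1)
    finally show "cmod (Ln (1 - w) + a - log_sum (fps_of_poly f) K)
        \<le> degree f * ((1 / \<beta>) ^ Suc K / (1 - 1 / \<beta>))" .
    have "cmod (log_sum (fps_of_poly f) K) \<le> cmod (log_sum (fps_of_poly h) K) + cmod ?S"
      unfolding ls by (rule norm_triangle_ineq4)
    also have "\<dots> \<le> degree h * (1 / (\<beta> - 1)) + 1 / (\<beta> - 1)"
      using a(3) S by (rule add_mono)
    also have "\<dots> = degree f * (1 / (\<beta> - 1))"
      unfolding deg of_nat_Suc by (simp only: distrib_right mult_1 add.commute)
    finally show "cmod (log_sum (fps_of_poly f) K) \<le> degree f * (1 / (\<beta> - 1))" .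
  qed
qed

text \<open>The witness is \<open>M * Ln (1 + x / M)\<close>: each of the M factors has an error
  quadratic in \<open>x / M\<close>.\<close>

lemma power_exp_approx:
  fixes x :: complex
  assumes M: "0 < M" and x: "2 * cmod x \<le> M"
  shows "\<exists>c. exp c = (1 + x / of_nat M) ^ M \<and> cmod (c - x) \<le> 2 * cmod x ^ 2 / M"
proof -
  define z where "z = x / of_nat M"
  have nz: "cmod z = cmod x / M" using M by (simp add: z_def norm_divide)
  have z: "cmod z \<le> 1 / 2" using x M by (simp add: nz field_simps)
  have "1 + z \<noteq> 0"
  proof
    assume "1 + z = 0"
    then have "z = - 1" by (simp add: add_eq_0_iff)
    then show False using z by simp
  qed
  then have "exp (of_nat M * Ln (1 + z)) = (1 + z) ^ M"
    by (simp add: exp_of_nat_mult)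
  moreover have "cmod (of_nat M * Ln (1 + z) - x) \<le> 2 * cmod x ^ 2 / M"
  proof -
    have "cmod (Ln (1 + z) - z) \<le> cmod z ^ 2 / (1 - cmod z)"
      using z by (intro Ln_approx_linear) auto
    also have "\<dots> \<le> cmod z ^ 2 / (1 / 2)" using z by (intro divide_left_mono) auto
    finally have 1: "cmod (Ln (1 + z) - z) \<le> 2 * cmod z ^ 2" by simp
    have "of_nat M * Ln (1 + z) - x = of_nat M * (Ln (1 + z) - z)"
      using M by (simp add: z_def field_simps)
    then have "cmod (of_nat M * Ln (1 + z) - x) = M * cmod (Ln (1 + z) - z)"
      by (simp add: norm_mult)
    also have "\<dots> \<le> M * (2 * cmod z ^ 2)" using 1 by (intro mult_left_mono) auto
    also have "\<dots> = 2 * cmod x ^ 2 / M" using M by (simp add: nz field_simps power2_eq_square)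
    finally show ?thesis .
  qed
  ultimately show ?thesis unfolding z_def by blast
qed

section \<open>Geometry of the sector and of the thin strip\<close>

text \<open>Positive real factors do not change the argument, so a whole cone of directions around
  \<open>\<xi>\<close> stays in the sector. A thin strip along the positive axis leaves the
  corresponding cone only close to 0, where the first alternative holds.\<close>

lemma sector_neighbourhood:
  assumes \<xi>: "\<xi> \<in> arg_sector \<theta>" and \<theta>: "\<theta> \<le> pi" and r: "r > 0"
  shows "\<exists>\<delta>>0. \<forall>w. \<bar>Im w\<bar> < \<delta> \<and> Re w > - \<delta> \<longrightarrow> cmod (\<xi> * w) < r \<or> \<xi> * w \<in> arg_sector \<theta>"
proof -
  have \<xi>0: "\<xi> \<noteq> 0" and A: "\<bar>Arg \<xi>\<bar> < \<theta>" using \<xi> by (auto simp: arg_sector_def)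
  \<comment> \<open>On the negative axis \<open>Arg\<close> would equal \<open>pi\<close> and be
    discontinuous; \<open>\<theta> \<le> pi\<close> excludes this.\<close>
  have "\<xi> \<notin> \<real>\<^sub>\<le>\<^sub>0"
  proof
    assume "\<xi> \<in> \<real>\<^sub>\<le>\<^sub>0"
    then obtain s where "\<xi> = of_real s" "s \<le> 0" by (auto simp: nonpos_Reals_def)
    then show False using \<xi>0 A \<theta> Arg_of_real[of s] by (simp split: if_splits)
  qed
  then have "isCont Arg \<xi>" using continuous_at_Arg by blast
  then have "\<forall>\<^sub>F z in at \<xi>. dist (Arg z) (Arg \<xi>) < \<theta> - \<bar>Arg \<xi>\<bar>"
    using A unfolding isCont_def by (intro tendstoD) auto
  then obtain \<rho>0 where \<rho>0: "\<rho>0 > 0" "\<And>z. z \<noteq> \<xi> \<Longrightarrow> dist z \<xi> < \<rho>0 \<Longrightarrow> dist (Arg z) (Arg \<xi>) < \<theta> - \<bar>Arg \<xi>\<bar>"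
    by (auto simp: eventually_at)
  define \<rho> where "\<rho> = min \<rho>0 (cmod \<xi>)"
  have \<rho>: "\<rho> > 0" using \<rho>0 \<xi>0 by (simp add: \<rho>_def)
  have near: "z \<in> arg_sector \<theta>" if "cmod (z - \<xi>) < \<rho>" for z
  proof -
    have "z \<noteq> 0" using that by (auto simp: \<rho>_def)
    moreover have "\<bar>Arg z\<bar> < \<theta>"
      using \<rho>0(2)[of z] that A by (cases "z = \<xi>") (auto simp: \<rho>_def dist_norm)
    ultimately show ?thesis by (simp add: arg_sector_def)
  qed
  define s where "s = \<rho> / (2 * cmod \<xi>)"
  have s: "s > 0" using \<rho> \<xi>0 by (simp add: s_def)
  have s\<xi>: "cmod \<xi> * s < \<rho>" using \<rho> \<xi>0 by (simp add: s_def)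
  have cone: "\<xi> * w \<in> arg_sector \<theta>" if "Re w > 0" "\<bar>Im w\<bar> \<le> s * Re w" for w
  proof -
    let ?z = "\<xi> * (1 + \<i> * of_real (Im w / Re w))"
    have w: "\<xi> * w = of_real (Re w) * ?z" using that by (simp add: complex_eq_iff field_simps)
    have "\<bar>Im w / Re w\<bar> \<le> s" using that by (simp add: field_simps)
    then have "cmod \<xi> * \<bar>Im w / Re w\<bar> \<le> cmod \<xi> * s" by (intro mult_left_mono) auto
    moreover have "cmod (?z - \<xi>) = cmod \<xi> * \<bar>Im w / Re w\<bar>"
    proof -
      have "?z - \<xi> = \<xi> * (\<i> * of_real (Im w / Re w))" by (simp add: algebra_simps)
      then show ?thesis by (simp only: norm_mult norm_of_real norm_ii)
    qed
    ultimately have "?z \<in> arg_sector \<theta>" using s\<xi> by (intro near) linarith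
    then show ?thesis unfolding w using that by (auto simp: arg_sector_def)
  qed
  \<comment> \<open>Outside the cone, \<open>Re w\<close> and \<open>Im w\<close> are both below
    \<open>\<delta> * (1 + 1 / s)\<close> in absolute value, so \<open>cmod w\<close> is below twice
    this. The 3 turns the result into \<open>2 / 3 * r\<close>.\<close>
  define \<delta> where "\<delta> = r / (3 * cmod \<xi> * (1 + 1 / s))"
  have \<delta>: "\<delta> > 0" using r \<xi>0 s by (simp add: \<delta>_def field_simps add_pos_pos)
  show ?thesis
  proof (intro exI[of _ \<delta>] conjI allI impI \<delta>)
    fix w assume w: "\<bar>Im w\<bar> < \<delta> \<and> Re w > - \<delta>"
    show "cmod (\<xi> * w) < r \<or> \<xi> * w \<in> arg_sector \<theta>"
    proof (cases "Re w > 0 \<and> \<bar>Im w\<bar> \<le> s * Re w")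
      case True
      then show ?thesis using cone by blast
    next
      case False
      have "\<bar>Re w\<bar> < \<delta> * (1 + 1 / s)"
      proof (cases "Re w > 0")
        case True
        then have "Re w < \<bar>Im w\<bar> / s" using False s by (simp add: field_simps)
        also have "\<dots> < \<delta> / s" using w s by (simp add: divide_strict_right_mono)
        finally show ?thesis using True \<delta> by (simp add: algebra_simps)
      next
        case False
        then have "\<bar>Re w\<bar> < \<delta>" using w by simp
        moreover have "0 < \<delta> / s" using \<delta> s by simp
        ultimately show ?thesis by (simp add: algebra_simps)
      qed
      moreover have "\<bar>Im w\<bar> < \<delta> * (1 + 1 / s)"
      proof -
        have "0 < \<delta> / s" using \<delta> s by simp
        then show ?thesis using w by (simp add: algebra_simps)
      qed
      ultimately have "cmod w < 2 * (\<delta> * (1 + 1 / s))" using cmod_le[of w] by linarith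
      then have "cmod \<xi> * cmod w < cmod \<xi> * (2 * (\<delta> * (1 + 1 / s)))"
        using \<xi>0 by (intro mult_strict_left_mono) auto
      also have "\<dots> = 2 / 3 * r"
      proof -
        have "1 + 1 / s \<noteq> 0" using s by (smt (verit) divide_pos_pos)
        then show ?thesis using \<xi>0 by (simp add: \<delta>_def)
      qed
      also have "\<dots> < r" using r by simp
      finally show ?thesis by (simp add: norm_mult)
    qed
  qed
qed

text \<open>The map is a truncation of \<open>ln (1 - a t) / ln (1 - a)\<close> with \<open>a = 1 - 1 / q\<close> and \<open>q\<close> large. Since
  \<open>a\<close> is rational, all coefficients are multiples of \<open>1 / D\<close>.\<close>

lemma strip_map:
  assumes \<delta>: "\<delta> > 0"
  shows "\<exists>\<beta>>1. \<exists>c N D. c 0 = 0 \<and> (\<forall>k>N. c k = 0) \<and> 0 < D \<and> (\<Sum>k\<le>N. c k) = D \<and>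
    (\<forall>t. cmod t \<le> \<beta> \<longrightarrow> \<bar>Im (\<Sum>k\<le>N. of_nat (c k) / of_nat D * t ^ k)\<bar> < \<delta> \<and>
      Re (\<Sum>k\<le>N. of_nat (c k) / of_nat D * t ^ k) > - \<delta>)"
proof -
  \<comment> \<open>The normalising sum \<open>\<sigma>\<close> is within 1 of \<open>ln q\<close>,
    hence larger than \<open>3 / \<delta>\<close>. Dividing by it shrinks a strip of half-width 3 to
    less than \<open>\<delta>\<close>.\<close>
  obtain q0 :: nat where q0: "real q0 > exp (3 / \<delta> + 1)" using reals_Archimedean2 by blast
  define q where "q = max 2 q0"
  have q2: "q \<ge> 2" by (simp add: q_def)
  have "exp (3 / \<delta> + 1) < real q" using q0 by (simp add: q_def)
  then have lnq: "3 / \<delta> + 1 < ln (real q)" using q2 by (metis exp_less_cancel_iff exp_ln gr0I of_nat_0_less_iff not_numeral_le_zero)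
  define a where "a = 1 - 1 / real q"
  \<comment> \<open>With this radius \<open>a * \<beta> = 1 - 1 / q^2 < 1\<close>, so the
    logarithmic series still converges on the larger disc.\<close>
  define \<beta> where "\<beta> = 1 + 1 / real q"
  have a01: "0 < a" "a < 1" using q2 by (auto simp: a_def)
  have \<beta>: "\<beta> > 1" using q2 by (simp add: \<beta>_def)
  define p where "p = a * \<beta>"
  have "p = 1 - (1 / real q) ^ 2" by (simp add: p_def a_def \<beta>_def algebra_simps power2_eq_square)
  then have p1: "p < 1" using q2 by simp
  have p0: "0 < p" using a01 \<beta> by (simp add: p_def)
  have "(\<lambda>n. p ^ n) \<longlonglongrightarrow> 0" using p0 p1 by (intro LIMSEQ_power_zero) auto
  then have "\<forall>\<^sub>F n in sequentially. p ^ n < 1 - p"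
    using p1 by (intro order_tendstoD) auto
  then obtain N0 where "\<And>n. n \<ge> N0 \<Longrightarrow> p ^ n < 1 - p" by (auto simp: eventually_sequentially)
  then have "p ^ Suc N0 < 1 - p" by (meson le_SucI order_refl)
  then have pN: "p ^ Suc N0 / (1 - p) \<le> 1" using p1 by simp
  define N where "N = N0"
  define h where "h = (\<lambda>t. \<Sum>k=1..N. (of_real a * t) ^ k / of_nat k :: complex)"
  have hb: "cmod (Ln (1 - of_real a * t) + h t) \<le> 1" if "cmod t \<le> \<beta>" for t
  proof -
    have "cmod (of_real a * t) \<le> p" using that a01 by (simp add: norm_mult p_def)
    from Ln_taylor_bound[OF this p1, of N] show ?thesis using pN by (simp add: h_def N_def)
  qed
  define \<sigma> where "\<sigma> = (\<Sum>k=1..N. a ^ k / real k)"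
  have h1: "h 1 = of_real \<sigma>" by (simp add: h_def \<sigma>_def)
  have "Ln (1 - of_real a * 1) = of_real (- ln (real q))"
  proof -
    have "1 - of_real a * 1 = (of_real (1 / real q) :: complex)" by (simp add: a_def)
    moreover have "Ln (of_real (1 / real q)) = of_real (ln (1 / real q))" using q2 by (intro Ln_of_real) auto
    ultimately show ?thesis using q2 by (simp add: ln_div)
  qed
  then have "cmod (of_real (\<sigma> - ln (real q))) \<le> 1" using hb[of 1] \<beta> h1 by simp
  then have "\<bar>\<sigma> - ln (real q)\<bar> \<le> 1" by (simp only: norm_of_real)
  then have "\<sigma> > 3 / \<delta>" using lnq by linarith
  moreover have "3 / \<delta> > 0" using \<delta> by simp
  ultimately have \<sigma>0: "\<sigma> > 0" by linarith
  then have \<sigma>: "3 / \<sigma> < \<delta>" using \<open>\<sigma> > 3 / \<delta>\<close> \<delta> by (simp add: field_simps)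
  \<comment> \<open>\<open>a ^ k / k\<close> multiplied by the common denominator
    \<open>q ^ N * fact N\<close>, called \<open>E\<close> below; this is a natural number since
    \<open>a * q = q - 1\<close> and \<open>k\<close> divides \<open>fact N\<close>. Taking the sum
    of these numbers for \<open>D\<close> forces the value 1 at \<open>t = 1\<close>.\<close>
  define c where "c = (\<lambda>k. if k = 0 \<or> k > N then 0 else (q - 1) ^ k * q ^ (N - k) * (fact N div k))"
  define D where "D = (\<Sum>k\<le>N. c k)"
  define E where "E = real q ^ N * fact N"
  have E: "E > 0" using q2 by (simp add: E_def)
  have ck: "real (c k) = E * (a ^ k / k)" if "k \<in> {1..N}" for k
  proof -
    have k: "k \<noteq> 0" "k \<le> N" using that by auto
    have "k dvd (fact N :: nat)" using that by (intro dvd_fact) auto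
    then have f: "real (fact N div k) = fact N / k" by (simp add: real_of_nat_div)
    have q1: "real (q - Suc 0) = real q * a" using q2 by (simp add: a_def field_simps of_nat_diff)
    have "real q ^ N = real q ^ k * real q ^ (N - k)" using k by (simp flip: power_add)
    then show ?thesis using k by (simp add: c_def f q1 E_def power_mult_distrib)
  qed
  have c0: "c 0 = 0" by (simp add: c_def)
  have sum_split: "(\<Sum>k\<le>N. g k) = (\<Sum>k=1..N. g k)" if "g 0 = 0" for g :: "nat \<Rightarrow> 'b::comm_monoid_add"
  proof -
    have "{..N} = insert 0 {1..N}" by auto
    then show ?thesis using that by simp
  qed
  have D: "real D = E * \<sigma>"
  proof -
    have "real D = (\<Sum>k=1..N. real (c k))" unfolding D_def of_nat_sum by (rule sum_split) (simp add: c0)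
    also have "\<dots> = E * \<sigma>" unfolding \<sigma>_def sum_distrib_left by (intro sum.cong) (auto simp: ck)
    finally show ?thesis .
  qed
  have D0: "D > 0" using D E \<sigma>0 by (metis mult_pos_pos of_nat_0_less_iff)
  have phi: "(\<Sum>k\<le>N. of_nat (c k) / of_nat D * t ^ k) = h t / of_real \<sigma>" for t :: complex
  proof -
    have "(\<Sum>k\<le>N. of_nat (c k) / of_nat D * t ^ k) = (\<Sum>k=1..N. of_nat (c k) / of_nat D * t ^ k)"
      by (rule sum_split) (simp add: c0)
    also have "\<dots> = (\<Sum>k=1..N. (of_real a * t) ^ k / of_nat k / of_real \<sigma>)"
    proof (intro sum.cong refl)
      fix k assume k: "k \<in> {1..N}"
      have "of_nat (c k) / of_nat D = (of_real (real (c k) / real D) :: complex)" by simp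
      also have "real (c k) / real D = a ^ k / k / \<sigma>" using E \<sigma>0 by (simp add: ck[OF k] D)
      finally show "of_nat (c k) / of_nat D * t ^ k = (of_real a * t) ^ k / of_nat k / of_real \<sigma>"
        by (simp add: power_mult_distrib)
    qed
    finally show ?thesis by (simp add: h_def sum_divide_distrib)
  qed
  \<comment> \<open>\<open>1 - a t\<close> lies in the right half-plane and has modulus at most 2,
    so its logarithm has imaginary part below \<open>pi / 2 < 2\<close> and real part at most 1. The
    truncation changes this by at most 1.\<close>
  have h3: "\<bar>Im (h t)\<bar> < 3 \<and> Re (h t) > - 3" if t: "cmod t \<le> \<beta>" for t
  proof -
    let ?w = "1 - of_real a * t"
    have at: "cmod (of_real a * t) < 1"
    proof -
      have "cmod (of_real a * t) \<le> p" using t a01 by (simp add: norm_mult p_def)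
      then show ?thesis using p1 by simp
    qed
    have "Re (of_real a * t) < 1" using at complex_Re_le_cmod[of "of_real a * t"] by linarith
    then have "Re ?w > 0" by simp
    then have im: "\<bar>Im (Ln ?w)\<bar> < pi / 2" by (rule Re_Ln_pos_lt_imp)
    have w0: "?w \<noteq> 0" using at by (metis eq_iff_diff_eq_0 norm_one less_irrefl)
    have "cmod ?w \<le> 2" using norm_triangle_ineq4[of 1 "of_real a * t"] at by simp
    moreover have "2 \<le> exp (1::real)" using exp_ge_add_one_self[of 1] by simp
    ultimately have "cmod ?w \<le> exp 1" by linarith
    then have "ln (cmod ?w) \<le> 1" using w0 by (metis ln_exp ln_le_cancel_iff zero_less_norm_iff exp_gt_zero)
    then have re: "Re (Ln ?w) \<le> 1" using w0 by simp
    have b: "cmod (Ln ?w + h t) \<le> 1" using hb[OF t] .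
    have "\<bar>Im (Ln ?w) + Im (h t)\<bar> \<le> 1" "\<bar>Re (Ln ?w) + Re (h t)\<bar> \<le> 1"
      using order_trans[OF abs_Im_le_cmod b] order_trans[OF abs_Re_le_cmod b] by simp_all
    moreover have "pi / 2 < 2" using pi_less_4 by simp
    ultimately show ?thesis using im re by linarith
  qed
  then have "\<bar>Im (h t / of_real \<sigma>)\<bar> < \<delta> \<and> Re (h t / of_real \<sigma>) > - \<delta>" if t: "cmod t \<le> \<beta>" for t
  proof -
    have *: "\<bar>Im (h t)\<bar> < 3" "Re (h t) > - 3" using h3[OF t] by auto
    have "\<bar>Im (h t)\<bar> / \<sigma> < 3 / \<sigma>" "- 3 / \<sigma> < Re (h t) / \<sigma>"
      using divide_strict_right_mono[OF *(1) \<sigma>0] divide_strict_right_mono[OF *(2) \<sigma>0] by blast+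
    then show ?thesis using \<sigma> \<sigma>0 by (simp add: abs_divide)
  qed
  then have "\<forall>t. cmod t \<le> \<beta> \<longrightarrow> \<bar>Im (\<Sum>k\<le>N. of_nat (c k) / of_nat D * t ^ k)\<bar> < \<delta> \<and>
      Re (\<Sum>k\<le>N. of_nat (c k) / of_nat D * t ^ k) > - \<delta>"
    unfolding phi by blast
  moreover have "\<forall>k>N. c k = 0" by (simp add: c_def)
  ultimately show ?thesis using \<beta> c0 D0 D_def by blast
qed

subsection \<open>A program logic with running times\<close>

text \<open>Total correctness with an upper bound on the time instead of the exact cost, so that
  crude constants can be used throughout.\<close>

definition ok :: "com \<Rightarrow> state \<Rightarrow> nat \<Rightarrow> (state \<Rightarrow> bool) \<Rightarrow> bool" where
  "ok c s T Q \<longleftrightarrow> (\<exists>t s'. runs c s t s' \<and> t \<le> T \<and> Q s')"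

lemma ok_conseq:
  "ok c s T Q \<Longrightarrow> T \<le> T' \<Longrightarrow> (\<And>s'. Q s' \<Longrightarrow> Q' s') \<Longrightarrow> ok c s T' Q'"
  unfolding ok_def by (meson order_trans)

lemma ok_Skip: "Q s \<Longrightarrow> 1 \<le> T \<Longrightarrow> ok Skip s T Q"
  unfolding ok_def by (meson runs_Skip)

lemma ok_SetNReg: "Q (s\<lparr>nreg := (nreg s)(r := nval e s)\<rparr>) \<Longrightarrow> 1 + ncost e \<le> T \<Longrightarrow> ok (SetNReg r e) s T Q"
  unfolding ok_def by (intro exI conjI, rule runs_SetNReg) auto

lemma ok_SetNMem:
  "Q (s\<lparr>nmem := (nmem s)(nval a s := nval e s)\<rparr>) \<Longrightarrow> 1 + ncost a + ncost e \<le> T \<Longrightarrow> ok (SetNMem a e) s T Q"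
  unfolding ok_def by (intro exI conjI, rule runs_SetNMem) auto

lemma ok_SetCReg: "Q (s\<lparr>creg := (creg s)(r := cval e s)\<rparr>) \<Longrightarrow> 1 + ccost e \<le> T \<Longrightarrow> ok (SetCReg r e) s T Q"
  unfolding ok_def by (intro exI conjI, rule runs_SetCReg) auto

lemma ok_SetCMem:
  "Q (s\<lparr>cmem := (cmem s)(nval a s := cval e s)\<rparr>) \<Longrightarrow> 1 + ncost a + ccost e \<le> T \<Longrightarrow> ok (SetCMem a e) s T Q"
  unfolding ok_def by (intro exI conjI, rule runs_SetCMem) auto

lemma ok_SetCReg_val:
  "cval e s = v \<Longrightarrow> Q (s\<lparr>creg := (creg s)(r := v)\<rparr>) \<Longrightarrow> 1 + ccost e \<le> T \<Longrightarrow> ok (SetCReg r e) s T Q"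
  by (auto intro: ok_SetCReg)

lemma ok_SetCMem_val:
  "nval a s = x \<Longrightarrow> cval e s = v \<Longrightarrow> Q (s\<lparr>cmem := (cmem s)(x := v)\<rparr>) \<Longrightarrow> 1 + ncost a + ccost e \<le> T \<Longrightarrow>
   ok (SetCMem a e) s T Q"
  by (auto intro: ok_SetCMem)

lemma ok_Seq:
  assumes "ok c s T1 R" "\<And>s'. R s' \<Longrightarrow> ok d s' T2 Q"
  shows "ok (Seq c d) s (1 + T1 + T2) Q"
proof -
  obtain t s' where 1: "runs c s t s'" "t \<le> T1" "R s'" using assms(1) unfolding ok_def by blast
  obtain u s'' where 2: "runs d s' u s''" "u \<le> T2" "Q s''" using assms(2)[OF 1(3)] unfolding ok_def by blast
  show ?thesis unfolding ok_def using runs_Seq[OF 1(1) 2(1)] 1 2 by (intro exI[of _ "1 + t + u"] exI[of _ s'']) auto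
qed

lemma ok_If:
  assumes "tval p s \<Longrightarrow> ok c s T Q" "\<not> tval p s \<Longrightarrow> ok d s T Q"
  shows "ok (If_Then_Else p c d) s (1 + tcost p + T) Q"
proof (cases "tval p s")
  case True
  then obtain t s' where "runs c s t s'" "t \<le> T" "Q s'" using assms(1) unfolding ok_def by blast
  then show ?thesis unfolding ok_def using runs_IfTrue[OF True]
    by (intro exI[of _ "1 + tcost p + t"] exI[of _ s']) auto
next
  case False
  then obtain t s' where "runs d s t s'" "t \<le> T" "Q s'" using assms(2) unfolding ok_def by blast
  then show ?thesis unfolding ok_def using runs_IfFalse[OF False]
    by (intro exI[of _ "1 + tcost p + t"] exI[of _ s']) auto
qed

text \<open>\<open>i\<close> counts completed passes, so its bound \<open>N\<close> gives
  termination and the running time at once.\<close>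

lemma ok_While:
  assumes I: "I i s" and i: "i \<le> N"
    and step: "\<And>i s. I i s \<Longrightarrow> tval p s \<Longrightarrow> i < N \<and> ok c s T (I (Suc i))"
  shows "ok (While p c) s ((N - i) * (1 + tcost p + T) + (1 + tcost p)) (\<lambda>s'. \<exists>j\<le>N. I j s' \<and> \<not> tval p s')"
  using I i
proof (induction "N - i" arbitrary: i s rule: less_induct)
  case less
  show ?case
  proof (cases "tval p s")
    case True
    from step[OF less.prems(1) True] have iN: "i < N" and "ok c s T (I (Suc i))" by auto
    then obtain t s' where 1: "runs c s t s'" "t \<le> T" "I (Suc i) s'" unfolding ok_def by blast
    have "ok (While p c) s' ((N - Suc i) * (1 + tcost p + T) + (1 + tcost p)) (\<lambda>s'. \<exists>j\<le>N. I j s' \<and> \<not> tval p s')"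
      using iN 1 by (intro less.hyps) auto
    then obtain u s'' where 2: "runs (While p c) s' u s''" "u \<le> (N - Suc i) * (1 + tcost p + T) + (1 + tcost p)"
        "\<exists>j\<le>N. I j s'' \<and> \<not> tval p s''"
      unfolding ok_def by blast
    have "N - i = Suc (N - Suc i)" using iN by simp
    then have "1 + tcost p + t + u \<le> (N - i) * (1 + tcost p + T) + (1 + tcost p)" using 1 2 by simp
    then show ?thesis unfolding ok_def using runs_WhileTrue[OF True 1(1) 2(1)] 2 by blast
  next
    case False
    then show ?thesis unfolding ok_def using runs_WhileFalse[OF False] less.prems by fastforce
  qed
qed

definition For :: "nat \<Rightarrow> nexp \<Rightarrow> com \<Rightarrow> com" where
  "For r e c = Seq (SetNReg r (NLit 0))
     (While (NLess (NReg r) e) (Seq c (SetNReg r (NAdd (NReg r) (NLit 1)))))"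

definition for_time :: "nat \<Rightarrow> nexp \<Rightarrow> nat \<Rightarrow> nat" where
  "for_time N e T = N * (T + ncost e + 10) + ncost e + 10"

text \<open>The limit \<open>e\<close> is evaluated again before each pass, so the invariant has to
  keep its value fixed; when the test fails, this forces the counter to be exactly
  \<open>N\<close>.\<close>

lemma ok_For:
  assumes init: "I 0 (s\<lparr>nreg := (nreg s)(r := 0)\<rparr>)"
    and inv: "\<And>i s. I i s \<Longrightarrow> i \<le> N \<Longrightarrow> nreg s r = i \<and> nval e s = N"
    and step: "\<And>i s. I i s \<Longrightarrow> i < N \<Longrightarrow>
      ok c s T (\<lambda>s'. nreg s' r = i \<and> I (Suc i) (s'\<lparr>nreg := (nreg s')(r := Suc i)\<rparr>))"
  shows "ok (For r e c) s (for_time N e T) (I N)"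
proof -
  let ?p = "NLess (NReg r) e"
  let ?J = "\<lambda>i s. I i s \<and> i \<le> N"
  have st: "i < N \<and> ok (Seq c (SetNReg r (NAdd (NReg r) (NLit 1)))) s (1 + T + 4) (?J (Suc i))"
    if "?J i s" "tval ?p s" for i s
  proof
    show i: "i < N" using inv[of i s] that by auto
    have "I i s" using that by simp
    from step[OF this i] show "ok (Seq c (SetNReg r (NAdd (NReg r) (NLit 1)))) s (1 + T + 4) (?J (Suc i))"
    proof (rule ok_Seq)
      fix s' assume a: "nreg s' r = i \<and> I (Suc i) (s'\<lparr>nreg := (nreg s')(r := Suc i)\<rparr>)"
      show "ok (SetNReg r (NAdd (NReg r) (NLit 1))) s' 4 (?J (Suc i))"
        by (rule ok_SetNReg) (use a i in auto)
    qed
  qed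
  have "ok (While ?p (Seq c (SetNReg r (NAdd (NReg r) (NLit 1))))) (s\<lparr>nreg := (nreg s)(r := 0)\<rparr>)
      ((N - 0) * (1 + tcost ?p + (1 + T + 4)) + (1 + tcost ?p)) (\<lambda>s'. \<exists>j\<le>N. ?J j s' \<and> \<not> tval ?p s')"
    by (rule ok_While[where I = ?J]) (use init st in auto)
  then have w: "ok (While ?p (Seq c (SetNReg r (NAdd (NReg r) (NLit 1))))) (s\<lparr>nreg := (nreg s)(r := 0)\<rparr>)
      (N * (T + ncost e + 8) + (ncost e + 3)) (I N)"
  proof (rule ok_conseq)
    fix s' assume "\<exists>j\<le>N. ?J j s' \<and> \<not> tval ?p s'"
    then obtain j where "j \<le> N" "I j s'" "\<not> tval ?p s'" by blast
    then show "I N s'" using inv[of j s'] by simp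
  qed (simp add: algebra_simps)
  have "ok (For r e c) s (1 + 2 + (N * (T + ncost e + 8) + (ncost e + 3))) (I N)"
    unfolding For_def
    by (rule ok_Seq[where R = "\<lambda>s'. s' = s\<lparr>nreg := (nreg s)(r := 0)\<rparr>"])
       (use w in \<open>auto intro: ok_SetNReg\<close>)
  then show ?thesis
    by (rule ok_conseq) (auto simp: for_time_def algebra_simps)
qed

lemma ok_Seq_eq: "ok c s T1 (\<lambda>t. t = u) \<Longrightarrow> ok d u T2 Q \<Longrightarrow> ok (Seq c d) s (1 + T1 + T2) Q"
  by (erule ok_Seq) simp

lemma for_time_mono: "N \<le> N' \<Longrightarrow> T \<le> T' \<Longrightarrow> for_time N e T \<le> for_time N' e T'"
  unfolding for_time_def by (intro add_mono mult_mono) auto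

section \<open>Memory layout and the tree programs\<close>

abbreviation "R \<equiv> NReg"

text \<open>Registers: 0: number of vertices, 1: number of edges \<open>m\<close>, 2: \<open>K\<close>, 3 and 4: vertex pair, 5: row address,
  6: edge table, 8: block size, 9: current block, 10: first free block, 11: neighbour, 12 to 14: loop
  counters, 15: parent block; algebraic registers: 0: \<open>b\<close>, 1: \<open>\<xi>\<close>, 2: \<open>1 / b\<close>, 3: accumulator, 4: logarithm.

  Algebraic memory: cells \<open>0, \<dots>, K\<close> hold the coefficients of \<open>z\<close>, the next \<open>K + 1\<close> cells are scratch
  space, followed by the endpoints of the \<open>m\<close> edges and then by the blocks, one for each node of the tree.
  A block consists of \<open>K + 1\<close> coefficients of the node's series, the two parameters \<open>a\<close> and \<open>c\<close> of the factor
  \<open>(a + r) / (1 + c r)\<close> contributed to the parent, and the \<open>m\<close> weights. The first three cells of the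
  corresponding block of discrete memory hold the vertex, the remaining depth and the parent's address. The
  first block is an artificial root whose children are the vertices, with \<open>a = 1\<close> and \<open>c = 0\<close>.\<close>

definition mu_addr :: "nat \<Rightarrow> nat \<Rightarrow> nexp" where
  "mu_addr q w = NAdd (NAdd (NAdd (R q) (R 2)) (NLit 3)) (R w)"

text \<open>The weights are copied first because the coefficient loop takes the weight of the new
  vertex from the new block.\<close>

definition new_block :: "cexp \<Rightarrow> cexp \<Rightarrow> com" where
  "new_block a c =
    Seq (For 12 (R 1) (SetCMem (mu_addr 10 12) (CMem (mu_addr 9 12))))
   (Seq (For 13 (NAdd (R 2) (NLit 1)) (SetCMem (NAdd (R 10) (R 13)) (CMul (CMem (mu_addr 10 11)) (CMem (R 13)))))
   (Seq (SetCMem (NAdd (NAdd (R 10) (R 2)) (NLit 1)) a)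
   (Seq (SetCMem (NAdd (NAdd (R 10) (R 2)) (NLit 2)) c)
   (Seq (SetNMem (R 10) (R 11))
   (Seq (SetNMem (NAdd (R 10) (NLit 1)) (NSub (NMem (NAdd (R 9) (NLit 1))) (NLit 1)))
   (Seq (SetNMem (NAdd (R 10) (NLit 2)) (R 9))
        (SetNReg 10 (NAdd (R 10) (R 8)))))))))"

text \<open>The parent's weights are updated in place, and the child copies them between the factors
  \<open>pre\<close> and \<open>post\<close>. With both equal to \<open>1 / b\<close>, the copies
  are exactly the child weights, earlier neighbours having received two factors and \<open>u\<close>
  one. With \<open>pre = 1\<close> and \<open>post = 0\<close>, each copy has all earlier vertices
  pinned, as the telescoping product requires.\<close>

definition expand :: "test \<Rightarrow> cexp \<Rightarrow> cexp \<Rightarrow> cexp \<Rightarrow> cexp \<Rightarrow> com" where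
  "expand p pre post a c = For 11 (R 1)
    (If_Then_Else p
      (Seq (SetCMem (mu_addr 9 11) (CMul (CMem (mu_addr 9 11)) pre))
      (Seq (new_block a c)
           (SetCMem (mu_addr 9 11) (CMul (CMem (mu_addr 9 11)) post))))
      Skip)"

text \<open>Replaces the parent's series P by \<open>Q = P * (a + r) / (1 + c * r)\<close> in place.
  Later coefficients need the earlier ones of P and Q only in the combination
  \<open>P - c * Q\<close>, which is what the scratch cells keep.\<close>

definition propagate :: com where
  "propagate =
    Seq (SetNReg 15 (NMem (NAdd (R 9) (NLit 2))))
    (For 13 (NAdd (R 2) (NLit 1))
      (Seq (SetCReg 3 (CMul (CMem (NAdd (NAdd (R 9) (R 2)) (NLit 1))) (CMem (NAdd (R 15) (R 13)))))
      (Seq (For 14 (R 13) (SetCReg 3 (CAdd (CReg 3)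
             (CMul (CMem (NAdd (NAdd (R 9) (NLit 1)) (R 14))) (CMem (NAdd (R 2) (NSub (R 13) (R 14))))))))
      (Seq (SetCMem (NAdd (NAdd (R 2) (NLit 1)) (R 13))
             (CSub (CMem (NAdd (R 15) (R 13))) (CMul (CMem (NAdd (NAdd (R 9) (R 2)) (NLit 2))) (CReg 3))))
           (SetCMem (NAdd (R 15) (R 13)) (CReg 3))))))"

text \<open>Newton's recurrence, then K halvings and K squarings; the number \<open>2 ^ K\<close>
  itself is never formed.\<close>

definition log_exp :: com where
  "log_exp =
    Seq (SetCReg 4 (COfNat (NLit 0)))
   (Seq (For 13 (R 2)
      (Seq (SetCReg 3 (CMul (COfNat (NAdd (R 13) (NLit 1))) (CMem (NAdd (R 9) (NAdd (R 13) (NLit 1))))))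
      (Seq (For 14 (R 13) (SetCReg 3 (CSub (CReg 3)
             (CMul (CMem (NAdd (NAdd (R 2) (NLit 2)) (R 14))) (CMem (NAdd (R 9) (NSub (R 13) (R 14))))))))
      (Seq (SetCMem (NAdd (NAdd (R 2) (NLit 2)) (R 13)) (CReg 3))
           (SetCReg 4 (CAdd (CReg 4) (CDiv (CReg 3) (COfNat (NAdd (R 13) (NLit 1))))))))))
   (Seq (For 13 (R 2) (SetCReg 4 (CDiv (CReg 4) (COfNat (NLit 2)))))
   (Seq (SetCReg 0 (CAdd (COfNat (NLit 1)) (CReg 4)))
        (For 13 (R 2) (SetCReg 0 (CMul (CReg 0) (CReg 0)))))))"

locale layout =
  fixes m K :: nat and b :: complex and z :: "complex fps" and X Y :: "nat \<Rightarrow> nat"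
begin

text \<open>All blocks have the same length, so the program can move between neighbouring blocks by
  adding or subtracting one register.\<close>

definition stride :: nat where "stride = K + 3 + m"
definition addr :: "nat \<Rightarrow> nat" where "addr i = 2 * K + 2 + 2 * m + i * stride"

lemma addr_less: "i < j \<Longrightarrow> addr i + stride \<le> addr j"
proof -
  assume "i < j"
  then have "Suc i * stride \<le> j * stride" by (intro mult_right_mono) auto
  then show ?thesis by (simp add: addr_def)
qed

lemma addr_Suc: "addr (Suc i) = addr i + stride" by (simp add: addr_def)

lemma addr_lower: "2 * K + 2 + 2 * m \<le> addr i" by (simp add: addr_def)

definition base :: "state \<Rightarrow> bool" where
  "base s \<longleftrightarrow> nreg s 1 = m \<and> nreg s 2 = K \<and> nreg s 6 = 2 * K + 2 \<and> nreg s 8 = stride \<and>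
     creg s 0 = b \<and> creg s 2 = 1 / b \<and> (\<forall>k\<le>K. cmem s k = fps_nth z k) \<and>
     (\<forall>e<m. cmem s (2 * K + 2 + 2 * e) = of_nat (X e) \<and> cmem s (2 * K + 2 + 2 * e + 1) = of_nat (Y e))"

definition block :: "(nat \<Rightarrow> complex) \<Rightarrow> nat \<Rightarrow> complex \<Rightarrow> complex \<Rightarrow> nat \<Rightarrow> complex" where
  "block \<mu> u a c k = (if k \<le> K then \<mu> u * fps_nth z k else if k = K + 1 then a
     else if k = K + 2 then c else \<mu> (k - (K + 3)))"

definition new_block_time :: "cexp \<Rightarrow> cexp \<Rightarrow> nat" where
  "new_block_time a c = for_time m (R 1) 20 + for_time (K + 1) (NAdd (R 2) (NLit 1)) 20 + 60 + ccost a + ccost c"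

lemma ok_new_block:
  assumes s: "base s" "nreg s 9 = addr i" "nreg s 10 = addr L" "i < L" "nreg s 11 = u" "u < m"
    and M: "\<And>w. w < m \<Longrightarrow> cmem s (addr i + (K + 3) + w) = M w"
    and d: "nmem s (addr i + 1) = d"
    and a: "\<And>s'. creg s' = creg s \<Longrightarrow> cval a s' = a'" and c: "\<And>s'. creg s' = creg s \<Longrightarrow> cval c s' = c'"
  shows "ok (new_block a c) s (new_block_time a c) (\<lambda>s'.
     (\<forall>r. r \<notin> {10, 12, 13} \<longrightarrow> nreg s' r = nreg s r) \<and> nreg s' 10 = addr (Suc L) \<and> creg s' = creg s \<and>
     nmem s' = (nmem s)(addr L := u, addr L + 1 := d - 1, addr L + 2 := addr i) \<and>
     cmem s' = (\<lambda>x. if addr L \<le> x \<and> x < addr (Suc L) then block M u a' c' (x - addr L) else cmem s x))"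
proof -
  have reg: "nreg s (Suc 0) = m" "nreg s 2 = K" "nreg s 8 = stride" and z: "\<And>k. k \<le> K \<Longrightarrow> cmem s k = fps_nth z k"
    using s by (auto simp: base_def)
  have sep: "addr i + stride \<le> addr L" using addr_less[OF s(4)] .
  have low: "2 * K + 2 + 2 * m \<le> addr L" by (rule addr_lower)
  let ?B = "addr L + (K + 3)"
  define I1 where "I1 = (\<lambda>w s'. s' = s\<lparr>nreg := (nreg s)(12 := w),
     cmem := \<lambda>x. if ?B \<le> x \<and> x < ?B + w then M (x - ?B) else cmem s x\<rparr>)"
  have 1: "ok (For 12 (R 1) (SetCMem (mu_addr 10 12) (CMem (mu_addr 9 12)))) s (for_time m (R 1) 20) (I1 m)"
  proof (rule ok_For)
    show "I1 0 (s\<lparr>nreg := (nreg s)(12 := 0)\<rparr>)" by (auto simp: I1_def fun_eq_iff intro!: state.equality)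
    show "nreg s' 12 = w \<and> nval (R 1) s' = m" if "I1 w s'" for w s'
      using that by (simp add: I1_def reg)
    show "ok (SetCMem (mu_addr 10 12) (CMem (mu_addr 9 12))) s' 20
       (\<lambda>s'. nreg s' 12 = w \<and> I1 (Suc w) (s'\<lparr>nreg := (nreg s')(12 := Suc w)\<rparr>))" if I: "I1 w s'" "w < m" for w s'
    proof (rule ok_SetCMem_val)
      show "nval (mu_addr 10 12) s' = ?B + w" using I s reg by (simp add: I1_def mu_addr_def add.assoc)
      show "cval (CMem (mu_addr 9 12)) s' = M w" using I sep M s reg by (auto simp: I1_def stride_def mu_addr_def add.assoc)
    qed (use I in \<open>auto simp: I1_def mu_addr_def fun_eq_iff intro!: state.equality\<close>)
  qed
  define g where "g = (\<lambda>k x. if addr L \<le> x \<and> x < addr L + k then M u * fps_nth z (x - addr L)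
      else if ?B \<le> x \<and> x < ?B + m then M (x - ?B) else cmem s x)"
  define I2 where "I2 = (\<lambda>k s'. s' = s\<lparr>nreg := (nreg s)(12 := m, 13 := k), cmem := g k\<rparr>)"
  have 2: "ok (For 13 (NAdd (R 2) (NLit 1)) (SetCMem (NAdd (R 10) (R 13)) (CMul (CMem (mu_addr 10 11)) (CMem (R 13)))))
     s' (for_time (K + 1) (NAdd (R 2) (NLit 1)) 20) (I2 (K + 1))" if I1: "I1 m s'" for s'
  proof (rule ok_For)
    show "I2 0 (s'\<lparr>nreg := (nreg s')(13 := 0)\<rparr>)"
      using I1 by (auto simp: I1_def I2_def g_def fun_eq_iff intro!: state.equality)
    show "nreg s' 13 = k \<and> nval (NAdd (R 2) (NLit 1)) s' = K + 1" if "I2 k s'" for k s'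
      using that by (simp add: I2_def reg)
    show "ok (SetCMem (NAdd (R 10) (R 13)) (CMul (CMem (mu_addr 10 11)) (CMem (R 13)))) s' 20
       (\<lambda>s'. nreg s' 13 = k \<and> I2 (Suc k) (s'\<lparr>nreg := (nreg s')(13 := Suc k)\<rparr>))" if I: "I2 k s'" "k < K + 1" for k s'
    proof (rule ok_SetCMem_val)
      have "g k (?B + u) = M u" "g k k = fps_nth z k" using I low s(6) by (auto simp: g_def z)
      then show "cval (CMul (CMem (mu_addr 10 11)) (CMem (R 13))) s' = M u * fps_nth z k"
        using I s reg by (auto simp: I2_def mu_addr_def add.assoc)
      show "nval (NAdd (R 10) (R 13)) s' = addr L + k" using I s by (simp add: I2_def)
      have "(g k)(addr L + k := M u * fps_nth z k) = g (Suc k)" using I(2) by (auto simp: g_def fun_eq_iff)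
      then show "nreg (s'\<lparr>cmem := (cmem s')(addr L + k := M u * fps_nth z k)\<rparr>) 13 = k \<and>
        I2 (Suc k) ((s'\<lparr>cmem := (cmem s')(addr L + k := M u * fps_nth z k)\<rparr>)
          \<lparr>nreg := (nreg (s'\<lparr>cmem := (cmem s')(addr L + k := M u * fps_nth z k)\<rparr>))(13 := Suc k)\<rparr>)"
        using I by (auto simp: I2_def intro!: state.equality)
    qed (simp add: mu_addr_def)
  qed
  let ?tail = "(Seq (SetCMem (NAdd (NAdd (R 10) (R 2)) (NLit 1)) a)
   (Seq (SetCMem (NAdd (NAdd (R 10) (R 2)) (NLit 2)) c)
   (Seq (SetNMem (R 10) (R 11))
   (Seq (SetNMem (NAdd (R 10) (NLit 1)) (NSub (NMem (NAdd (R 9) (NLit 1))) (NLit 1)))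
   (Seq (SetNMem (NAdd (R 10) (NLit 2)) (R 9))
        (SetNReg 10 (NAdd (R 10) (R 8))))))))"
  have g: "(g (K + 1))(addr L + K + 1 := a', addr L + K + 2 := c') =
     (\<lambda>x. if addr L \<le> x \<and> x < addr (Suc L) then block M u a' c' (x - addr L) else cmem s x)"
    by (auto simp: g_def fun_eq_iff block_def addr_Suc stride_def)
  have 3: "ok ?tail s' (55 + ccost a + ccost c) (\<lambda>s'.
     (\<forall>r. r \<notin> {10, 12, 13} \<longrightarrow> nreg s' r = nreg s r) \<and> nreg s' 10 = addr (Suc L) \<and> creg s' = creg s \<and>
     nmem s' = (nmem s)(addr L := u, addr L + 1 := d - 1, addr L + 2 := addr i) \<and>
     cmem s' = (\<lambda>x. if addr L \<le> x \<and> x < addr (Suc L) then block M u a' c' (x - addr L) else cmem s x))"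
    if I2: "I2 (K + 1) s'" for s'
    unfolding g[symmetric]
    apply (rule ok_conseq)
      apply (rule ok_Seq[OF ok_SetCMem[where Q = "(=) _"]], rule refl, rule order.refl, erule subst)+
      apply (rule ok_Seq[OF ok_SetNMem[where Q = "(=) _"]], rule refl, rule order.refl, erule subst)+
      apply (rule ok_SetNReg[where Q = "(=) _"], rule refl, rule order.refl)
    using I2 a c s reg d sep
     apply (auto simp: I2_def addr_Suc stride_def)
    done
  have "ok (new_block a c) s (1 + for_time m (R 1) 20 + (1 + for_time (K + 1) (NAdd (R 2) (NLit 1)) 20 + (55 + ccost a + ccost c))) (\<lambda>s'.
     (\<forall>r. r \<notin> {10, 12, 13} \<longrightarrow> nreg s' r = nreg s r) \<and> nreg s' 10 = addr (Suc L) \<and> creg s' = creg s \<and>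
     nmem s' = (nmem s)(addr L := u, addr L + 1 := d - 1, addr L + 2 := addr i) \<and>
     cmem s' = (\<lambda>x. if addr L \<le> x \<and> x < addr (Suc L) then block M u a' c' (x - addr L) else cmem s x))"
    unfolding new_block_def by (rule ok_Seq[OF 1 ok_Seq[OF 2 3]])
  then show ?thesis by (rule ok_conseq) (auto simp: new_block_time_def)
qed

end

subsection \<open>Building the computation tree\<close>

text \<open>Vertex, remaining depth, weights, and index of the parent.\<close>

type_synonym node = "nat \<times> nat \<times> (nat \<Rightarrow> complex) \<times> nat"

context layout
begin

text \<open>The data of a node that must survive until the tree is evaluated. The weights are kept
  apart, as they are destroyed when the node is expanded. Block 0 starts with the empty product
  1.\<close>

definition node_ok :: "state \<Rightarrow> nat \<Rightarrow> node \<Rightarrow> bool" where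
  "node_ok s i nd \<longleftrightarrow> (case nd of (v, d, \<mu>, p) \<Rightarrow>
     nmem s (addr i) = v \<and> nmem s (addr i + 1) = d \<and>
     (i > 0 \<longrightarrow> nmem s (addr i + 2) = addr p \<and> cmem s (addr i + K + 1) = (if p = 0 then 1 else b) \<and>
       cmem s (addr i + K + 2) = (if p = 0 then 0 else b)) \<and>
     (\<forall>k\<le>K. cmem s (addr i + k) = fps_nth (if i = 0 then 1 else fps_const (\<mu> v) * z) k))"

lemma node_okD:
  assumes "node_ok s i nd"
  shows "nmem s (addr i) = fst nd" "nmem s (addr i + 1) = fst (snd nd)"
    "i > 0 \<Longrightarrow> nmem s (addr i + 2) = addr (snd (snd (snd nd)))"
    "i > 0 \<Longrightarrow> cmem s (addr i + K + 1) = (if snd (snd (snd nd)) = 0 then 1 else b)"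
    "i > 0 \<Longrightarrow> cmem s (addr i + K + 2) = (if snd (snd (snd nd)) = 0 then 0 else b)"
    "k \<le> K \<Longrightarrow> cmem s (addr i + k) = fps_nth (if i = 0 then 1 else fps_const (fst (snd (snd nd)) (fst nd)) * z) k"
  using assms by (cases nd; simp add: node_ok_def)+

definition mu_ok :: "state \<Rightarrow> nat \<Rightarrow> (nat \<Rightarrow> complex) \<Rightarrow> bool" where
  "mu_ok s i \<mu> \<longleftrightarrow> (\<forall>w<m. cmem s (addr i + (K + 3) + w) = \<mu> w)"

text \<open>Only the nodes from \<open>lo\<close> on, which still wait for expansion, are required
  to have intact weights.\<close>

definition bfs_state :: "state \<Rightarrow> node list \<Rightarrow> nat \<Rightarrow> bool" where
  "bfs_state s ns lo \<longleftrightarrow> base s \<and> nreg s 10 = addr (length ns) \<and>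
     (\<forall>i<length ns. node_ok s i (ns ! i)) \<and>
     (\<forall>i. lo \<le> i \<and> i < length ns \<longrightarrow> mu_ok s i (fst (snd (snd (ns ! i)))))"

lemma base_frame:
  assumes "base s" "nreg s' 1 = nreg s 1" "nreg s' 2 = nreg s 2" "nreg s' 6 = nreg s 6" "nreg s' 8 = nreg s 8"
    "creg s' 0 = creg s 0" "creg s' 2 = creg s 2"
    and c: "\<And>x. x < 2 * K + 2 + 2 * m \<Longrightarrow> cmem s' x = cmem s x"
  shows "base s'"
proof -
  have "cmem s' k = cmem s k" if "k \<le> K" for k using that by (intro c) auto
  moreover have "cmem s' (2 * K + 2 + 2 * e) = cmem s (2 * K + 2 + 2 * e)"
    "cmem s' (2 * K + 2 + 2 * e + 1) = cmem s (2 * K + 2 + 2 * e + 1)" if "e < m" for e using that by (intro c; auto)+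
  ultimately show ?thesis using assms by (simp add: base_def)
qed

lemma node_ok_frame:
  assumes "node_ok s i nd" "\<And>x. addr i \<le> x \<Longrightarrow> x \<le> addr i + K + 2 \<Longrightarrow> cmem s' x = cmem s x"
    "\<And>x. addr i \<le> x \<Longrightarrow> x \<le> addr i + 2 \<Longrightarrow> nmem s' x = nmem s x"
  shows "node_ok s' i nd"
  using assms(1) unfolding node_ok_def by (auto simp: assms(2,3) split: prod.splits)

lemma mu_ok_frame:
  assumes "mu_ok s i \<mu>" "\<And>x. addr i \<le> x \<Longrightarrow> x < addr (Suc i) \<Longrightarrow> cmem s' x = cmem s x"
  shows "mu_ok s' i \<mu>"
proof -
  have "cmem s' (addr i + (K + 3) + w) = cmem s (addr i + (K + 3) + w)" if "w < m" for w
    using that by (intro assms(2)) (auto simp: addr_Suc stride_def)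
  then show ?thesis using assms(1) by (simp add: mu_ok_def)
qed

text \<open>Justifies the in-place updates of \<open>expand\<close>: the node being expanded lies
  below \<open>lo\<close>, and blocks do not overlap.\<close>

lemma bfs_state_write_mu:
  assumes s: "bfs_state s ns lo" and i: "i < lo" and w: "w < m"
  shows "bfs_state (s\<lparr>cmem := (cmem s)(addr i + (K + 3) + w := x)\<rparr>) ns lo"
proof -
  let ?s = "s\<lparr>cmem := (cmem s)(addr i + (K + 3) + w := x)\<rparr>"
  have "base ?s"
  proof (rule base_frame)
    show "base s" using s by (simp add: bfs_state_def)
    show "cmem ?s y = cmem s y" if "y < 2 * K + 2 + 2 * m" for y using that addr_lower[of i] by simp
  qed simp_all
  moreover have "node_ok ?s j (ns ! j)" if "j < length ns" for j
  proof (rule node_ok_frame)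
    show "node_ok s j (ns ! j)" using s that by (simp add: bfs_state_def)
    fix y assume "addr j \<le> y" "y \<le> addr j + K + 2"
    moreover have "i = j \<or> addr i + stride \<le> addr j \<or> addr j + stride \<le> addr i"
      using addr_less[of i j] addr_less[of j i] by (meson linorder_neqE_nat)
    ultimately have "y \<noteq> addr i + (K + 3) + w" using w unfolding stride_def
      by - (elim disjE; simp)
    then show "cmem ?s y = cmem s y" by simp
  qed simp
  moreover have "mu_ok ?s j (fst (snd (snd (ns ! j))))" if "lo \<le> j" "j < length ns" for j
  proof (rule mu_ok_frame)
    show "mu_ok s j (fst (snd (snd (ns ! j))))" using s that by (simp add: bfs_state_def)
    fix y assume "addr j \<le> y" "y < addr (Suc j)"
    moreover have "addr i + stride \<le> addr j" using i that by (intro addr_less) auto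
    ultimately have "y \<noteq> addr i + (K + 3) + w" using w unfolding stride_def by linarith
    then show "cmem ?s y = cmem s y" by simp
  qed
  ultimately show ?thesis using s by (simp add: bfs_state_def)
qed

lemma bfs_state_append:
  assumes s: "bfs_state s ns (Suc i)" and i: "i < length ns"
    and reg: "nreg s' 1 = nreg s 1" "nreg s' 2 = nreg s 2" "nreg s' 6 = nreg s 6" "nreg s' 8 = nreg s 8"
      "nreg s' 10 = addr (Suc (length ns))" "creg s' = creg s"
    and nm: "nmem s' = (nmem s)(addr (length ns) := u, addr (length ns) + 1 := d, addr (length ns) + 2 := addr i)"
    and cm: "cmem s' = (\<lambda>x. if addr (length ns) \<le> x \<and> x < addr (Suc (length ns))
        then block \<mu> u (if i = 0 then 1 else b) (if i = 0 then 0 else b) (x - addr (length ns)) else cmem s x)"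
  shows "bfs_state s' (ns @ [(u, d, \<mu>, i)]) (Suc i)"
proof -
  let ?L = "length ns"
  have "base s'"
  proof (rule base_frame)
    show "base s" using s by (simp add: bfs_state_def)
    show "cmem s' y = cmem s y" if "y < 2 * K + 2 + 2 * m" for y using that addr_lower[of ?L] by (simp add: cm)
  qed (simp_all only: reg)
  moreover have "node_ok s' j (ns ! j)" if "j < ?L" for j
  proof (rule node_ok_frame)
    have "addr j + stride \<le> addr ?L" using that by (rule addr_less)
    then show "cmem s' x = cmem s x" if "x \<le> addr j + K + 2" for x using that by (auto simp: cm stride_def)
    show "nmem s' x = nmem s x" if "x \<le> addr j + 2" for x
      using that \<open>addr j + stride \<le> addr ?L\<close> by (auto simp: nm stride_def)
    show "node_ok s j (ns ! j)" using s that by (simp add: bfs_state_def)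
  qed
  moreover have "mu_ok s' j (fst (snd (snd (ns ! j))))" if "Suc i \<le> j" "j < ?L" for j
  proof (rule mu_ok_frame)
    show "mu_ok s j (fst (snd (snd (ns ! j))))" using s that by (simp add: bfs_state_def)
    have "addr j + stride \<le> addr ?L" using that by (intro addr_less) auto
    then show "cmem s' x = cmem s x" if "x < addr (Suc j)" for x using that by (auto simp: cm addr_Suc)
  qed
  moreover have "node_ok s' ?L (u, d, \<mu>, i)"
    using i by (auto simp: node_ok_def nm cm block_def addr_Suc stride_def)
  moreover have "mu_ok s' ?L \<mu>"
    by (auto simp: mu_ok_def cm block_def addr_Suc stride_def)
  ultimately show ?thesis
    using reg(5) by (simp add: bfs_state_def nth_append less_Suc_eq)
qed

definition expand_time :: "test \<Rightarrow> cexp \<Rightarrow> cexp \<Rightarrow> cexp \<Rightarrow> cexp \<Rightarrow> nat" where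
  "expand_time p pre post a c = for_time m (R 1)
     (1 + tcost p + (1 + (25 + ccost pre) + (1 + new_block_time a c + (25 + ccost post))))"

text \<open>\<open>M u\<close> stands for the weights in block \<open>i\<close> when the loop
  reaches \<open>u\<close>, and \<open>C u\<close> for the copy handed to the child; the two
  recursions express the order \<open>pre\<close>, copy, \<open>post\<close>.\<close>

lemma ok_expand:
  assumes s: "bfs_state s ns (Suc i)" "nreg s 9 = addr i" "i < length ns" "mu_ok s i (M 0)"
    and nd: "fst (ns ! i) = v" "fst (snd (ns ! i)) = d"
    and p: "\<And>s' u. base s' \<Longrightarrow> nreg s' 9 = addr i \<Longrightarrow> nreg s' 11 = u \<Longrightarrow> u < m \<Longrightarrow>
       nmem s' (addr i) = v \<Longrightarrow> tval p s' \<longleftrightarrow> P u"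
    and e: "\<And>s'. creg s' 0 = b \<Longrightarrow> creg s' 2 = 1 / b \<Longrightarrow> cval pre s' = pre' \<and> cval post s' = post' \<and>
       cval a s' = (if i = 0 then 1 else b) \<and> cval c s' = (if i = 0 then 0 else b)"
    and C: "\<And>u. u < m \<Longrightarrow> P u \<Longrightarrow> C u = (M u)(u := M u u * pre')"
    and M: "\<And>u. u < m \<Longrightarrow> M (Suc u) = (if P u then (C u)(u := C u u * post') else M u)"
  shows "ok (expand p pre post a c) s (expand_time p pre post a c) (\<lambda>s'.
     bfs_state s' (ns @ map (\<lambda>u. (u, d - 1, C u, i)) (filter P [0..<m])) (Suc i) \<and> nreg s' 9 = addr i)"
proof -
  define NS where "NS = (\<lambda>u. ns @ map (\<lambda>u. (u, d - 1, C u, i)) (filter P [0..<u]))"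
  define J where "J = (\<lambda>u s'. bfs_state s' (NS u) (Suc i) \<and> nreg s' 9 = addr i \<and> nreg s' 11 = u \<and> mu_ok s' i (M u))"
  have iN: "i < length (NS u)" "NS u ! i = ns ! i" for u using s(3) by (auto simp: NS_def nth_append)
  have reg11: "bfs_state (s'\<lparr>nreg := (nreg s')(11 := x)\<rparr>) ns' lo = bfs_state s' ns' lo" 
     "mu_ok (s'\<lparr>nreg := (nreg s')(11 := x)\<rparr>) j \<mu> = mu_ok s' j \<mu>" for s' x ns' lo j \<mu>
    by (auto simp: bfs_state_def base_def node_ok_def mu_ok_def)
  have mu: "nval (mu_addr 9 11) s' = addr i + (K + 3) + u" "nval (mu_addr 9 11) s' = addr i + (K + 3) + nreg s' 11"
    if "base s'" "nreg s' 9 = addr i" "nreg s' 11 = u" for s' u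
    using that by (simp_all add: mu_addr_def base_def)
  let ?body = "Seq (SetCMem (mu_addr 9 11) (CMul (CMem (mu_addr 9 11)) pre))
      (Seq (new_block a c) (SetCMem (mu_addr 9 11) (CMul (CMem (mu_addr 9 11)) post)))"
  let ?T = "1 + (25 + ccost pre) + (1 + new_block_time a c + (25 + ccost post))"
  have body: "ok ?body s' ?T (\<lambda>s'. nreg s' 11 = u \<and> J (Suc u) (s'\<lparr>nreg := (nreg s')(11 := Suc u)\<rparr>))"
    if J: "J u s'" and u: "u < m" and P: "P u" for u s'
  proof -
    have bs: "base s'" using J by (simp add: J_def bfs_state_def)
    have ev: "cval pre t = pre'" "cval post t = post'" "cval a t = (if i = 0 then 1 else b)"
      "cval c t = (if i = 0 then 0 else b)" if "base t" for t
      using e[of t] that by (auto simp: base_def)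
    define s1 where "s1 = s'\<lparr>cmem := (cmem s')(addr i + (K + 3) + u := M u u * pre')\<rparr>"
    have 1: "ok (SetCMem (mu_addr 9 11) (CMul (CMem (mu_addr 9 11)) pre)) s' (25 + ccost pre) (\<lambda>t. t = s1)"
    proof (rule ok_SetCMem)
      show "s'\<lparr>cmem := (cmem s')(nval (mu_addr 9 11) s' := cval (CMul (CMem (mu_addr 9 11)) pre) s')\<rparr> = s1"
        using J bs u mu(1)[OF bs, of u] ev(1)[OF bs] by (simp add: s1_def J_def mu_ok_def)
    qed (simp add: mu_addr_def)
    have s1: "bfs_state s1 (NS u) (Suc i)" unfolding s1_def
      by (rule bfs_state_write_mu) (use J u in \<open>auto simp: J_def\<close>)
    then have bs1: "base s1" by (simp add: bfs_state_def)
    have r1: "nreg s1 9 = addr i" "nreg s1 11 = u" using J by (auto simp: s1_def J_def)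
    have mu1: "mu_ok s1 i (C u)" using J u P by (auto simp: s1_def J_def mu_ok_def C)
    let ?Q2 = "\<lambda>t. (\<forall>r. r \<notin> {10, 12, 13} \<longrightarrow> nreg t r = nreg s1 r) \<and> nreg t 10 = addr (Suc (length (NS u))) \<and> creg t = creg s1 \<and>
     nmem t = (nmem s1)(addr (length (NS u)) := u, addr (length (NS u)) + 1 := d - 1, addr (length (NS u)) + 2 := addr i) \<and>
     cmem t = (\<lambda>x. if addr (length (NS u)) \<le> x \<and> x < addr (Suc (length (NS u)))
         then block (C u) u (if i = 0 then 1 else b) (if i = 0 then 0 else b) (x - addr (length (NS u))) else cmem s1 x)"
    have 2: "ok (new_block a c) s1 (new_block_time a c) ?Q2"
    proof (rule ok_new_block[OF bs1 r1(1) _ iN(1) r1(2) u])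
      show "nreg s1 10 = addr (length (NS u))" using s1 by (simp add: bfs_state_def)
      show "cmem s1 (addr i + (K + 3) + w) = C u w" if "w < m" for w using mu1 that by (simp add: mu_ok_def)
      show "nmem s1 (addr i + 1) = d"
        using s1 iN[of u] nd node_okD(2)[of s1 i "ns ! i"] unfolding bfs_state_def by metis
      show "cval a t = (if i = 0 then 1 else b)" "cval c t = (if i = 0 then 0 else b)" if "creg t = creg s1" for t
        using e[of t] bs1 that by (auto simp: base_def)
    qed
    have 3: "ok (SetCMem (mu_addr 9 11) (CMul (CMem (mu_addr 9 11)) post)) t (25 + ccost post)
        (\<lambda>s'. nreg s' 11 = u \<and> J (Suc u) (s'\<lparr>nreg := (nreg s')(11 := Suc u)\<rparr>))" if t: "?Q2 t" for t
    proof -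
      have NS: "NS (Suc u) = NS u @ [(u, d - 1, C u, i)]" using P by (simp add: NS_def)
      have bt: "bfs_state t (NS (Suc u)) (Suc i)" unfolding NS
        by (rule bfs_state_append[OF s1 iN(1)]) (use t in auto)
      then have bst: "base t" by (simp add: bfs_state_def)
      have rt: "nreg t 9 = addr i" "nreg t 11 = u" using t r1 by auto
      have sep: "addr i + stride \<le> addr (length (NS u))" using iN by (intro addr_less)
      have mut: "mu_ok t i (C u)" by (rule mu_ok_frame[OF mu1]) (use t sep in \<open>auto simp: addr_Suc\<close>)
      have val: "nval (mu_addr 9 11) t = addr i + (K + 3) + u"
        "cval (CMul (CMem (mu_addr 9 11)) post) t = C u u * post'"
        using mu(1)[OF bst rt] ev(2)[OF bst] mut u by (simp_all add: mu_ok_def)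
      let ?t = "t\<lparr>cmem := (cmem t)(addr i + (K + 3) + u := C u u * post')\<rparr>"
      have "bfs_state ?t (NS (Suc u)) (Suc i)" by (rule bfs_state_write_mu[OF bt _ u]) simp
      moreover have "mu_ok ?t i (M (Suc u))" using mut u P by (auto simp: mu_ok_def M)
      ultimately have "nreg ?t 11 = u \<and> J (Suc u) (?t\<lparr>nreg := (nreg ?t)(11 := Suc u)\<rparr>)"
        using rt unfolding J_def reg11 by simp
      then show ?thesis by (intro ok_SetCMem_val[OF val]) (simp_all add: mu_addr_def)
    qed
    show ?thesis
      by (rule ok_Seq[OF 1], drule sym, hypsubst, rule ok_Seq[OF 2 3])
  qed
  have "ok (expand p pre post a c) s (for_time m (R 1) (1 + tcost p + ?T)) (J m)"
    unfolding expand_def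
  proof (rule ok_For)
    show "J 0 (s\<lparr>nreg := (nreg s)(11 := 0)\<rparr>)"
      using s unfolding J_def reg11 by (simp add: NS_def)
    show "nreg s' 11 = u \<and> nval (R 1) s' = m" if "J u s'" for u s'
      using that by (simp add: J_def bfs_state_def base_def)
    show "ok (If_Then_Else p ?body Skip) s' (1 + tcost p + ?T)
       (\<lambda>s'. nreg s' 11 = u \<and> J (Suc u) (s'\<lparr>nreg := (nreg s')(11 := Suc u)\<rparr>))" if J: "J u s'" and u: "u < m" for u s'
    proof (rule ok_If)
      have nv: "nmem s' (addr i) = v"
        using J iN[of u] nd node_okD(1)[of s' i "ns ! i"] unfolding J_def bfs_state_def by metis
      have tv: "tval p s' \<longleftrightarrow> P u" using J u nv by (intro p) (auto simp: J_def bfs_state_def)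
      show "ok ?body s' ?T (\<lambda>s'. nreg s' 11 = u \<and> J (Suc u) (s'\<lparr>nreg := (nreg s')(11 := Suc u)\<rparr>))" if "tval p s'"
        using body[OF J u] tv that by blast
      show "ok Skip s' ?T (\<lambda>s'. nreg s' 11 = u \<and> J (Suc u) (s'\<lparr>nreg := (nreg s')(11 := Suc u)\<rparr>))" if "\<not> tval p s'"
      proof (rule ok_Skip)
        have "\<not> P u" using tv that by simp
        then have "NS (Suc u) = NS u" "M (Suc u) = M u" using u by (simp_all add: NS_def M)
        then show "nreg s' 11 = u \<and> J (Suc u) (s'\<lparr>nreg := (nreg s')(11 := Suc u)\<rparr>)"
          using J unfolding J_def reg11 by simp
      qed simp
    qed
  qed
  then show ?thesis
    by (rule ok_conseq) (auto simp: expand_time_def J_def NS_def)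
qed

end

lemma prod_list_filter_upt:
  "prod_list (map f (filter P [0..<m])) = (\<Prod>u | u < m \<and> P u. f u :: 'a::comm_monoid_mult)"
proof -
  have "prod f (set (filter P [0..<m])) = prod_list (map f (filter P [0..<m]))"
    by (rule prod.distinct_set_conv_list) simp
  moreover have "set (filter P [0..<m]) = {u. u < m \<and> P u}" by auto
  ultimately show ?thesis by simp
qed

text \<open>The number of nodes of the full D-ary tree of the given depth.\<close>

primrec tree_size :: "nat \<Rightarrow> nat \<Rightarrow> nat" where
  "tree_size D 0 = 1"
| "tree_size D (Suc k) = 1 + D * tree_size D k"

lemma tree_size_pos: "1 \<le> tree_size D k"
  by (cases k) auto

lemma tree_size_le: "tree_size D k \<le> (D + 1) ^ k"
proof (induction k)
  case (Suc k)
  have "1 + D * tree_size D k \<le> (D + 1) ^ k + D * (D + 1) ^ k"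
    using Suc by (intro add_mono mult_left_mono) auto
  then show ?case by simp
qed simp

definition vertex_x :: "nexp \<Rightarrow> cexp" where
  "vertex_x e = CMem (NAdd (R 6) (NAdd e e))"

definition vertex_y :: "nexp \<Rightarrow> cexp" where
  "vertex_y e = CMem (NAdd (NAdd (R 6) (NAdd e e)) (NLit 1))"

text \<open>The right-hand side is \<open>0\<close> for distinct indices and, since \<open>0 / 0 = 0\<close>, it is \<open>1\<close> for equal ones;
  in the latter case the left-hand side vanishes.\<close>

definition adj_test :: test where
  "adj_test =
    (let e = NMem (R 9); f = R 11 in
     CEq (CMul (CMul (CSub (vertex_x e) (vertex_x f)) (CSub (vertex_x e) (vertex_y f)))
               (CMul (CSub (vertex_y e) (vertex_x f)) (CSub (vertex_y e) (vertex_y f))))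
         (CSub (COfNat (NLit 1)) (CDiv (CSub (COfNat e) (COfNat f)) (CSub (COfNat e) (COfNat f)))))"

definition true_test :: test where
  "true_test = CEq (COfNat (NLit 0)) (COfNat (NLit 0))"

text \<open>The zero written at the node's own vertex is the pinning \<open>l(v := 0)\<close> inside
  \<open>child_weight\<close>. Nodes of remaining depth 0 become leaves.\<close>

definition expand_node :: com where
  "expand_node =
    If_Then_Else (NLess (NLit 0) (NMem (NAdd (R 9) (NLit 1))))
      (Seq (SetCMem (NAdd (NAdd (NAdd (R 9) (R 2)) (NLit 3)) (NMem (R 9))) (COfNat (NLit 0)))
           (expand adj_test (CReg 2) (CReg 2) (CReg 0) (CReg 0)))
      Skip"

text \<open>The sequence of blocks serves as the queue of a breadth-first search, with register 9 as
  its head and register 10 as its end.\<close>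

definition build_tree :: com where
  "build_tree =
    Seq (expand true_test (COfNat (NLit 1)) (COfNat (NLit 0)) (COfNat (NLit 1)) (COfNat (NLit 0)))
   (Seq (SetNReg 9 (NAdd (R 9) (R 8)))
        (While (NLess (R 9) (R 10)) (Seq expand_node (SetNReg 9 (NAdd (R 9) (R 8))))))"

context layout
begin

definition adj :: "nat \<Rightarrow> nat \<Rightarrow> bool" where
  "adj v u \<longleftrightarrow> v \<noteq> u \<and> (X v = X u \<or> X v = Y u \<or> Y v = X u \<or> Y v = Y u)"

sublocale adjacency adj m
  by unfold_locales (auto simp: adj_def)

definition children :: "node \<Rightarrow> nat \<Rightarrow> node list" where
  "children nd i = (case nd of (v, d, \<mu>, p) \<Rightarrow> if d = 0 then []
     else map (\<lambda>u. (u, d - 1, child_weight adj (1 / b) \<mu> v u, i)) (filter (adj v) [0..<m]))"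

definition root :: "nat \<Rightarrow> node" where
  "root u = (u, K, \<lambda>w. if w < u then 0 else 1, 0)"

text \<open>The queue after the nodes \<open>0, ..., i\<close> have been expanded. The artificial
  root has depth \<open>K + 1\<close> so that its children get depth \<open>K\<close> by the usual
  rule.\<close>

primrec bfs :: "nat \<Rightarrow> node list" where
  "bfs 0 = (0, K + 1, \<lambda>_. 1, 0) # map root [0..<m]"
| "bfs (Suc i) = (if Suc i < length (bfs i) then bfs i @ children (bfs i ! Suc i) (Suc i) else bfs i)"

abbreviation "parent nd \<equiv> snd (snd (snd nd))"

lemma children_nodes:
  "nd' \<in> set (children nd i) \<Longrightarrow> fst nd' < m \<and> parent nd' = i"
  by (auto simp: children_def split: prod.splits if_splits)

text \<open>Parents precede their children; going through the blocks backwards therefore meets each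
  node only after all its children.\<close>

lemma bfs_nodes:
  assumes "j < length (bfs i)" "0 < j"
  shows "fst (bfs i ! j) < m \<and> parent (bfs i ! j) < j"
  using assms
proof (induction i arbitrary: j)
  case 0
  then show ?case by (cases j) (auto simp: root_def)
next
  case (Suc i)
  show ?case
  proof (cases "Suc i < length (bfs i) \<and> \<not> j < length (bfs i)")
    case True
    then have "j - length (bfs i) < length (children (bfs i ! Suc i) (Suc i))" using Suc.prems by auto
    then have "children (bfs i ! Suc i) (Suc i) ! (j - length (bfs i)) \<in> set (children (bfs i ! Suc i) (Suc i))"
      by simp
    from children_nodes[OF this] show ?thesis using True by (simp add: nth_append)
  next
    case False
    then show ?thesis using Suc by (auto simp: nth_append split: if_splits)
  qed
qed

lemma prod_nth_append:
  fixes g :: "'n \<Rightarrow> 'a::comm_monoid_mult"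
  assumes "1 \<le> length xs"
  shows "(\<Prod>j | 1 \<le> j \<and> j < length (xs @ ys) \<and> P ((xs @ ys) ! j). g ((xs @ ys) ! j))
    = (\<Prod>j | 1 \<le> j \<and> j < length xs \<and> P (xs ! j). g (xs ! j)) * prod_list (map g (filter P ys))"
proof (induction ys rule: rev_induct)
  case Nil
  then show ?case by simp
next
  case (snoc y ys)
  let ?zs = "xs @ ys"
  have e: "{j. 1 \<le> j \<and> j < length (xs @ ys @ [y]) \<and> P ((xs @ ys @ [y]) ! j)} =
     {j. 1 \<le> j \<and> j < length ?zs \<and> P (?zs ! j)} \<union> (if P y then {length ?zs} else {})"
    using assms by (auto simp: nth_append less_Suc_eq split: if_splits)
  have "(\<Prod>j | 1 \<le> j \<and> j < length (xs @ ys @ [y]) \<and> P ((xs @ ys @ [y]) ! j). g ((xs @ ys @ [y]) ! j))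
    = (\<Prod>j | 1 \<le> j \<and> j < length ?zs \<and> P (?zs ! j). g ((xs @ ys @ [y]) ! j)) * (if P y then g y else 1)"
    unfolding e by (subst prod.union_disjoint) (auto simp: nth_append)
  also have "(\<Prod>j | 1 \<le> j \<and> j < length ?zs \<and> P (?zs ! j). g ((xs @ ys @ [y]) ! j))
    = (\<Prod>j | 1 \<le> j \<and> j < length ?zs \<and> P (?zs ! j). g (?zs ! j))"
    by (intro prod.cong refl) (auto simp: nth_append)
  finally show ?case using snoc by (simp add: mult.assoc)
qed

lemma bfs_length_ge: "1 \<le> length (bfs i)"
  by (induction i) auto

text \<open>Translates the product over children in the recursion into a product over blocks with a
  given parent pointer, which is the form in which the memory presents it.\<close>

lemma bfs_prod:
  fixes g :: "node \<Rightarrow> 'a::comm_monoid_mult"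
  assumes "Suc i \<le> length (bfs i)"
  shows "(\<Prod>j | 1 \<le> j \<and> j < length (bfs i) \<and> parent (bfs i ! j) = q. g (bfs i ! j))
    = (if q = 0 then (\<Prod>u<m. g (root u)) else if q \<le> i then prod_list (map g (children (bfs i ! q) q)) else 1)"
  using assms
proof (induction i)
  case 0
  let ?xs = "[(0, K + 1, \<lambda>_. 1, 0)] :: node list"
  have e: "{j. 1 \<le> j \<and> j < length ?xs \<and> parent (?xs ! j) = q} = {}" by auto
  have b: "bfs 0 = ?xs @ map root [0..<m]" by simp
  have "(\<Prod>j | 1 \<le> j \<and> j < length (bfs 0) \<and> parent (bfs 0 ! j) = q. g (bfs 0 ! j))
     = (\<Prod>j | 1 \<le> j \<and> j < length ?xs \<and> parent (?xs ! j) = q. g (?xs ! j)) *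
       prod_list (map g (filter (\<lambda>nd. parent nd = q) (map root [0..<m])))"
    unfolding b by (rule prod_nth_append) simp
  also have "\<dots> = prod_list (map g (filter (\<lambda>nd. parent nd = q) (map root [0..<m])))"
    unfolding e by simp
  also have "\<dots> = (if q = 0 then (\<Prod>u<m. g (root u)) else 1)"
    using prod_list_filter_upt[of "g \<circ> root" "\<lambda>_. q = 0" m]
    by (simp add: filter_map o_def root_def lessThan_def split: if_splits)
  finally show ?case by simp
next
  case (Suc i)
  show ?case
  proof (cases "Suc i < length (bfs i)")
    case False
    then show ?thesis using Suc.prems by simp
  next
    case True
    let ?xs = "bfs i" and ?ys = "children (bfs i ! Suc i) (Suc i)"
    have b: "bfs (Suc i) = ?xs @ ?ys" using True by simp
    have f: "filter (\<lambda>nd. parent nd = q) ?ys = (if q = Suc i then ?ys else [])"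
      using children_nodes by (auto simp: filter_id_conv filter_empty_conv)
    have nth: "q \<le> Suc i \<Longrightarrow> bfs (Suc i) ! q = bfs i ! q" using True by (simp add: nth_append)
    have "(\<Prod>j | 1 \<le> j \<and> j < length (bfs (Suc i)) \<and> parent (bfs (Suc i) ! j) = q. g (bfs (Suc i) ! j))
      = (\<Prod>j | 1 \<le> j \<and> j < length ?xs \<and> parent (?xs ! j) = q. g (?xs ! j)) * prod_list (map g (if q = Suc i then ?ys else []))"
      unfolding b f[symmetric] by (rule prod_nth_append) (rule bfs_length_ge)
    also have "\<dots> = (if q = 0 then (\<Prod>u<m. g (root u)) else if q \<le> Suc i then prod_list (map g (children (bfs (Suc i) ! q) q)) else 1)"
      using Suc.IH True nth by (auto simp del: bfs.simps simp: le_Suc_eq)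
    finally show ?thesis .
  qed
qed

text \<open>A potential argument: the number of expanded nodes plus the full tree sizes of the
  waiting nodes never increases, since expanding a node replaces its tree by itself and at most
  \<open>D\<close> subtrees.\<close>

lemma bfs_size:
  assumes D: "\<And>v. v < m \<Longrightarrow> card {u. u < m \<and> adj v u} \<le> D"
    and i: "Suc i \<le> length (bfs i)"
  shows "length (bfs i) \<le> 1 + m * tree_size D K"
proof -
  let ?w = "\<lambda>nd :: node. tree_size D (fst (snd nd))"
  have main: "Suc i + sum_list (map ?w (drop (Suc i) (bfs i))) \<le> 1 + m * tree_size D K"
    using i
  proof (induction i)
    case 0
    then show ?case by (simp add: root_def o_def sum_list_triv)
  next
    case (Suc i)
    show ?case
    proof (cases "Suc i < length (bfs i)")
      case False
      then show ?thesis using Suc.prems by simp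
    next
      case True
      obtain v d \<mu> p where nd: "bfs i ! Suc i = (v, d, \<mu>, p)" by (cases "bfs i ! Suc i")
      have "v < m" using bfs_nodes[OF True] nd by simp
      have ch: "1 + sum_list (map ?w (children (bfs i ! Suc i) (Suc i))) \<le> ?w (bfs i ! Suc i)"
      proof (cases d)
        case (Suc k)
        have "length (filter (adj v) [0..<m]) = card {u. u < m \<and> adj v u}"
          by (subst distinct_card[symmetric]) (auto intro: arg_cong[where f = card])
        then have "length (filter (adj v) [0..<m]) * tree_size D k \<le> D * tree_size D k"
          using D[OF \<open>v < m\<close>] by simp
        then show ?thesis by (simp add: nd children_def Suc o_def sum_list_triv)
      qed (simp add: nd children_def)
      have "drop (Suc i) (bfs i) = (bfs i ! Suc i) # drop (Suc (Suc i)) (bfs i)"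
        using True by (simp add: Cons_nth_drop_Suc)
      then have "Suc (Suc i) + sum_list (map ?w (drop (Suc (Suc i)) (bfs (Suc i))))
         \<le> Suc i + sum_list (map ?w (drop (Suc i) (bfs i)))"
        using True ch by simp
      then show ?thesis using Suc.IH True by linarith
    qed
  qed
  have "length xs \<le> sum_list (map ?w xs)" for xs
  proof (induction xs)
    case (Cons x xs)
    then show ?case using tree_size_pos[of D "fst (snd x)"] by (simp add: add_mono)
  qed simp
  from this[of "drop (Suc i) (bfs i)"] show ?thesis using main i by simp
qed

lemma tval_adj_test:
  assumes "base s" "nreg s 9 = addr i" "nreg s 11 = u" "u < m" "nmem s (addr i) = v" "v < m"
  shows "tval adj_test s \<longleftrightarrow> adj v u"
proof -
  have x: "cval (vertex_x e) s = of_nat (X w)" "cval (vertex_y e) s = of_nat (Y w)" if "nval e s = w" "w < m" for e w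
  proof -
    have a: "nreg s 6 + (w + w) = 2 * K + 2 + 2 * w" using assms(1) by (simp add: base_def)
    have "cmem s (nreg s 6 + (w + w)) = of_nat (X w)" "cmem s (nreg s 6 + (w + w) + 1) = of_nat (Y w)"
      unfolding a using assms(1) \<open>w < m\<close> unfolding base_def by blast+
    then show "cval (vertex_x e) s = of_nat (X w)" "cval (vertex_y e) s = of_nat (Y w)"
      by (simp_all add: vertex_x_def vertex_y_def \<open>nval e s = w\<close>)
  qed
  have c: "(of_nat i - of_nat j = (0::complex)) \<longleftrightarrow> i = j" for i j :: nat by simp
  show ?thesis
    using x[of "NMem (R 9)" v] x[of "R 11" u] assms
    by (cases "v = u") (simp_all add: adj_test_def Let_def adj_def)
qed

definition node_time :: nat where
  "node_time = 100 + expand_time adj_test (CReg 2) (CReg 2) (CReg 0) (CReg 0)"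

lemma ok_expand_node:
  assumes s: "bfs_state s (bfs i) (Suc i)" "nreg s 9 = addr (Suc i)" "Suc i < length (bfs i)"
  shows "ok expand_node s node_time (\<lambda>s'. bfs_state s' (bfs (Suc i)) (Suc (Suc i)) \<and> nreg s' 9 = addr (Suc i))"
proof -
  obtain v d \<mu> p where nd: "bfs i ! Suc i = (v, d, \<mu>, p)" by (cases "bfs i ! Suc i")
  have v: "v < m" using bfs_nodes[OF s(3)] nd by simp
  have node: "node_ok s (Suc i) (v, d, \<mu>, p)" "mu_ok s (Suc i) \<mu>" and bs: "base s"
    using s nd by (auto simp: bfs_state_def)
  have nv: "nmem s (addr (Suc i)) = v" "nmem s (addr (Suc i) + 1) = d"
    using node_okD(1,2)[OF node(1)] by simp_all
  have K: "nreg s 2 = K" using bs by (simp add: base_def)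
  have weaker: "bfs_state s (bfs i) (Suc (Suc i))" using s by (auto simp: bfs_state_def)
  let ?E = "expand adj_test (CReg 2) (CReg 2) (CReg 0) (CReg 0)"
  let ?Q = "\<lambda>s'. bfs_state s' (bfs (Suc i)) (Suc (Suc i)) \<and> nreg s' 9 = addr (Suc i)"
  have "ok expand_node s (1 + tcost (NLess (NLit 0) (NMem (NAdd (R 9) (NLit 1)))) + (1 + 30 + expand_time adj_test (CReg 2) (CReg 2) (CReg 0) (CReg 0))) ?Q"
    unfolding expand_node_def
  proof (rule ok_If)
    assume "tval (NLess (NLit 0) (NMem (NAdd (R 9) (NLit 1)))) s"
    then have d: "0 < d" using nv s by simp
    let ?s = "s\<lparr>cmem := (cmem s)(addr (Suc i) + (K + 3) + v := 0)\<rparr>"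
    have s': "bfs_state ?s (bfs i) (Suc (Suc i))" by (rule bfs_state_write_mu[OF weaker _ v]) simp
    \<comment> \<open>The states of the switching process at \<open>v\<close>; passing from
      \<open>u\<close> to \<open>Suc u\<close> costs a factor \<open>(1 / b)^2\<close>, applied in
      two halves around the copy.\<close>
    define M where "M = nbr_scale adj (1 / b) (\<mu>(v := 0)) v"
    have 1: "ok (SetCMem (NAdd (NAdd (NAdd (R 9) (R 2)) (NLit 3)) (NMem (R 9))) (COfNat (NLit 0))) s 30 (\<lambda>t. t = ?s)"
      by (rule ok_SetCMem) (use nv s(2) K in \<open>auto simp: add.assoc\<close>)
    have 2: "ok ?E ?s (expand_time adj_test (CReg 2) (CReg 2) (CReg 0) (CReg 0)) (\<lambda>s'.
        bfs_state s' (bfs i @ map (\<lambda>u. (u, d - 1, child_weight adj (1 / b) \<mu> v u, Suc i)) (filter (adj v) [0..<m])) (Suc (Suc i)) \<and> nreg s' 9 = addr (Suc i))"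
    proof (rule ok_expand[OF s' _ s(3), where M = M and v = v and pre' = "1 / b" and post' = "1 / b"])
      show "nreg ?s 9 = addr (Suc i)" using s by simp
      show "mu_ok ?s (Suc i) (M 0)" using node(2) by (auto simp: mu_ok_def M_def nbr_scale_def)
      show "fst (bfs i ! Suc i) = v" "fst (snd (bfs i ! Suc i)) = d" using nd by simp_all
      show "tval adj_test s' = adj v u" if "base s'" "nreg s' 9 = addr (Suc i)" "nreg s' 11 = u" "u < m" "nmem s' (addr (Suc i)) = v" for s' u
        using tval_adj_test that v by blast
      show "child_weight adj (1 / b) \<mu> v u = (M u)(u := M u u * (1 / b))" if "adj v u" for u
        using that by (auto simp: child_weight_def M_def nbr_scale_def adj_def)
      show "M (Suc u) = (if adj v u then (child_weight adj (1 / b) \<mu> v u)(u := child_weight adj (1 / b) \<mu> v u u * (1 / b)) else M u)" for u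
        by (auto simp: child_weight_def M_def nbr_scale_def adj_def fun_eq_iff less_Suc_eq power2_eq_square)
    qed simp
    have "bfs (Suc i) = bfs i @ map (\<lambda>u. (u, d - 1, child_weight adj (1 / b) \<mu> v u, Suc i)) (filter (adj v) [0..<m])"
      using s(3) d by (simp add: nd children_def)
    with 2 have 2: "ok ?E ?s (expand_time adj_test (CReg 2) (CReg 2) (CReg 0) (CReg 0)) ?Q" by simp
    show "ok (Seq (SetCMem (NAdd (NAdd (NAdd (R 9) (R 2)) (NLit 3)) (NMem (R 9))) (COfNat (NLit 0))) ?E) s
      (1 + 30 + expand_time adj_test (CReg 2) (CReg 2) (CReg 0) (CReg 0)) ?Q"
      by (rule ok_Seq[OF 1]) (use 2 in simp)
  next
    assume "\<not> tval (NLess (NLit 0) (NMem (NAdd (R 9) (NLit 1)))) s"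
    then have "d = 0" using nv s by simp
    then have "bfs (Suc i) = bfs i" using s by (simp add: nd children_def)
    then show "ok Skip s (1 + 30 + expand_time adj_test (CReg 2) (CReg 2) (CReg 0) (CReg 0)) ?Q"
      using weaker s by (intro ok_Skip) auto
  qed
  then show ?thesis by (rule ok_conseq) (auto simp: node_time_def)
qed

definition build_time :: "nat \<Rightarrow> nat" where
  "build_time N = expand_time true_test (COfNat (NLit 1)) (COfNat (NLit 0)) (COfNat (NLit 1)) (COfNat (NLit 0))
     + N * (node_time + 20) + 30"

lemma ok_build_tree:
  assumes D: "\<And>v. v < m \<Longrightarrow> card {u. u < m \<and> adj v u} \<le> D"
    and s: "bfs_state s [(0, K + 1, \<lambda>_. 1, 0)] 0" "nreg s 9 = addr 0"
  shows "ok build_tree s (build_time (1 + m * tree_size D K))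
    (\<lambda>s'. \<exists>i. Suc i = length (bfs i) \<and> bfs_state s' (bfs i) (Suc i) \<and> nreg s' 9 = addr (Suc i))"
proof -
  let ?N = "1 + m * tree_size D K"
  let ?t = "expand_time true_test (COfNat (NLit 1)) (COfNat (NLit 0)) (COfNat (NLit 1)) (COfNat (NLit 0))"
  define M where "M = (\<lambda>(u::nat) w. if w < u then 0 else 1 :: complex)"
  have "ok (expand true_test (COfNat (NLit 1)) (COfNat (NLit 0)) (COfNat (NLit 1)) (COfNat (NLit 0))) s ?t
     (\<lambda>s'. bfs_state s' ([(0, K + 1, \<lambda>_. 1, 0)] @ map (\<lambda>u. (u, K + 1 - 1, M u, 0)) (filter (\<lambda>_. True) [0..<m])) (Suc 0) \<and> nreg s' 9 = addr 0)"
  proof (rule ok_expand[where M = M and v = 0 and pre' = 1 and post' = 0])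
    show "bfs_state s [(0, K + 1, \<lambda>_. 1, 0)] (Suc 0)" using s by (simp add: bfs_state_def)
    show "mu_ok s 0 (M 0)" using s by (simp add: bfs_state_def M_def)
  qed (use s in \<open>auto simp: true_test_def M_def fun_eq_iff less_Suc_eq\<close>)
  then have 1: "ok (expand true_test (COfNat (NLit 1)) (COfNat (NLit 0)) (COfNat (NLit 1)) (COfNat (NLit 0))) s ?t
     (\<lambda>s'. bfs_state s' (bfs 0) (Suc 0) \<and> nreg s' 9 = addr 0)"
    by (rule ok_conseq) (simp_all add: root_def[abs_def] M_def)
  define I where "I = (\<lambda>i s. bfs_state s (bfs i) (Suc i) \<and> nreg s 9 = addr (Suc i) \<and> Suc i \<le> length (bfs i))"
  have reg9: "bfs_state (s'\<lparr>nreg := (nreg s')(9 := x)\<rparr>) ns' lo = bfs_state s' ns' lo" for s' x ns' lo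
    by (auto simp: bfs_state_def base_def node_ok_def mu_ok_def)
  have str: "bfs_state s' ns' lo \<Longrightarrow> nreg s' 8 = stride" for s' ns' lo by (simp add: bfs_state_def base_def)
  have 2: "ok (SetNReg 9 (NAdd (R 9) (R 8))) s' 4 (I 0)" if "bfs_state s' (bfs 0) (Suc 0) \<and> nreg s' 9 = addr 0" for s'
    using that bfs_length_ge[of 0] by (intro ok_SetNReg) (auto simp: I_def reg9 str addr_Suc simp del: bfs.simps)
  have 3: "ok (While (NLess (R 9) (R 10)) (Seq expand_node (SetNReg 9 (NAdd (R 9) (R 8))))) s'
     ((?N - 0) * (1 + tcost (NLess (R 9) (R 10)) + (1 + node_time + 4)) + (1 + tcost (NLess (R 9) (R 10))))
     (\<lambda>s'. \<exists>j\<le>?N. I j s' \<and> \<not> tval (NLess (R 9) (R 10)) s')" if I0: "I 0 s'" for s'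
  proof (rule ok_While[where I = I, OF I0], goal_cases)
    case (2 i t)
    have len: "Suc i < length (bfs i)"
    proof (rule ccontr)
      assume "\<not> Suc i < length (bfs i)"
      then have "length (bfs i) = Suc i" using 2 by (simp add: I_def)
      then show False using 2 by (simp add: I_def bfs_state_def)
    qed
    then have "i < ?N" using bfs_size[OF D, of i] by simp
    moreover have "ok (Seq expand_node (SetNReg 9 (NAdd (R 9) (R 8)))) t (1 + node_time + 4) (I (Suc i))"
    proof (rule ok_Seq)
      show "ok expand_node t node_time (\<lambda>s'. bfs_state s' (bfs (Suc i)) (Suc (Suc i)) \<and> nreg s' 9 = addr (Suc i))"
        using 2 len by (intro ok_expand_node) (auto simp: I_def)
      show "ok (SetNReg 9 (NAdd (R 9) (R 8))) s' 4 (I (Suc i))"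
        if "bfs_state s' (bfs (Suc i)) (Suc (Suc i)) \<and> nreg s' 9 = addr (Suc i)" for s'
      proof (rule ok_SetNReg)
        have "Suc (Suc i) \<le> length (bfs (Suc i))" using len by simp
        then show "I (Suc i) (s'\<lparr>nreg := (nreg s')(9 := nval (NAdd (R 9) (R 8)) s')\<rparr>)"
          using that str[of s' "bfs (Suc i)" "Suc (Suc i)"] by (simp add: I_def reg9 addr_Suc del: bfs.simps)
      qed simp
    qed
    ultimately show ?case ..
  qed simp
  have "ok build_tree s (1 + ?t + (1 + 4 + ((?N - 0) * (1 + tcost (NLess (R 9) (R 10)) + (1 + node_time + 4)) + (1 + tcost (NLess (R 9) (R 10))))))
    (\<lambda>s'. \<exists>j\<le>?N. I j s' \<and> \<not> tval (NLess (R 9) (R 10)) s')"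
    unfolding build_tree_def by (rule ok_Seq[OF 1 ok_Seq[OF 2 3]])
  then show ?thesis
  proof (rule ok_conseq)
    show "1 + ?t + (1 + 4 + ((?N - 0) * (1 + tcost (NLess (R 9) (R 10)) + (1 + node_time + 4)) + (1 + tcost (NLess (R 9) (R 10))))) \<le> build_time ?N"
      by (simp add: build_time_def algebra_simps)
    fix s' assume "\<exists>j\<le>?N. I j s' \<and> \<not> tval (NLess (R 9) (R 10)) s'"
    then obtain j where j: "I j s'" "\<not> tval (NLess (R 9) (R 10)) s'" by blast
    have "\<not> Suc j < length (bfs j)"
    proof
      assume "Suc j < length (bfs j)"
      then have "addr (Suc j) + stride \<le> addr (length (bfs j))" by (rule addr_less)
      then show False using j by (simp add: I_def bfs_state_def stride_def)
    qed
    then show "\<exists>i. Suc i = length (bfs i) \<and> bfs_state s' (bfs i) (Suc i) \<and> nreg s' 9 = addr (Suc i)"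
      using j(1) unfolding I_def by (metis le_neq_implies_less)
  qed
qed

end

subsection \<open>Power series arithmetic\<close>

text \<open>Multiply by \<open>1 + c * r\<close> and compare coefficients. As \<open>r\<close> has
  no constant term, only lower coefficients of Q occur on the right, and no series has to be
  inverted.\<close>

lemma edge_factor_nth:
  fixes P r :: "complex fps" and a c :: complex
  assumes r: "fps_nth r 0 = 0"
  defines "Q \<equiv> P * edge_factor (fps_const a) (fps_const c) r"
  shows "fps_nth Q k = a * fps_nth P k +
    (\<Sum>j<k. fps_nth r (Suc j) * (fps_nth P (k - Suc j) - c * fps_nth Q (k - Suc j)))"
proof -
  have shift: "fps_nth (r * F) k = (\<Sum>j<k. fps_nth r (Suc j) * fps_nth F (k - Suc j))" for F :: "complex fps"
  proof -
    have "fps_nth (r * F) k = (\<Sum>i<Suc k. fps_nth r i * fps_nth F (k - i))"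
      by (simp add: fps_mult_nth atLeast0AtMost lessThan_Suc_atMost)
    then show ?thesis by (simp only: sum.lessThan_Suc_shift r mult_zero_left add_0)
  qed
  have "Q * (1 + fps_const c * r) = P * (fps_const a + r)"
    using inverse_one_plus[OF r, of "fps_const c"] by (simp add: Q_def edge_factor_def mult.assoc)
  then have "Q = fps_const a * P + (r * P - fps_const c * (r * Q))"
    by (simp add: algebra_simps)
  then have "fps_nth Q k = fps_nth (fps_const a * P + (r * P - fps_const c * (r * Q))) k" by simp
  also have "\<dots> = a * fps_nth P k + (fps_nth (r * P) k - c * fps_nth (r * Q) k)" by simp
  finally show ?thesis unfolding shift
    by (simp only: sum_distrib_left right_diff_distrib sum_subtractf mult_ac)
qed

context layout
begin

definition propagate_time :: nat where
  "propagate_time = 20 + for_time (K + 1) (NAdd (R 2) (NLit 1)) (100 + for_time K (R 13) 30)"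

lemma ok_propagate:
  assumes s: "nreg s 2 = K" "nreg s 9 = q" "nmem s (q + 2) = pa" "pa + K < q" "2 * K + 1 < pa"
    and r: "\<And>k. k \<le> K \<Longrightarrow> cmem s (q + k) = fps_nth r k" "fps_nth r 0 = 0"
    and P: "\<And>k. k \<le> K \<Longrightarrow> cmem s (pa + k) = fps_nth P k"
    and ac: "cmem s (q + K + 1) = a" "cmem s (q + K + 2) = c"
  shows "ok propagate s propagate_time (\<lambda>s'. (\<forall>i. i \<notin> {13, 14, 15} \<longrightarrow> nreg s' i = nreg s i) \<and> nmem s' = nmem s \<and>
    (\<forall>x>2 * K + 1. cmem s' x = (if pa \<le> x \<and> x \<le> pa + K
      then fps_nth (P * edge_factor (fps_const a) (fps_const c) r) (x - pa) else cmem s x)))"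
proof -
  define Q where "Q = P * edge_factor (fps_const a) (fps_const c) r"
  have Q: "fps_nth Q k = a * fps_nth P k +
    (\<Sum>j<k. fps_nth r (Suc j) * (fps_nth P (k - Suc j) - c * fps_nth Q (k - Suc j)))" for k
    unfolding Q_def by (rule edge_factor_nth) (rule r)
  define cm where "cm = (\<lambda>k x. if K + 1 \<le> x \<and> x < K + 1 + k then fps_nth P (x - (K + 1)) - c * fps_nth Q (x - (K + 1))
     else if pa \<le> x \<and> x < pa + k then fps_nth Q (x - pa) else cmem s x)"
  define J where "J = (\<lambda>k (s' :: state). nreg s' 13 = k \<and> nreg s' 15 = pa \<and> (\<forall>i. i \<notin> {13, 14, 15} \<longrightarrow> nreg s' i = nreg s i) \<and> nmem s' = nmem s \<and> cmem s' = cm k)"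
  have 1: "ok (SetNReg 15 (NMem (NAdd (R 9) (NLit 2)))) s 5 (\<lambda>t. t = s\<lparr>nreg := (nreg s)(15 := pa)\<rparr>)"
    by (rule ok_SetNReg) (use s in auto)
  let ?inner = "SetCReg 3 (CAdd (CReg 3)
             (CMul (CMem (NAdd (NAdd (R 9) (NLit 1)) (R 14))) (CMem (NAdd (R 2) (NSub (R 13) (R 14))))))"
  let ?c1 = "SetCReg 3 (CMul (CMem (NAdd (NAdd (R 9) (R 2)) (NLit 1))) (CMem (NAdd (R 15) (R 13))))"
  let ?c3 = "SetCMem (NAdd (NAdd (R 2) (NLit 1)) (R 13))
             (CSub (CMem (NAdd (R 15) (R 13))) (CMul (CMem (NAdd (NAdd (R 9) (R 2)) (NLit 2))) (CReg 3)))"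
  let ?c4 = "SetCMem (NAdd (R 15) (R 13)) (CReg 3)"
  let ?body = "Seq ?c1 (Seq (For 14 (R 13) ?inner) (Seq ?c3 ?c4))"
  let ?post = "\<lambda>k s'. nreg s' 13 = k \<and> J (Suc k) (s'\<lparr>nreg := (nreg s')(13 := Suc k)\<rparr>)"
  have body: "ok ?body t (100 + for_time K (R 13) 30) (?post k)"
    if J: "J k t" and k: "k < K + 1" for k t
  proof -
    have t: "nreg t 13 = k" "nreg t 15 = pa" "nreg t 2 = K" "nreg t 9 = q" "cmem t = cm k"
      using J s by (auto simp: J_def)
    have cells: "cm k (pa + k) = fps_nth P k" "cm k (q + K + 1) = a" "cm k (q + K + 2) = c"
      using s k P ac by (auto simp: cm_def)
    define t1 where "t1 = t\<lparr>creg := (creg t)(3 := a * fps_nth P k)\<rparr>"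
    have b1: "ok ?c1 t 20 (\<lambda>s'. s' = t1)"
      by (rule ok_SetCReg) (use t cells in \<open>auto simp: t1_def\<close>)
    define I where "I = (\<lambda>j s'. s' = t1\<lparr>nreg := (nreg t1)(14 := j), creg := (creg t1)(3 := a * fps_nth P k +
       (\<Sum>i<j. fps_nth r (Suc i) * (fps_nth P (k - Suc i) - c * fps_nth Q (k - Suc i))))\<rparr>)"
    have b2: "ok (For 14 (R 13) ?inner) t1 (for_time k (R 13) 30) (I k)"
    proof (rule ok_For)
      show "I 0 (t1\<lparr>nreg := (nreg t1)(14 := 0)\<rparr>)" by (simp add: I_def t1_def)
      show "nreg s' 14 = j \<and> nval (R 13) s' = k" if "I j s'" for j s' using that t by (simp add: I_def t1_def)
      fix j s' assume I: "I j s'" and j: "j < k"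
      have "Suc (q + j) = q + Suc j" by simp
      then have v1: "cm k (Suc (q + j)) = fps_nth r (Suc j)" using r(1)[of "Suc j"] s j k by (simp add: cm_def)
      \<comment> \<open>The address \<open>K + (k - j)\<close> used by the program is the scratch
        cell of index \<open>k - Suc j\<close>; the shift by one comes from the sum starting at
        coefficient 1 of \<open>r\<close>.\<close>
      have e: "K + (k - j) = K + 1 + (k - Suc j)" using j by simp
      have "cm k (K + 1 + i) = fps_nth P i - c * fps_nth Q i" if "i < k" for i
        using that by (simp add: cm_def)
      from this[of "k - Suc j"] j have v2: "cm k (K + (k - j)) = fps_nth P (k - Suc j) - c * fps_nth Q (k - Suc j)"
        unfolding e by simp
      have v: "cval (CAdd (CReg 3) (CMul (CMem (NAdd (NAdd (R 9) (NLit 1)) (R 14))) (CMem (NAdd (R 2) (NSub (R 13) (R 14)))))) s'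
        = a * fps_nth P k + (\<Sum>i<Suc j. fps_nth r (Suc i) * (fps_nth P (k - Suc i) - c * fps_nth Q (k - Suc i)))"
        using I t v1 v2 by (simp add: I_def t1_def)
      show "ok ?inner s' 30 (\<lambda>s'. nreg s' 14 = j \<and> I (Suc j) (s'\<lparr>nreg := (nreg s')(14 := Suc j)\<rparr>))"
        by (rule ok_SetCReg_val[OF v]) (use I in \<open>simp_all add: I_def\<close>)
    qed
    have upd: "(cm k)(K + 1 + k := fps_nth P k - c * fps_nth Q k, pa + k := fps_nth Q k) = cm (Suc k)"
      using s k by (auto simp: cm_def fun_eq_iff less_Suc_eq)
    have b3: "ok (Seq ?c3 ?c4) s' 60 (?post k)"
      if I: "I k s'" for s'
    proof -
      have s': "nreg s' 13 = k" "nreg s' 15 = pa" "nreg s' 2 = K" "nreg s' 9 = q" "cmem s' = cm k" "creg s' 3 = fps_nth Q k"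
        using I t Q[of k] by (simp_all add: I_def t1_def)
      let ?u = "s'\<lparr>cmem := (cm k)(K + 1 + k := fps_nth P k - c * fps_nth Q k)\<rparr>"
      have "ok ?c3 s' 30 (\<lambda>t. t = ?u)"
        by (rule ok_SetCMem) (use s' cells in auto)
      moreover have "ok ?c4 ?u 20 (?post k)"
      proof (rule ok_SetCMem_val)
        show "nval (NAdd (R 15) (R 13)) ?u = pa + k" "cval (CReg 3) ?u = fps_nth Q k" using s' by simp_all
      qed (use I J upd in \<open>simp_all add: J_def I_def t1_def\<close>)
      ultimately have "ok (Seq ?c3 ?c4) s' (1 + 30 + 20) (?post k)"
        by (rule ok_Seq_eq)
      then show ?thesis by (rule ok_conseq) auto
    qed
    have b23: "ok (Seq (For 14 (R 13) ?inner) (Seq ?c3 ?c4)) t1 (1 + for_time k (R 13) 30 + 60) (?post k)"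
      by (rule ok_Seq[OF b2 b3])
    have "ok ?body t (1 + 20 + (1 + for_time k (R 13) 30 + 60)) (?post k)"
      by (rule ok_Seq[OF b1]) (use b23 in simp)
    moreover have "for_time k (R 13) 30 \<le> for_time K (R 13) 30" using k by (intro for_time_mono) auto
    ultimately show ?thesis by (elim ok_conseq) auto
  qed
  have 2: "ok (For 13 (NAdd (R 2) (NLit 1)) ?body) (s\<lparr>nreg := (nreg s)(15 := pa)\<rparr>)
     (for_time (K + 1) (NAdd (R 2) (NLit 1)) (100 + for_time K (R 13) 30)) (J (K + 1))"
  proof (rule ok_For)
    show "J 0 (s\<lparr>nreg := (nreg s)(15 := pa), nreg := (nreg (s\<lparr>nreg := (nreg s)(15 := pa)\<rparr>))(13 := 0)\<rparr>)"
      by (auto simp: J_def cm_def fun_eq_iff)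
    show "nreg t 13 = k \<and> nval (NAdd (R 2) (NLit 1)) t = K + 1" if "J k t" for k t
      using that s by (simp add: J_def)
  qed (rule body)
  have "ok propagate s (1 + 5 + for_time (K + 1) (NAdd (R 2) (NLit 1)) (100 + for_time K (R 13) 30)) (J (K + 1))"
    unfolding propagate_def by (rule ok_Seq[OF 1]) (use 2 in simp)
  then show ?thesis
    by (rule ok_conseq) (auto simp: propagate_time_def J_def cm_def Q_def)
qed

definition log_exp_time :: nat where
  "log_exp_time = 100 + for_time K (R 2) (100 + for_time K (R 13) 30) + 2 * for_time K (R 2) 30"

lemma ok_log_exp:
  assumes s: "nreg s 2 = K" "nreg s 9 = q" "2 * K + 1 < q"
    and f: "\<And>k. k \<le> K \<Longrightarrow> cmem s (q + k) = fps_nth f k" "fps_nth f 0 = 1"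
  shows "ok log_exp s log_exp_time (\<lambda>s'. creg s' 0 = (1 + log_sum f K / of_nat (2 ^ K)) ^ (2 ^ K))"
proof -
  define g where "g = (\<lambda>j. fps_nth (log_deriv f) j)"
  have g: "g (Suc k) = of_nat (Suc k) * fps_nth f (Suc k) - (\<Sum>j<k. g (Suc j) * fps_nth f (k - j))" for k
  proof -
    have "(\<Sum>j=1..<Suc k. g j * fps_nth f (Suc k - j)) = (\<Sum>j<k. g (Suc j) * fps_nth f (k - j))"
      by (rule sum.reindex_bij_witness[of _ Suc "\<lambda>j. j - 1"]) auto
    then show ?thesis using log_deriv_nth[OF f(2), of "Suc k"] by (simp add: g_def)
  qed
  \<comment> \<open>Scratch cell \<open>K + 2 + j\<close> holds coefficient \<open>Suc j\<close>, so
    the K values end at cell \<open>2 * K + 1\<close>, just below the area that has to be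
    preserved.\<close>
  define cm where "cm = (\<lambda>k x. if K + 2 \<le> x \<and> x < K + 2 + k then g (Suc (x - (K + 2))) else cmem s x)"
  define L where "L = (\<lambda>k. \<Sum>j<k. g (Suc j) / of_nat (Suc j))"
  have L: "L K = log_sum f K"
    unfolding L_def log_sum_def g_def by (rule sum.reindex_bij_witness[of _ "\<lambda>j. j - 1" Suc]) auto
  define J where "J = (\<lambda>k (s' :: state). nreg s' 13 = k \<and> nreg s' 2 = K \<and> nreg s' 9 = q \<and> cmem s' = cm k \<and> creg s' 4 = L k)"
  have 1: "ok (SetCReg 4 (COfNat (NLit 0))) s 5 (\<lambda>t. t = s\<lparr>creg := (creg s)(4 := 0)\<rparr>)"
    by (rule ok_SetCReg) auto
  let ?inner = "SetCReg 3 (CSub (CReg 3)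
             (CMul (CMem (NAdd (NAdd (R 2) (NLit 2)) (R 14))) (CMem (NAdd (R 9) (NSub (R 13) (R 14))))))"
  let ?c1 = "SetCReg 3 (CMul (COfNat (NAdd (R 13) (NLit 1))) (CMem (NAdd (R 9) (NAdd (R 13) (NLit 1)))))"
  let ?c3 = "SetCMem (NAdd (NAdd (R 2) (NLit 2)) (R 13)) (CReg 3)"
  let ?c4 = "SetCReg 4 (CAdd (CReg 4) (CDiv (CReg 3) (COfNat (NAdd (R 13) (NLit 1)))))"
  let ?body = "Seq ?c1 (Seq (For 14 (R 13) ?inner) (Seq ?c3 ?c4))"
  let ?post = "\<lambda>k s'. nreg s' 13 = k \<and> J (Suc k) (s'\<lparr>nreg := (nreg s')(13 := Suc k)\<rparr>)"
  have body: "ok ?body t (100 + for_time K (R 13) 30) (?post k)"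
    if J: "J k t" and k: "k < K" for k t
  proof -
    have t: "nreg t 13 = k" "nreg t 2 = K" "nreg t 9 = q" "cmem t = cm k" "creg t 4 = L k" using J by (auto simp: J_def)
    have fc: "cm k (q + i) = fps_nth f i" if "i \<le> K" for i using that s f k by (auto simp: cm_def)
    define t1 where "t1 = t\<lparr>creg := (creg t)(3 := of_nat (Suc k) * fps_nth f (Suc k))\<rparr>"
    have b1: "ok ?c1 t 20 (\<lambda>s'. s' = t1)"
      by (rule ok_SetCReg) (use t fc[of "Suc k"] k in \<open>auto simp: t1_def\<close>)
    define I where "I = (\<lambda>j s'. s' = t1\<lparr>nreg := (nreg t1)(14 := j), creg := (creg t1)(3 := of_nat (Suc k) * fps_nth f (Suc k) -
       (\<Sum>i<j. g (Suc i) * fps_nth f (k - i)))\<rparr>)"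
    have b2: "ok (For 14 (R 13) ?inner) t1 (for_time k (R 13) 30) (I k)"
    proof (rule ok_For)
      show "I 0 (t1\<lparr>nreg := (nreg t1)(14 := 0)\<rparr>)" by (simp add: I_def t1_def)
      show "nreg s' 14 = j \<and> nval (R 13) s' = k" if "I j s'" for j s' using that t by (simp add: I_def t1_def)
      fix j s' assume I: "I j s'" and j: "j < k"
      have v1: "cm k (K + 2 + j) = g (Suc j)" using j by (simp add: cm_def)
      have v: "cval (CSub (CReg 3) (CMul (CMem (NAdd (NAdd (R 2) (NLit 2)) (R 14))) (CMem (NAdd (R 9) (NSub (R 13) (R 14)))))) s'
        = of_nat (Suc k) * fps_nth f (Suc k) - (\<Sum>i<Suc j. g (Suc i) * fps_nth f (k - i))"
        using I t v1 fc[of "k - j"] k by (simp add: I_def t1_def)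
      show "ok ?inner s' 30 (\<lambda>s'. nreg s' 14 = j \<and> I (Suc j) (s'\<lparr>nreg := (nreg s')(14 := Suc j)\<rparr>))"
        by (rule ok_SetCReg_val[OF v]) (use I in \<open>simp_all add: I_def\<close>)
    qed
    have upd: "(cm k)(K + 2 + k := g (Suc k)) = cm (Suc k)" by (auto simp: cm_def fun_eq_iff less_Suc_eq)
    have b3: "ok (Seq ?c3 ?c4) s' 60 (?post k)"
      if I: "I k s'" for s'
    proof -
      have s': "nreg s' 13 = k" "nreg s' 2 = K" "nreg s' 9 = q" "cmem s' = cm k" "creg s' 3 = g (Suc k)" "creg s' 4 = L k"
        using I t g[of k] by (simp_all add: I_def t1_def)
      let ?u = "s'\<lparr>cmem := cm (Suc k)\<rparr>"
      have "ok ?c3 s' 30 (\<lambda>t. t = ?u)"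
        by (rule ok_SetCMem) (use s' upd in \<open>auto simp: upd[symmetric]\<close>)
      moreover have "ok ?c4 ?u 20 (?post k)"
        by (rule ok_SetCReg) (use s' in \<open>auto simp: J_def L_def\<close>)
      ultimately have "ok (Seq ?c3 ?c4) s' (1 + 30 + 20) (?post k)"
        by (rule ok_Seq_eq)
      then show ?thesis by (rule ok_conseq) auto
    qed
    have b23: "ok (Seq (For 14 (R 13) ?inner) (Seq ?c3 ?c4)) t1 (1 + for_time k (R 13) 30 + 60) (?post k)"
      by (rule ok_Seq[OF b2 b3])
    have "ok ?body t (1 + 20 + (1 + for_time k (R 13) 30 + 60)) (?post k)"
      by (rule ok_Seq[OF b1]) (use b23 in simp)
    moreover have "for_time k (R 13) 30 \<le> for_time K (R 13) 30" using k by (intro for_time_mono) auto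
    ultimately show ?thesis by (elim ok_conseq) auto
  qed
  have 2: "ok (For 13 (R 2) ?body) t (for_time K (R 2) (100 + for_time K (R 13) 30)) (J K)"
    if t: "t = s\<lparr>creg := (creg s)(4 := 0)\<rparr>" for t
  proof (rule ok_For)
    show "J 0 (t\<lparr>nreg := (nreg t)(13 := 0)\<rparr>)" using s by (auto simp: t J_def cm_def fun_eq_iff L_def)
    show "nreg t 13 = k \<and> nval (R 2) t = K" if "J k t" for k t using that by (simp add: J_def)
  qed (rule body)
  define J3 where "J3 = (\<lambda>k (s' :: state). nreg s' 13 = k \<and> nreg s' 2 = K \<and> creg s' 4 = log_sum f K / 2 ^ k)"
  have 3: "ok (For 13 (R 2) (SetCReg 4 (CDiv (CReg 4) (COfNat (NLit 2))))) t (for_time K (R 2) 30) (J3 K)" if t: "J K t" for t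
  proof (rule ok_For)
    show "J3 0 (t\<lparr>nreg := (nreg t)(13 := 0)\<rparr>)" using t by (auto simp: J_def J3_def L)
    show "nreg t 13 = k \<and> nval (R 2) t = K" if "J3 k t" for k t using that by (simp add: J3_def)
    show "ok (SetCReg 4 (CDiv (CReg 4) (COfNat (NLit 2)))) t 30 (\<lambda>s'. nreg s' 13 = k \<and> J3 (Suc k) (s'\<lparr>nreg := (nreg s')(13 := Suc k)\<rparr>))"
      if "J3 k t" for k t
      by (rule ok_SetCReg) (use that in \<open>auto simp: J3_def\<close>)
  qed
  define w where "w = 1 + log_sum f K / 2 ^ K"
  have 4: "ok (SetCReg 0 (CAdd (COfNat (NLit 1)) (CReg 4))) t 10 (\<lambda>t. creg t 0 = w \<and> nreg t 2 = K)" if "J3 K t" for t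
    by (rule ok_SetCReg) (use that in \<open>auto simp: J3_def w_def\<close>)
  define J5 where "J5 = (\<lambda>k (s' :: state). nreg s' 13 = k \<and> nreg s' 2 = K \<and> creg s' 0 = w ^ (2 ^ k))"
  have 5: "ok (For 13 (R 2) (SetCReg 0 (CMul (CReg 0) (CReg 0)))) t (for_time K (R 2) 30) (J5 K)" if t: "creg t 0 = w \<and> nreg t 2 = K" for t
  proof (rule ok_For)
    show "J5 0 (t\<lparr>nreg := (nreg t)(13 := 0)\<rparr>)" using t by (auto simp: J5_def)
    show "nreg t 13 = k \<and> nval (R 2) t = K" if "J5 k t" for k t using that by (simp add: J5_def)
    show "ok (SetCReg 0 (CMul (CReg 0) (CReg 0))) t 30 (\<lambda>s'. nreg s' 13 = k \<and> J5 (Suc k) (s'\<lparr>nreg := (nreg s')(13 := Suc k)\<rparr>))"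
      if "J5 k t" for k t
      by (rule ok_SetCReg) (use that in \<open>auto simp: J5_def power_add[symmetric] mult_2\<close>)
  qed
  have "ok log_exp s (1 + 5 + (1 + for_time K (R 2) (100 + for_time K (R 13) 30) + (1 + for_time K (R 2) 30 + (1 + 10 + for_time K (R 2) 30)))) (J5 K)"
    unfolding log_exp_def by (rule ok_Seq[OF 1 ok_Seq[OF 2 ok_Seq[OF 3 ok_Seq[OF 4 5]]]])
  then show ?thesis
    by (rule ok_conseq) (auto simp: log_exp_time_def J5_def w_def)
qed

end

subsection \<open>Evaluating the tree\<close>

text \<open>The address compared with register 9 is that of block 0, so the loop stops at the
  artificial root.\<close>

definition fold_tree :: com where
  "fold_tree =
    Seq (SetNReg 9 (NSub (R 9) (R 8)))
    (While (NLess (NAdd (NAdd (R 6) (R 1)) (R 1)) (R 9)) (Seq propagate (SetNReg 9 (NSub (R 9) (R 8)))))"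

context layout
begin

definition node_ratio :: "node \<Rightarrow> complex fps" where
  "node_ratio nd = ratio_approx adj m b z (fst (snd nd)) (fst nd) (fst (snd (snd nd)))"

definition contribution :: "node \<Rightarrow> complex fps" where
  "contribution nd = edge_factor (fps_const (if parent nd = 0 then 1 else b))
     (fps_const (if parent nd = 0 then 0 else b)) (node_ratio nd)"

lemma node_ratio_children:
  assumes "0 < i"
  shows "node_ratio nd = fps_const (fst (snd (snd nd)) (fst nd)) * z * prod_list (map contribution (children nd i))"
proof -
  obtain v d \<mu> p where nd: "nd = (v, d, \<mu>, p)" by (cases nd)
  show ?thesis
  proof (cases d)
    case 0
    then show ?thesis by (simp add: nd node_ratio_def children_def)
  next
    case (Suc k)
    have "prod_list (map contribution (children nd i)) = (\<Prod>u | u < m \<and> adj v u. edge_factor (fps_const b) (fps_const b)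
        (ratio_approx adj m b z k u (child_weight adj (1 / b) \<mu> v u)))"
      using assms unfolding prod_list_filter_upt[symmetric]
      by (simp add: nd Suc children_def o_def contribution_def node_ratio_def)
    then show ?thesis by (simp add: nd node_ratio_def Suc)
  qed
qed

text \<open>The series in block \<open>q\<close> once all nodes from index \<open>j\<close> on have
  been multiplied into their parents.\<close>

definition partial_value :: "node list \<Rightarrow> nat \<Rightarrow> nat \<Rightarrow> complex fps" where
  "partial_value ns j q = (if q = 0 then 1 else fps_const (fst (snd (snd (ns ! q))) (fst (ns ! q))) * z) *
     (\<Prod>k | j \<le> k \<and> k < length ns \<and> parent (ns ! k) = q. contribution (ns ! k))"

lemma partial_value_step:
  assumes "j < length ns"
  shows "partial_value ns j q = partial_value ns (Suc j) q * (if parent (ns ! j) = q then contribution (ns ! j) else 1)"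
proof -
  have "{k. j \<le> k \<and> k < length ns \<and> parent (ns ! k) = q} =
     (if parent (ns ! j) = q then insert j {k. Suc j \<le> k \<and> k < length ns \<and> parent (ns ! k) = q}
      else {k. Suc j \<le> k \<and> k < length ns \<and> parent (ns ! k) = q})"
    using assms by (auto simp: le_less Suc_le_eq)
  then show ?thesis by (simp add: partial_value_def mult_ac)
qed

text \<open>All children of \<open>q\<close> have larger indices, so the block is complete when the
  backward pass arrives at \<open>q\<close>.\<close>

lemma partial_value_node:
  assumes "Suc i = length (bfs i)" "0 < q" "q < length (bfs i)"
  shows "partial_value (bfs i) (Suc q) q = node_ratio (bfs i ! q)"
proof -
  have "{k. Suc q \<le> k \<and> k < length (bfs i) \<and> parent (bfs i ! k) = q}
      = {k. 1 \<le> k \<and> k < length (bfs i) \<and> parent (bfs i ! k) = q}"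
    using bfs_nodes by (auto simp: Suc_le_eq)
  then have "(\<Prod>k | Suc q \<le> k \<and> k < length (bfs i) \<and> parent (bfs i ! k) = q. contribution (bfs i ! k))
      = prod_list (map contribution (children (bfs i ! q) q))"
    using bfs_prod[where i = i and q = q and g = contribution] assms by simp
  then show ?thesis using assms node_ratio_children[of q "bfs i ! q"] by (simp add: partial_value_def)
qed

lemma partial_value_root:
  assumes "Suc i = length (bfs i)"
  shows "partial_value (bfs i) 1 0 = (\<Prod>u<m. 1 + ratio_approx adj m b z K u (\<lambda>w. if w < u then 0 else 1))"
  using bfs_prod[where i = i and q = 0 and g = contribution] assms
  by (simp add: partial_value_def contribution_def root_def node_ratio_def edge_factor_def)

definition fold_time :: "nat \<Rightarrow> nat" where
  "fold_time N = N * (propagate_time + 20) + 30"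

lemma ok_fold_tree:
  assumes z: "fps_nth z 0 = 0"
    and i: "Suc i = length (bfs i)" and s: "bfs_state s (bfs i) (Suc i)" "nreg s 9 = addr (Suc i)"
  shows "ok fold_tree s (fold_time (length (bfs i))) (\<lambda>s'. nreg s' 2 = K \<and> nreg s' 9 = addr 0 \<and>
     (\<forall>k\<le>K. cmem s' (addr 0 + k) = fps_nth (\<Prod>u<m. 1 + ratio_approx adj m b z K u (\<lambda>w. if w < u then 0 else 1)) k))"
proof -
  define ns where "ns = bfs i"
  define L where "L = length ns"
  have L: "L = Suc i" using i by (simp add: L_def ns_def)
  \<comment> \<open>After \<open>t\<close> passes the last \<open>t\<close> nodes have been folded;
    the current node is \<open>L - 1 - t\<close>.\<close>
  define J where "J = (\<lambda>t (s' :: state). t < L \<and> nreg s' 1 = m \<and> nreg s' 2 = K \<and> nreg s' 6 = 2 * K + 2 \<and> nreg s' 8 = stride \<and>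
    nreg s' 9 = addr (L - 1 - t) \<and>
    (\<forall>q<L. \<forall>k\<le>K. cmem s' (addr q + k) = fps_nth (partial_value ns (L - t) q) k) \<and>
    (\<forall>q. 0 < q \<and> q < L \<longrightarrow> nmem s' (addr q + 2) = addr (parent (ns ! q)) \<and>
       cmem s' (addr q + K + 1) = (if parent (ns ! q) = 0 then 1 else b) \<and>
       cmem s' (addr q + K + 2) = (if parent (ns ! q) = 0 then 0 else b)))"
  have pv0: "partial_value ns L q = (if q = 0 then 1 else fps_const (fst (snd (snd (ns ! q))) (fst (ns ! q))) * z)" for q
  proof -
    have "{k. length ns \<le> k \<and> k < length ns \<and> parent (ns ! k) = q} = {}" by auto
    then show ?thesis unfolding partial_value_def L_def by (simp only: prod.empty mult_1_right)
  qed
  have J0: "J 0 (s\<lparr>nreg := (nreg s)(9 := nval (NSub (R 9) (R 8)) s)\<rparr>)"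
  proof -
    have bs: "nreg s (Suc 0) = m" "nreg s 2 = K" "nreg s 6 = 2 * K + 2" "nreg s 8 = stride"
      using s by (auto simp: bfs_state_def base_def)
    have nodes: "node_ok s q (ns ! q)" if "q < L" for q using s that by (simp add: bfs_state_def ns_def L_def)
    show ?thesis
      unfolding J_def using bs s(2) node_okD(3-6)[OF nodes] pv0 by (simp add: L addr_Suc)
  qed
  let ?p = "NLess (NAdd (NAdd (R 6) (R 1)) (R 1)) (R 9)"
  have test: "tval ?p s' \<longleftrightarrow> t < L - 1" if "J t s'" for t s'
  proof -
    have "nreg s' 6 + nreg s' 1 + nreg s' 1 = addr 0" "nreg s' 9 = addr (L - 1 - t)"
      using that by (simp_all add: J_def addr_def)
    moreover have "addr 0 < addr (L - 1 - t) \<longleftrightarrow> 0 < L - 1 - t"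
      using addr_less[of 0 "L - 1 - t"] by (cases "L - 1 - t = 0") (auto simp: stride_def)
    ultimately show ?thesis by auto
  qed
  have step: "ok (Seq propagate (SetNReg 9 (NSub (R 9) (R 8)))) s' (1 + propagate_time + 4) (J (Suc t))"
    if J: "J t s'" and t: "t < L - 1" for t s'
  proof -
    define q where "q = L - 1 - t"
    define p where "p = parent (ns ! q)"
    have q: "0 < q" "q < L" "Suc q = L - t" "q = L - Suc t" using t by (auto simp: q_def)
    have pq: "p < q" using bfs_nodes[of q i] q L by (simp add: p_def ns_def L_def)
    have sep: "addr p + stride \<le> addr q" using pq by (rule addr_less)
    have s': "nreg s' (Suc 0) = m" "nreg s' 2 = K" "nreg s' 6 = 2 * K + 2" "nreg s' 8 = stride" "nreg s' 9 = addr q"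
      using J by (auto simp: J_def q_def)
    have cells: "cmem s' (addr x + k) = fps_nth (partial_value ns (Suc q) x) k" if "x < L" "k \<le> K" for x k
      using J that unfolding J_def q(3) by blast
    have fixed: "nmem s' (addr x + 2) = addr (parent (ns ! x))"
       "cmem s' (addr x + K + 1) = (if parent (ns ! x) = 0 then 1 else b)"
       "cmem s' (addr x + K + 2) = (if parent (ns ! x) = 0 then 0 else b)" if "0 < x" "x < L" for x
      using J that unfolding J_def by blast+
    have r: "partial_value ns (Suc q) q = node_ratio (ns ! q)"
      unfolding ns_def by (rule partial_value_node[OF i]) (use q in \<open>auto simp: L_def ns_def\<close>)
    have r0: "fps_nth (node_ratio (ns ! q)) 0 = 0" unfolding node_ratio_def by (rule ratio_approx_nth_0[OF z])
    have pv: "partial_value ns q x = (if x = p then partial_value ns (Suc q) p * contribution (ns ! q) else partial_value ns (Suc q) x)" for x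
      using partial_value_step[of q ns x] q by (auto simp: p_def L_def)
    have con: "contribution (ns ! q) = edge_factor (fps_const (if p = 0 then 1 else b)) (fps_const (if p = 0 then 0 else b)) (node_ratio (ns ! q))"
      by (simp add: contribution_def p_def)
    let ?Q = "\<lambda>u. (\<forall>i. i \<notin> {13, 14, 15} \<longrightarrow> nreg u i = nreg s' i) \<and> nmem u = nmem s' \<and>
      (\<forall>x>2 * K + 1. cmem u x = (if addr p \<le> x \<and> x \<le> addr p + K
        then fps_nth (partial_value ns q p) (x - addr p) else cmem s' x))"
    have 1: "ok propagate s' propagate_time ?Q"
      unfolding pv con if_P[OF refl[of p]]
    proof (rule ok_propagate)
      show "nreg s' 2 = K" "nreg s' 9 = addr q" by (rule s')+
      show "nmem s' (addr q + 2) = addr p" "cmem s' (addr q + K + 1) = (if p = 0 then 1 else b)"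
        "cmem s' (addr q + K + 2) = (if p = 0 then 0 else b)"
        using fixed[OF q(1,2)] by (simp_all only: p_def)
      show "addr p + K < addr q" using sep by (simp add: stride_def)
      show "2 * K + 1 < addr p" using addr_lower[of p] by linarith
      show "cmem s' (addr q + k) = fps_nth (node_ratio (ns ! q)) k" if "k \<le> K" for k
        using cells[OF q(2) that] by (simp only: r)
      show "fps_nth (node_ratio (ns ! q)) 0 = 0" by (rule r0)
      show "cmem s' (addr p + k) = fps_nth (partial_value ns (Suc q) p) k" if "k \<le> K" for k
        using cells[of p k] that pq q by simp
    qed
    have "Suc t < L" using t by linarith
    have 2: "ok (SetNReg 9 (NSub (R 9) (R 8))) u 4 (J (Suc t))" if u: "?Q u" for u
    proof (rule ok_SetNReg)
      have "addr q - stride = addr (L - 1 - Suc t)"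
      proof -
        have "q = Suc (L - 1 - Suc t)" using q by simp
        then show ?thesis by (metis addr_Suc diff_add_inverse2)
      qed
      moreover have "cmem u (addr x + k) = fps_nth (partial_value ns (L - Suc t) x) k" if "x < L" "k \<le> K" for x k
      proof (cases "x = p")
        case True
        have "2 * K + 1 < addr p + k" using addr_lower[of p] by linarith
        then show ?thesis using u that True by (simp add: q(4)[symmetric])
      next
        case False
        have "x < p \<or> p < x" using False by auto
        then have "addr x + stride \<le> addr p \<or> addr p + stride \<le> addr x" using addr_less by blast
        then have "\<not> (addr p \<le> addr x + k \<and> addr x + k \<le> addr p + K)" using that by (auto simp: stride_def)
        moreover have "2 * K + 1 < addr x + k" using addr_lower[of x] by linarith
        ultimately have "cmem u (addr x + k) = cmem s' (addr x + k)" using u by auto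
        then show ?thesis using cells[OF that] pv[of x] False by (simp add: q(4)[symmetric])
      qed
      moreover have cell: "cmem u (addr x + K + d) = cmem s' (addr x + K + d)" if "d = 1 \<or> d = 2" for x d
      proof -
        have "x < p \<or> p < x \<or> x = p" by auto
        then have "addr x + stride \<le> addr p \<or> addr p + stride \<le> addr x \<or> x = p" using addr_less by blast
        then have "\<not> (addr p \<le> addr x + K + d \<and> addr x + K + d \<le> addr p + K)" using that by (auto simp: stride_def)
        moreover have "2 * K + 1 < addr x + K + d" using addr_lower[of x] by linarith
        ultimately show ?thesis using u by auto
      qed
      ultimately show "J (Suc t) (u\<lparr>nreg := (nreg u)(9 := nval (NSub (R 9) (R 8)) u)\<rparr>)"
        using u s' fixed cell[of 1] cell[of 2] \<open>Suc t < L\<close> by (simp add: J_def)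
    qed simp
    show ?thesis by (rule ok_Seq[OF 1 2])
  qed
  have 1: "ok (SetNReg 9 (NSub (R 9) (R 8))) s 4 (J 0)"
    by (rule ok_SetNReg[where Q = "J 0", OF J0]) simp
  have 2: "ok (While ?p (Seq propagate (SetNReg 9 (NSub (R 9) (R 8))))) s'
     ((L - 0) * (1 + tcost ?p + (1 + propagate_time + 4)) + (1 + tcost ?p)) (\<lambda>s'. \<exists>j\<le>L. J j s' \<and> \<not> tval ?p s')"
    if "J 0 s'" for s'
  proof (rule ok_While[where I = J, OF that])
    show "t < L \<and> ok (Seq propagate (SetNReg 9 (NSub (R 9) (R 8)))) u (1 + propagate_time + 4) (J (Suc t))"
      if "J t u" "tval ?p u" for t u
      using step[OF that(1)] test[OF that(1)] that(2) by auto
  qed simp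
  have "ok fold_tree s (1 + 4 + ((L - 0) * (1 + tcost ?p + (1 + propagate_time + 4)) + (1 + tcost ?p))) (\<lambda>s'. \<exists>j\<le>L. J j s' \<and> \<not> tval ?p s')"
    unfolding fold_tree_def by (rule ok_Seq[OF 1 2])
  then show ?thesis
  proof (rule ok_conseq)
    show "1 + 4 + ((L - 0) * (1 + tcost ?p + (1 + propagate_time + 4)) + (1 + tcost ?p)) \<le> fold_time (length (bfs i))"
      by (simp add: fold_time_def L_def ns_def algebra_simps)
    fix s' assume "\<exists>j\<le>L. J j s' \<and> \<not> tval ?p s'"
    then obtain j where j: "J j s'" "\<not> tval ?p s'" by blast
    then have "j = L - 1" using test[OF j(1)] by (auto simp: J_def)
    then have e: "L - 1 - j = 0" "L - j = 1" using L by auto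
    have "nreg s' 2 = K \<and> nreg s' 9 = addr (L - 1 - j) \<and> (\<forall>k\<le>K. cmem s' (addr 0 + k) = fps_nth (partial_value ns (L - j) 0) k)"
      using j(1) L unfolding J_def by blast
    then show "nreg s' 2 = K \<and> nreg s' 9 = addr 0 \<and>
     (\<forall>k\<le>K. cmem s' (addr 0 + k) = fps_nth (\<Prod>u<m. 1 + ratio_approx adj m b z K u (\<lambda>w. if w < u then 0 else 1)) k)"
      unfolding e unfolding ns_def partial_value_root[OF i] .
  qed
qed

end

section \<open>Input phase: truncation order, coefficients of the substitution, edge table\<close>

definition compute_K :: "nat \<Rightarrow> nat \<Rightarrow> com" where
  "compute_K k0 c0 = Seq (SetNReg 2 (NLit k0)) (Seq (SetNReg 5 (NLit 1))
    (While (NLess (R 5) (R 0)) (Seq (SetNReg 5 (NAdd (R 5) (R 5))) (SetNReg 2 (NAdd (R 2) (NLit c0))))))"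

text \<open>The binary logarithm of \<open>n\<close> is found by doubling, and each doubling adds
  the literal \<open>c0\<close> to \<open>K\<close>, which takes the place of a multiplication.
  Since \<open>l < 2 ^ l\<close>, there are at most \<open>n\<close> passes.\<close>

lemma ok_compute_K:
  assumes n: "nreg s 0 = n" "1 \<le> n"
  shows "ok (compute_K k0 c0) s (30 * n + 30) (\<lambda>s'. \<exists>l. n \<le> 2 ^ l \<and> 2 ^ l \<le> 2 * n \<and>
    s' = s\<lparr>nreg := (nreg s)(2 := k0 + c0 * l, 5 := 2 ^ l)\<rparr>)"
proof -
  define I where "I = (\<lambda>l s'. 2 ^ l \<le> 2 * n \<and> s' = s\<lparr>nreg := (nreg s)(2 := k0 + c0 * l, 5 := 2 ^ l)\<rparr>)"
  let ?b = "Seq (SetNReg 5 (NAdd (R 5) (R 5))) (SetNReg 2 (NAdd (R 2) (NLit c0)))"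
  have 1: "ok (SetNReg 2 (NLit k0)) s 2 (\<lambda>t. t = s\<lparr>nreg := (nreg s)(2 := k0)\<rparr>)" by (rule ok_SetNReg) auto
  have 2: "ok (SetNReg 5 (NLit 1)) (s\<lparr>nreg := (nreg s)(2 := k0)\<rparr>) 2 (I 0)"
    by (rule ok_SetNReg) (use n in \<open>auto simp: I_def\<close>)
  have 3: "ok (While (NLess (R 5) (R 0)) ?b) t ((n - 0) * (1 + tcost (NLess (R 5) (R 0)) + 20) + (1 + tcost (NLess (R 5) (R 0))))
      (\<lambda>s'. \<exists>j\<le>n. I j s' \<and> \<not> tval (NLess (R 5) (R 0)) s')" if "I 0 t" for t
  proof (rule ok_While[where I = I, OF that])
    fix l u assume u: "I l u" "tval (NLess (R 5) (R 0)) u"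
    then have l: "2 ^ l < n" using n by (simp add: I_def)
    have "l < 2 ^ l" by (rule less_exp)
    then have "l < n" using l by linarith
    moreover have "ok ?b u (1 + 4 + 4) (I (Suc l))"
    proof (rule ok_Seq_eq)
      show "ok (SetNReg 5 (NAdd (R 5) (R 5))) u 4 (\<lambda>t. t = u\<lparr>nreg := (nreg u)(5 := 2 ^ Suc l)\<rparr>)"
        by (rule ok_SetNReg) (use u in \<open>auto simp: I_def mult_2\<close>)
      show "ok (SetNReg 2 (NAdd (R 2) (NLit c0))) (u\<lparr>nreg := (nreg u)(5 := 2 ^ Suc l)\<rparr>) 4 (I (Suc l))"
        by (rule ok_SetNReg) (use u l in \<open>auto simp: I_def fun_eq_iff intro!: state.equality\<close>)
    qed
    then have "ok ?b u 20 (I (Suc l))" by (rule ok_conseq) auto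
    ultimately show "l < n \<and> ok ?b u 20 (I (Suc l))" ..
  qed simp
  have "ok (compute_K k0 c0) s (1 + 2 + (1 + 2 + ((n - 0) * (1 + tcost (NLess (R 5) (R 0)) + 20) + (1 + tcost (NLess (R 5) (R 0))))))
     (\<lambda>s'. \<exists>j\<le>n. I j s' \<and> \<not> tval (NLess (R 5) (R 0)) s')"
    unfolding compute_K_def by (rule ok_Seq_eq[OF 1 ok_Seq[OF 2 3]])
  then show ?thesis
  proof (rule ok_conseq)
    fix s' assume "\<exists>j\<le>n. I j s' \<and> \<not> tval (NLess (R 5) (R 0)) s'"
    then obtain j where "I j s'" "\<not> tval (NLess (R 5) (R 0)) s'" by blast
    then show "\<exists>l. n \<le> 2 ^ l \<and> 2 ^ l \<le> 2 * n \<and> s' = s\<lparr>nreg := (nreg s)(2 := k0 + c0 * l, 5 := 2 ^ l)\<rparr>"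
      using n by (intro exI[of _ j]) (auto simp: I_def)
  qed simp
qed

text \<open>The numbers \<open>c\<close>, \<open>D\<close> and \<open>N\<close> do not depend on the
  graph, so the loop is unrolled into the program text. They have to be naturals, because programs
  contain no other constants.\<close>

primrec set_coeffs :: "(nat \<Rightarrow> nat) \<Rightarrow> nat \<Rightarrow> nat \<Rightarrow> com" where
  "set_coeffs c D 0 = Skip"
| "set_coeffs c D (Suc k) = Seq (set_coeffs c D k)
     (SetCMem (NLit (Suc k)) (CMul (CReg 1) (CDiv (COfNat (NLit (c (Suc k)))) (COfNat (NLit D)))))"

lemma ok_set_coeffs:
  "ok (set_coeffs c D N) s (20 * N + 10) (\<lambda>s'. s' = s\<lparr>cmem := (\<lambda>x. if 1 \<le> x \<and> x \<le> N
     then creg s 1 * (of_nat (c x) / of_nat D) else cmem s x)\<rparr>)"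
proof (induction N)
  case 0
  show ?case by (simp, rule ok_Skip) (auto simp: fun_eq_iff intro!: state.equality)
next
  case (Suc N)
  let ?s = "\<lambda>N. s\<lparr>cmem := (\<lambda>x. if 1 \<le> x \<and> x \<le> N then creg s 1 * (of_nat (c x) / of_nat D) else cmem s x)\<rparr>"
  have "ok (SetCMem (NLit (Suc N)) (CMul (CReg 1) (CDiv (COfNat (NLit (c (Suc N)))) (COfNat (NLit D))))) (?s N) 10 (\<lambda>s'. s' = ?s (Suc N))"
    by (rule ok_SetCMem) (auto simp: fun_eq_iff intro!: state.equality)
  from ok_Seq_eq[OF Suc this] show ?case
    by (simp, elim ok_conseq) auto
qed

text \<open>Register 5 advances by \<open>n\<close> per row, so no product \<open>i * n\<close> is
  needed; reading only below the diagonal meets each edge once.\<close>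

definition read_edges :: com where
  "read_edges = Seq (SetNReg 6 (NAdd (NAdd (R 2) (R 2)) (NLit 2))) (Seq (SetNReg 1 (NLit 0)) (Seq (SetNReg 5 (NLit 0))
    (For 3 (R 0) (Seq (For 4 (R 3)
      (If_Then_Else (NLess (NLit 0) (NMem (NAdd (R 5) (R 4))))
        (Seq (SetCMem (NAdd (R 6) (NAdd (R 1) (R 1))) (COfNat (R 3)))
        (Seq (SetCMem (NAdd (NAdd (R 6) (NAdd (R 1) (R 1))) (NLit 1)) (COfNat (R 4)))
             (SetNReg 1 (NAdd (R 1) (NLit 1)))))
        Skip))
      (SetNReg 5 (NAdd (R 5) (R 0)))))))"

definition pairs_before :: "nat set set \<Rightarrow> nat \<Rightarrow> nat \<Rightarrow> (nat \<times> nat) set" where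
  "pairs_before E i j = {(a, c). c < a \<and> {a, c} \<in> E \<and> (a < i \<or> a = i \<and> c < j)}"

definition edge_table :: "(nat \<Rightarrow> complex) \<Rightarrow> nat \<Rightarrow> (nat \<times> nat) list \<Rightarrow> (nat \<Rightarrow> complex) \<Rightarrow> bool" where
  "edge_table cm B es cm' \<longleftrightarrow> (\<forall>x. x < B \<or> B + 2 * length es \<le> x \<longrightarrow> cm' x = cm x) \<and>
     (\<forall>e<length es. cm' (B + 2 * e) = of_nat (fst (es ! e)) \<and> cm' (B + 2 * e + 1) = of_nat (snd (es ! e)))"

lemma edge_table_append:
  assumes "edge_table cm B es cm'"
  shows "edge_table cm B (es @ [(a, c)]) (cm'(B + 2 * length es := of_nat a, B + 2 * length es + 1 := of_nat c))"
  using assms unfolding edge_table_def by (auto simp: nth_append less_Suc_eq)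

definition edges_time :: "nat \<Rightarrow> nat" where
  "edges_time n = 30 + for_time n (R 0) (10 + for_time n (R 3) 60)"

text \<open>The order of the edges is left existential: every listing without repetitions gives the
  same partition function.\<close>

lemma ok_read_edges:
  assumes s: "nreg s 0 = n" "nreg s 2 = K"
    and nm: "\<And>i j. i < n \<Longrightarrow> j < n \<Longrightarrow> 0 < nmem s (i * n + j) \<longleftrightarrow> {i, j} \<in> E"
    and E: "\<And>i j. {i, j} \<in> E \<Longrightarrow> i < n"
  shows "ok read_edges s (edges_time n) (\<lambda>s'. \<exists>es. distinct es \<and> set es = {(a, c). c < a \<and> {a, c} \<in> E} \<and>
     nreg s' 1 = length es \<and> nreg s' 2 = K \<and> nreg s' 6 = 2 * K + 2 \<and> creg s' = creg s \<and>
     edge_table (cmem s) (2 * K + 2) es (cmem s'))"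
proof -
  let ?B = "2 * K + 2"
  define S where "S = (\<lambda>i j (s' :: state). nreg s' 0 = n \<and> nreg s' 2 = K \<and> nreg s' 6 = ?B \<and> nreg s' 5 = i * n \<and>
     nmem s' = nmem s \<and> creg s' = creg s \<and>
     (\<exists>es. distinct es \<and> set es = pairs_before E i j \<and> nreg s' 1 = length es \<and> edge_table (cmem s) ?B es (cmem s')))"
  let ?add = "Seq (SetCMem (NAdd (R 6) (NAdd (R 1) (R 1))) (COfNat (R 3)))
        (Seq (SetCMem (NAdd (NAdd (R 6) (NAdd (R 1) (R 1))) (NLit 1)) (COfNat (R 4)))
             (SetNReg 1 (NAdd (R 1) (NLit 1))))"
  let ?if = "If_Then_Else (NLess (NLit 0) (NMem (NAdd (R 5) (R 4)))) ?add Skip"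
  let ?I = "\<lambda>i j s'. S i j s' \<and> nreg s' 3 = i \<and> nreg s' 4 = j"
  let ?post = "\<lambda>i j s'. nreg s' 4 = j \<and> ?I i (Suc j) (s'\<lparr>nreg := (nreg s')(4 := Suc j)\<rparr>)"
  have inner: "ok ?if t 60 (?post i j)"
    if t: "?I i j t" and ij: "j < i" "i < n" for i j t
  proof -
    from t obtain es where es: "distinct es" "set es = pairs_before E i j" "nreg t 1 = length es"
        "edge_table (cmem s) ?B es (cmem t)" by (auto simp: S_def)
    have r: "nreg t 6 = ?B" "nreg t 3 = i" "nreg t 4 = j" "nreg t 5 = i * n" "nmem t = nmem s" using t by (auto simp: S_def)
    have test: "tval (NLess (NLit 0) (NMem (NAdd (R 5) (R 4)))) t \<longleftrightarrow> {i, j} \<in> E"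
      using r nm[of i j] ij by simp
    have "ok ?if t (1 + tcost (NLess (NLit 0) (NMem (NAdd (R 5) (R 4)))) + 50)
       (?post i j)"
    proof (rule ok_If)
      assume "tval (NLess (NLit 0) (NMem (NAdd (R 5) (R 4)))) t"
      then have in_E: "{i, j} \<in> E" using test by simp
      let ?es = "es @ [(i, j)]"
      have d: "distinct ?es" using es by (auto simp: pairs_before_def)
      have set: "set ?es = pairs_before E i (Suc j)" using es ij in_E by (auto simp: pairs_before_def less_Suc_eq)
      let ?t1 = "t\<lparr>cmem := (cmem t)(?B + 2 * length es := of_nat i)\<rparr>"
      let ?t2 = "t\<lparr>cmem := (cmem t)(?B + 2 * length es := of_nat i, ?B + 2 * length es + 1 := of_nat j)\<rparr>"
      have len: "nreg t (Suc 0) = length es" using es by simp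
      have 1: "ok (SetCMem (NAdd (R 6) (NAdd (R 1) (R 1))) (COfNat (R 3))) t 10 (\<lambda>u. u = ?t1)"
        by (rule ok_SetCMem) (use r len in \<open>auto simp: mult_2\<close>)
      have 2: "ok (SetCMem (NAdd (NAdd (R 6) (NAdd (R 1) (R 1))) (NLit 1)) (COfNat (R 4))) ?t1 12 (\<lambda>u. u = ?t2)"
        by (rule ok_SetCMem) (use r len in \<open>auto simp: mult_2\<close>)
      have tbl: "edge_table (cmem s) ?B ?es (cmem ?t2)" using edge_table_append[OF es(4), of i j] by simp
      have "\<exists>es. distinct es \<and> set es = pairs_before E i (Suc j) \<and> Suc (nreg t 1) = length es \<and> edge_table (cmem s) ?B es (cmem ?t2)"
        using d set es(3) tbl by (intro exI[of _ ?es]) simp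
      then have 3: "ok (SetNReg 1 (NAdd (R 1) (NLit 1))) ?t2 10 (?post i j)"
        using t by (intro ok_SetNReg) (auto simp: S_def)
      have "ok ?add t (1 + 10 + (1 + 12 + 10)) (?post i j)"
        by (rule ok_Seq_eq[OF 1 ok_Seq_eq[OF 2 3]])
      then show "ok ?add t 50 (?post i j)"
        by (rule ok_conseq) auto
    next
      assume "\<not> tval (NLess (NLit 0) (NMem (NAdd (R 5) (R 4)))) t"
      then have "{i, j} \<notin> E" using test by simp
      then have "pairs_before E i (Suc j) = pairs_before E i j" by (auto simp: pairs_before_def less_Suc_eq)
      then show "ok Skip t 50 (?post i j)"
        using t by (intro ok_Skip) (auto simp: S_def)
    qed
    then show ?thesis by (rule ok_conseq) auto
  qed
  have row: "ok (For 4 (R 3) ?if) t (for_time i (R 3) 60) (?I i i)" if t: "S i 0 t \<and> nreg t 3 = i" and i: "i < n" for i t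
  proof (rule ok_For[where I = "?I i"])
    show "?I i 0 (t\<lparr>nreg := (nreg t)(4 := 0)\<rparr>)" using t by (simp add: S_def)
    show "nreg u 4 = j \<and> nval (R 3) u = i" if "?I i j u" for j u using that by simp
  qed (use inner i in blast)
  let ?outer = "Seq (For 4 (R 3) ?if) (SetNReg 5 (NAdd (R 5) (R 0)))"
  let ?O = "\<lambda>i s'. S i 0 s' \<and> nreg s' 3 = i"
  have outer: "ok ?outer t (10 + for_time n (R 3) 60) (\<lambda>s'. nreg s' 3 = i \<and> ?O (Suc i) (s'\<lparr>nreg := (nreg s')(3 := Suc i)\<rparr>))"
    if t: "?O i t" and i: "i < n" for i t
  proof -
    have "ok ?outer t (1 + for_time i (R 3) 60 + 4) (\<lambda>s'. nreg s' 3 = i \<and> ?O (Suc i) (s'\<lparr>nreg := (nreg s')(3 := Suc i)\<rparr>))"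
    proof (rule ok_Seq[OF row[OF t i]])
      fix u assume u: "?I i i u"
      have "pairs_before E (Suc i) 0 = pairs_before E i i" by (auto simp: pairs_before_def less_Suc_eq)
      then show "ok (SetNReg 5 (NAdd (R 5) (R 0))) u 4 (\<lambda>s'. nreg s' 3 = i \<and> ?O (Suc i) (s'\<lparr>nreg := (nreg s')(3 := Suc i)\<rparr>))"
        using u by (intro ok_SetNReg) (auto simp: S_def)
    qed
    moreover have "for_time i (R 3) 60 \<le> for_time n (R 3) 60" using i by (intro for_time_mono) auto
    ultimately show ?thesis by (elim ok_conseq) auto
  qed
  define s3 where "s3 = s\<lparr>nreg := (nreg s)(6 := ?B, 1 := 0, 5 := 0)\<rparr>"
  have 1: "ok (SetNReg 6 (NAdd (NAdd (R 2) (R 2)) (NLit 2))) s 6 (\<lambda>u. u = s\<lparr>nreg := (nreg s)(6 := ?B)\<rparr>)"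
    by (rule ok_SetNReg) (use s in \<open>auto simp: mult_2\<close>)
  have 2: "ok (SetNReg 1 (NLit 0)) (s\<lparr>nreg := (nreg s)(6 := ?B)\<rparr>) 4 (\<lambda>u. u = s\<lparr>nreg := (nreg s)(6 := ?B, 1 := 0)\<rparr>)"
    by (rule ok_SetNReg) auto
  have 3: "ok (SetNReg 5 (NLit 0)) (s\<lparr>nreg := (nreg s)(6 := ?B, 1 := 0)\<rparr>) 4 (\<lambda>u. u = s3)"
    by (rule ok_SetNReg) (auto simp: s3_def)
  have 4: "ok (For 3 (R 0) ?outer) s3 (for_time n (R 0) (10 + for_time n (R 3) 60)) (?O n)"
  proof (rule ok_For[where I = ?O])
    have "pairs_before E 0 0 = {}" by (auto simp: pairs_before_def)
    moreover have "edge_table (cmem s) ?B [] (cmem s)" by (simp add: edge_table_def)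
    ultimately have "\<exists>es. distinct es \<and> set es = pairs_before E 0 0 \<and> 0 = length es \<and> edge_table (cmem s) ?B es (cmem s)"
      by (intro exI[of _ "[]"]) simp
    then show "?O 0 (s3\<lparr>nreg := (nreg s3)(3 := 0)\<rparr>)" using s by (simp add: S_def s3_def)
    show "nreg t 3 = i \<and> nval (R 0) t = n" if "?O i t" for i t using that by (simp add: S_def)
  qed (rule outer)
  have "ok read_edges s (1 + 6 + (1 + 4 + (1 + 4 + for_time n (R 0) (10 + for_time n (R 3) 60)))) (?O n)"
    unfolding read_edges_def by (rule ok_Seq_eq[OF 1 ok_Seq_eq[OF 2 ok_Seq_eq[OF 3 4]]])
  then show ?thesis
  proof (rule ok_conseq)
    have "pairs_before E n 0 = {(a, c). c < a \<and> {a, c} \<in> E}" using E by (auto simp: pairs_before_def)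
    then show "\<exists>es. distinct es \<and> set es = {(a, c). c < a \<and> {a, c} \<in> E} \<and>
     nreg s' 1 = length es \<and> nreg s' 2 = K \<and> nreg s' 6 = 2 * K + 2 \<and> creg s' = creg s \<and>
     edge_table (cmem s) (2 * K + 2) es (cmem s')" if "?O n s'" for s'
      using that by (auto simp: S_def)
  qed (simp add: edges_time_def)
qed

definition init_tree :: com where
  "init_tree =
    Seq (SetCReg 2 (CDiv (COfNat (NLit 1)) (CReg 0)))
   (Seq (SetNReg 8 (NAdd (NAdd (R 2) (NLit 3)) (R 1)))
   (Seq (SetNReg 9 (NAdd (NAdd (R 6) (R 1)) (R 1)))
   (Seq (SetNReg 10 (NAdd (R 9) (R 8)))
   (Seq (SetCMem (R 9) (COfNat (NLit 1)))
   (Seq (SetNMem (R 9) (NLit 0))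
   (Seq (SetNMem (NAdd (R 9) (NLit 1)) (NAdd (R 2) (NLit 1)))
        (For 12 (R 1) (SetCMem (mu_addr 9 12) (COfNat (NLit 1))))))))))"

context layout
begin

lemma ok_init_tree:
  assumes s: "nreg s 1 = m" "nreg s 2 = K" "nreg s 6 = 2 * K + 2" "creg s 0 = b"
    and z: "\<And>k. k \<le> K \<Longrightarrow> cmem s k = fps_nth z k"
    and XY: "\<And>e. e < m \<Longrightarrow> cmem s (2 * K + 2 + 2 * e) = of_nat (X e) \<and> cmem s (2 * K + 2 + 2 * e + 1) = of_nat (Y e)"
    and fresh: "\<And>x. 2 * K + 2 + 2 * m \<le> x \<Longrightarrow> cmem s x = 0"
  shows "ok init_tree s (100 + for_time m (R 1) 20)
    (\<lambda>s'. bfs_state s' [(0, K + 1, \<lambda>_. 1, 0)] 0 \<and> nreg s' 9 = addr 0)"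
proof -
  have s1: "nreg s (Suc 0) = m" using s by simp
  define t where "t = s\<lparr>nreg := (nreg s)(8 := stride, 9 := addr 0, 10 := addr 1),
     nmem := (nmem s)(addr 0 := 0, addr 0 + 1 := K + 1),
     creg := (creg s)(2 := 1 / b), cmem := (cmem s)(addr 0 := 1)\<rparr>"
  have a0: "addr 0 = 2 * K + 2 + m + m" by (simp add: addr_def)
  define I where "I = (\<lambda>w s'. s' = t\<lparr>nreg := (nreg t)(12 := w),
     cmem := \<lambda>x. if addr 0 + (K + 3) \<le> x \<and> x < addr 0 + (K + 3) + w then 1 else cmem t x\<rparr>)"
  have loop: "ok (For 12 (R 1) (SetCMem (mu_addr 9 12) (COfNat (NLit 1)))) t (for_time m (R 1) 20) (I m)"
  proof (rule ok_For)
    show "I 0 (t\<lparr>nreg := (nreg t)(12 := 0)\<rparr>)" by (auto simp: I_def fun_eq_iff intro!: state.equality)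
    show "nreg u 12 = w \<and> nval (R 1) u = m" if "I w u" for w u using that s1 by (simp add: I_def t_def)
    show "ok (SetCMem (mu_addr 9 12) (COfNat (NLit 1))) u 20 (\<lambda>s'. nreg s' 12 = w \<and> I (Suc w) (s'\<lparr>nreg := (nreg s')(12 := Suc w)\<rparr>))"
      if I: "I w u" for w u
    proof (rule ok_SetCMem_val)
      show "nval (mu_addr 9 12) u = addr 0 + (K + 3) + w" using I s by (simp add: I_def t_def mu_addr_def)
      show "cval (COfNat (NLit 1)) u = 1" by simp
    qed (use I in \<open>auto simp: I_def mu_addr_def fun_eq_iff intro!: state.equality\<close>)
  qed
  have post: "bfs_state u [(0, K + 1, \<lambda>_. 1, 0)] 0 \<and> nreg u 9 = addr 0" if "I m u" for u
  proof -
    have cm: "cmem u x = (if addr 0 + (K + 3) \<le> x \<and> x < addr 0 + (K + 3) + m then 1 else if x = addr 0 then 1 else cmem s x)" for x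
      using that by (simp add: I_def t_def)
    have "base u"
      unfolding base_def
    proof (intro conjI allI impI)
      fix k assume "k \<le> K" then show "cmem u k = fps_nth z k" using z[of k] by (simp add: cm a0)
    next
      fix e assume "e < m"
      then show "cmem u (2 * K + 2 + 2 * e) = of_nat (X e)" "cmem u (2 * K + 2 + 2 * e + 1) = of_nat (Y e)"
        using XY[of e] by (simp_all add: cm a0)
    qed (use that s s1 in \<open>simp_all add: I_def t_def\<close>)
    \<comment> \<open>The coefficients 1 to \<open>K\<close> of the constant series 1 are never
      written; \<open>fresh\<close> provides their zeros.\<close>
    moreover have "node_ok u 0 (0, K + 1, \<lambda>_. 1, 0)"
      using that fresh by (auto simp: node_ok_def cm I_def t_def a0)
    moreover have "mu_ok u 0 (\<lambda>_. 1)" by (simp add: mu_ok_def cm)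
    ultimately show ?thesis using that by (simp add: bfs_state_def I_def t_def)
  qed
  let ?a = "s\<lparr>creg := (creg s)(2 := 1 / b)\<rparr>"
  let ?b = "?a\<lparr>nreg := (nreg s)(8 := stride)\<rparr>"
  let ?c = "?a\<lparr>nreg := (nreg s)(8 := stride, 9 := addr 0)\<rparr>"
  let ?d = "?a\<lparr>nreg := (nreg s)(8 := stride, 9 := addr 0, 10 := addr 1)\<rparr>"
  let ?e = "?d\<lparr>cmem := (cmem s)(addr 0 := 1)\<rparr>"
  let ?f = "?e\<lparr>nmem := (nmem s)(addr 0 := 0)\<rparr>"
  have 1: "ok (SetCReg 2 (CDiv (COfNat (NLit 1)) (CReg 0))) s 6 (\<lambda>y. y = ?a)"
    by (rule ok_SetCReg) (use s in auto)
  have 2: "ok (SetNReg 8 (NAdd (NAdd (R 2) (NLit 3)) (R 1))) ?a 8 (\<lambda>y. y = ?b)"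
    by (rule ok_SetNReg) (use s s1 in \<open>auto simp: stride_def\<close>)
  have 3: "ok (SetNReg 9 (NAdd (NAdd (R 6) (R 1)) (R 1))) ?b 8 (\<lambda>y. y = ?c)"
    by (rule ok_SetNReg) (use s s1 in \<open>auto simp: a0\<close>)
  have 4: "ok (SetNReg 10 (NAdd (R 9) (R 8))) ?c 8 (\<lambda>y. y = ?d)"
    by (rule ok_SetNReg) (auto simp: addr_def)
  have 5: "ok (SetCMem (R 9) (COfNat (NLit 1))) ?d 8 (\<lambda>y. y = ?e)"
    by (rule ok_SetCMem) auto
  have 6: "ok (SetNMem (R 9) (NLit 0)) ?e 8 (\<lambda>y. y = ?f)"
    by (rule ok_SetNMem) auto
  have 7: "ok (SetNMem (NAdd (R 9) (NLit 1)) (NAdd (R 2) (NLit 1))) ?f 10 (\<lambda>y. y = t)"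
    by (rule ok_SetNMem) (use s in \<open>auto simp: t_def\<close>)
  have "ok init_tree s (1 + 6 + (1 + 8 + (1 + 8 + (1 + 8 + (1 + 8 + (1 + 8 + (1 + 10 + for_time m (R 1) 20))))))) (I m)"
    unfolding init_tree_def
    by (rule ok_Seq_eq[OF 1 ok_Seq_eq[OF 2 ok_Seq_eq[OF 3 ok_Seq_eq[OF 4 ok_Seq_eq[OF 5 ok_Seq_eq[OF 6 ok_Seq_eq[OF 7 loop]]]]]]])
  then show ?thesis by (rule ok_conseq) (use post in auto)
qed

end

subsection \<open>Line graphs\<close>

definition edge_list :: "nat graph \<Rightarrow> (nat \<times> nat) list \<Rightarrow> bool" where
  "edge_list G es \<longleftrightarrow> distinct es \<and> set es = {(a, c). c < a \<and> {a, c} \<in> edges G}"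

abbreviation list_adj :: "(nat \<times> nat) list \<Rightarrow> nat \<Rightarrow> nat \<Rightarrow> bool" where
  "list_adj es \<equiv> layout.adj (\<lambda>e. fst (es ! e)) (\<lambda>e. snd (es ! e))"

definition nth_edge :: "(nat \<times> nat) list \<Rightarrow> nat \<Rightarrow> nat set" where
  "nth_edge es e = {fst (es ! e), snd (es ! e)}"

lemma bij_nth_edge:
  assumes G: "simple_graph G" and es: "edge_list G es"
  shows "bij_betw (nth_edge es) {..<length es} (edges G)"
proof (rule bij_betw_imageI)
  have mem: "snd (es ! e) < fst (es ! e) \<and> nth_edge es e \<in> edges G" if "e < length es" for e
    using es nth_mem[OF that] by (auto simp: edge_list_def nth_edge_def)
  show "inj_on (nth_edge es) {..<length es}"
  proof (rule inj_onI)
    fix e f assume ef: "e \<in> {..<length es}" "f \<in> {..<length es}" and "nth_edge es e = nth_edge es f"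
    then have "es ! e = es ! f"
      using mem[of e] mem[of f] by (auto simp: nth_edge_def doubleton_eq_iff prod_eq_iff)
    then show "e = f" using es ef by (simp add: edge_list_def nth_eq_iff_index_eq)
  qed
  show "nth_edge es ` {..<length es} = edges G"
  proof
    show "nth_edge es ` {..<length es} \<subseteq> edges G" using mem by auto
    show "edges G \<subseteq> nth_edge es ` {..<length es}"
    proof
      fix x assume x: "x \<in> edges G"
      then have "card x = 2" using G by (simp add: simple_graph_def)
      then obtain a c where ac: "x = {a, c}" "a \<noteq> c" by (auto simp: card_2_iff)
      obtain a' c' where "x = {a', c'}" "c' < a'"
        using ac that[of a c] that[of c a] by (cases "c < a") (auto simp: insert_commute)
      then have "(a', c') \<in> set es" using x es by (auto simp: edge_list_def)
      then obtain e where "e < length es" "es ! e = (a', c')" by (auto simp: in_set_conv_nth)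
      then show "x \<in> nth_edge es ` {..<length es}" using \<open>x = {a', c'}\<close> by (auto simp: nth_edge_def intro!: image_eqI[of _ _ e])
    qed
  qed
qed

lemma list_adj_iff:
  assumes G: "simple_graph G" and es: "edge_list G es" and "e < length es" "f < length es"
  shows "list_adj es e f \<longleftrightarrow> nth_edge es e \<noteq> nth_edge es f \<and> nth_edge es e \<inter> nth_edge es f \<noteq> {}"
proof -
  have "e = f \<longleftrightarrow> nth_edge es e = nth_edge es f"
    using bij_betw_imp_inj_on[OF bij_nth_edge[OF G es]] assms(3,4) by (auto dest: inj_onD)
  moreover have "nth_edge es e \<inter> nth_edge es f \<noteq> {} \<longleftrightarrow> fst (es ! e) = fst (es ! f) \<or> fst (es ! e) = snd (es ! f) \<or>
      snd (es ! e) = fst (es ! f) \<or> snd (es ! e) = snd (es ! f)"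
    unfolding nth_edge_def by blast
  ultimately show ?thesis unfolding layout.adj_def by blast
qed

lemma ising_line_graph_eq_wZ:
  assumes G: "simple_graph G" and es: "edge_list G es"
  shows "ising_Z (line_graph G) z b = wZ (list_adj es) (length es) b (\<lambda>_. z)"
proof -
  let ?m = "length es" and ?f = "nth_edge es"
  note bij = bij_nth_edge[OF G es]
  have inj: "inj_on ?f {..<?m}" using bij by (rule bij_betw_imp_inj_on)
  have img: "?f ` {..<?m} = edges G" using bij by (rule bij_betw_imp_surj_on)
  have cut: "card (edge_boundary (line_graph G) (?f ` U)) = cut_size (list_adj es) ?m U" if U: "U \<subseteq> {..<?m}" for U
  proof -
    let ?C = "{(u, w). u \<in> U \<and> w < ?m \<and> w \<notin> U \<and> list_adj es u w}"
    let ?h = "\<lambda>(u, w). {?f u, ?f w}"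
    have in_img: "?f w \<in> ?f ` U \<longleftrightarrow> w \<in> U" if "w < ?m" for w
      using inj_on_image_mem_iff[OF inj _ U] that by simp
    have h_inj: "inj_on ?h ?C"
    proof (rule inj_onI)
      fix p q assume pq: "p \<in> ?C" "q \<in> ?C" "?h p = ?h q"
      obtain u w u' w' where e: "p = (u, w)" "q = (u', w')" by (cases p, cases q)
      have b: "u < ?m" "u' < ?m" "w < ?m" "w' < ?m" "u \<in> U" "u' \<in> U" "w \<notin> U" "w' \<notin> U" using pq U by (auto simp: e)
      \<comment> \<open>\<open>u\<close> and \<open>u'\<close> lie inside and \<open>w\<close> and
        \<open>w'\<close> outside, so the unordered pair determines its orientation.\<close>
      have "?f u = ?f u' \<and> ?f w = ?f w'"
        using pq(3) in_img b by (auto simp: e doubleton_eq_iff)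
      then show "p = q" using inj b by (auto simp: e dest: inj_onD)
    qed
    have "?h ` ?C = edge_boundary (line_graph G) (?f ` U)"
    proof
      show "?h ` ?C \<subseteq> edge_boundary (line_graph G) (?f ` U)"
      proof
        fix x assume "x \<in> ?h ` ?C"
        then obtain u w where x: "x = {?f u, ?f w}" and uw: "u \<in> U" "w < ?m" "w \<notin> U" "list_adj es u w" by auto
        have u: "u < ?m" using uw U by auto
        have "?f u \<in> edges G" "?f w \<in> edges G" using img u uw by auto
        then show "x \<in> edge_boundary (line_graph G) (?f ` U)"
          using uw list_adj_iff[OF G es u uw(2)] in_img[OF uw(2)]
          unfolding x edge_boundary_def line_graph_def by auto
      qed
      show "edge_boundary (line_graph G) (?f ` U) \<subseteq> ?h ` ?C"
      proof
        fix x assume "x \<in> edge_boundary (line_graph G) (?f ` U)"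
        then have xe: "x \<in> edges (line_graph G)"
          and "\<exists>u'\<in>?f ` U. \<exists>y\<in>verts (line_graph G) - ?f ` U. x = {u', y}"
          unfolding edge_boundary_def by blast+
        then obtain u y where x: "u \<in> U" "y \<in> verts (line_graph G)" "y \<notin> ?f ` U" "x = {?f u, y}" by blast
        obtain w where w: "w < ?m" "y = ?f w" using x(2) img by (auto simp: line_graph_def)
        have u: "u < ?m" using x U by auto
        have "?f u \<noteq> ?f w \<and> ?f u \<inter> ?f w \<noteq> {}"
          using xe x w by (auto simp: line_graph_def doubleton_eq_iff)
        then have "list_adj es u w" using list_adj_iff[OF G es u w(1)] by simp
        then have "(u, w) \<in> ?C" using x w in_img by auto
        then show "x \<in> ?h ` ?C" by (intro image_eqI[of _ _ "(u, w)"]) (simp_all add: x(4) w(2))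
      qed
    qed
    then have "card (edge_boundary (line_graph G) (?f ` U)) = card (?h ` ?C)" by (rule arg_cong[OF sym])
    also have "\<dots> = card ?C" by (rule card_image[OF h_inj])
    finally show ?thesis unfolding cut_size_def .
  qed
  have "ising_Z (line_graph G) z b = (\<Sum>W\<in>Pow (?f ` {..<?m}). z ^ card W * b ^ card (edge_boundary (line_graph G) W))"
    unfolding ising_Z_def by (simp add: line_graph_def img)
  also have "\<dots> = (\<Sum>U\<in>Pow {..<?m}. z ^ card (?f ` U) * b ^ card (edge_boundary (line_graph G) (?f ` U)))"
    using sum.reindex_bij_betw[OF bij_betw_Pow[OF bij], of "\<lambda>W. z ^ card W * b ^ card (edge_boundary (line_graph G) W)"]
    by (simp add: img)
  also have "\<dots> = (\<Sum>U\<in>Pow {..<?m}. (\<Prod>u\<in>U. z) * b ^ cut_size (list_adj es) ?m U)"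
  proof (intro sum.cong refl)
    fix U assume U: "U \<in> Pow {..<?m}"
    then have "card (?f ` U) = card U" by (intro card_image inj_on_subset[OF inj]) auto
    then show "z ^ card (?f ` U) * b ^ card (edge_boundary (line_graph G) (?f ` U)) = (\<Prod>u\<in>U. z) * b ^ cut_size (list_adj es) ?m U"
      using cut U by simp
  qed
  finally show ?thesis by (simp add: wZ_def)
qed

text \<open>Every neighbour contains one of the two endpoints, and each endpoint lies in at most
  \<open>\<Delta>\<close> edges.\<close>

lemma list_adj_degree:
  assumes G: "simple_graph G" and es: "edge_list G es" and deg: "max_degree_at_most G \<Delta>" and v: "v < length es"
  shows "card {u. u < length es \<and> list_adj es v u} \<le> 2 * \<Delta>"
proof -
  let ?m = "length es" and ?f = "nth_edge es"
  note bij = bij_nth_edge[OF G es]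
  have img: "?f ` {..<?m} = edges G" using bij by (rule bij_betw_imp_surj_on)
  have fE: "finite (edges G)" using img by (metis finite_imageI finite_lessThan)
  let ?S = "{u. u < ?m \<and> list_adj es v u}"
  let ?x = "fst (es ! v)" and ?y = "snd (es ! v)"
  have fv: "?f v \<in> edges G" using img v by auto
  then have xy: "?x \<in> verts G" "?y \<in> verts G" using G by (auto simp: simple_graph_def nth_edge_def)
  have "card ?S = card (?f ` ?S)"
    by (rule card_image[symmetric]) (rule inj_on_subset[OF bij_betw_imp_inj_on[OF bij]], auto)
  also have "\<dots> \<le> card ({e \<in> edges G. ?x \<in> e} \<union> {e \<in> edges G. ?y \<in> e})"
  proof (rule card_mono)
    show "?f ` ?S \<subseteq> {e \<in> edges G. ?x \<in> e} \<union> {e \<in> edges G. ?y \<in> e}"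
      using img list_adj_iff[OF G es v] by (auto simp: nth_edge_def)
  qed (use fE in auto)
  also have "\<dots> \<le> vertex_degree G ?x + vertex_degree G ?y"
    unfolding vertex_degree_def by (rule card_Un_le)
  also have "\<dots> \<le> \<Delta> + \<Delta>" using deg xy unfolding max_degree_at_most_def by (intro add_mono) blast+
  also have "\<dots> = 2 * \<Delta>" by simp
  finally show ?thesis .
qed

lemma edge_list_length:
  assumes G: "simple_graph G" "verts G = {..<n}" and es: "edge_list G es"
  shows "length es \<le> n ^ 2"
proof -
  have "set es \<subseteq> {..<n} \<times> {..<n}" using G es by (auto simp: edge_list_def simple_graph_def)
  then have "card (set es) \<le> card ({..<n} \<times> {..<n})" by (intro card_mono) auto
  moreover have "card (set es) = length es" using es unfolding edge_list_def by (blast intro: distinct_card)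
  ultimately show ?thesis by (simp add: power2_eq_square)
qed

lemma edge_list_exists:
  assumes "simple_graph G"
  shows "\<exists>es. edge_list G es"
proof -
  have "{(a, c). c < a \<and> {a, c} \<in> edges G} \<subseteq> verts G \<times> verts G" using assms by (auto simp: simple_graph_def)
  then have "finite {(a, c). c < a \<and> {a, c} \<in> edges G}"
    using assms by (elim finite_subset) (simp add: simple_graph_def)
  from finite_distinct_list[OF this] show ?thesis by (auto simp: edge_list_def)
qed

section \<open>Paths, used to exclude \<open>b = 0\<close>\<close>

definition path_graph :: "nat \<Rightarrow> nat graph" where
  "path_graph k = \<lparr>verts = {..k}, edges = (\<lambda>i. {i, Suc i}) ` {..<k}\<rparr>"

lemma path_graph_simple: "simple_graph (path_graph k)"
  by (auto simp: simple_graph_def path_graph_def)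

lemma path_graph_degree: "max_degree_at_most (path_graph k) 2"
  unfolding max_degree_at_most_def vertex_degree_def
proof
  fix v
  have "{e \<in> edges (path_graph k). v \<in> e} \<subseteq> {{v, Suc v}, {v - 1, v}}" by (auto simp: path_graph_def)
  then have "card {e \<in> edges (path_graph k). v \<in> e} \<le> card {{v, Suc v}, {v - 1, v}}" by (intro card_mono) auto
  also have "\<dots> \<le> 2" by (simp add: card_insert_if)
  finally show "card {e \<in> edges (path_graph k). v \<in> e} \<le> 2" .
qed

text \<open>At \<open>b = 0\<close> only sets with empty boundary survive, with
  \<open>0 ^ 0 = 1\<close>. The line graph of a path is connected, which leaves the empty set and
  the full set; these differ because \<open>0 < k\<close>.\<close>

lemma ising_path_zero:
  assumes k: "0 < k"
  shows "ising_Z (line_graph (path_graph k)) z 0 = 1 + z ^ k"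
proof -
  let ?L = "line_graph (path_graph k)" and ?e = "\<lambda>i::nat. {i, Suc i}"
  have V: "verts ?L = ?e ` {..<k}" by (simp add: line_graph_def path_graph_def)
  have inj: "inj_on ?e {..<k}" by (auto simp: inj_on_def doubleton_eq_iff)
  have fin: "finite (verts ?L)" by (simp add: V)
  have "edge_boundary ?L W = {} \<longleftrightarrow> W = {} \<or> W = verts ?L" if W: "W \<subseteq> verts ?L" for W
  proof
    assume b: "edge_boundary ?L W = {}"
    have adj: "{?e i, ?e (Suc i)} \<in> edges ?L" if "Suc i < k" for i
    proof -
      have "?e i \<in> edges (path_graph k)" "?e (Suc i) \<in> edges (path_graph k)"
        using that by (auto simp: path_graph_def)
      moreover have "?e i \<noteq> ?e (Suc i)" "?e i \<inter> ?e (Suc i) \<noteq> {}" by (auto simp: doubleton_eq_iff)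
      ultimately show ?thesis unfolding line_graph_def by auto
    qed
    have step: "?e i \<in> W \<longleftrightarrow> ?e (Suc i) \<in> W" if i: "Suc i < k" for i
    proof (rule ccontr)
      assume "\<not> ?thesis"
      moreover have "?e i \<in> verts ?L" "?e (Suc i) \<in> verts ?L" using i by (auto simp: V)
      ultimately have "\<exists>u\<in>W. \<exists>v\<in>verts ?L - W. {?e i, ?e (Suc i)} = {u, v}" by blast
      then have "{?e i, ?e (Suc i)} \<in> edge_boundary ?L W"
        unfolding edge_boundary_def using adj[OF i] by (intro CollectI conjI)
      then show False using b by simp
    qed
    have all: "i < k \<Longrightarrow> ?e i \<in> W \<longleftrightarrow> ?e 0 \<in> W" for i
      by (induction i) (use step in auto)
    show "W = {} \<or> W = verts ?L"
    proof (cases "?e 0 \<in> W")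
      case True
      then have "verts ?L \<subseteq> W" using all by (auto simp: V)
      then show ?thesis using W by auto
    next
      case False
      then have "W = {}" using all W by (force simp: V)
      then show ?thesis by simp
    qed
  next
    assume "W = {} \<or> W = verts ?L"
    then show "edge_boundary ?L W = {}" by (auto simp: edge_boundary_def)
  qed
  moreover have "finite (edge_boundary ?L W)" if "W \<subseteq> verts ?L" for W
  proof (rule finite_subset)
    show "edge_boundary ?L W \<subseteq> Pow (verts ?L)" using that by (auto simp: edge_boundary_def)
  qed (use fin in simp)
  ultimately have c: "card (edge_boundary ?L W) = 0 \<longleftrightarrow> W = {} \<or> W = verts ?L" if "W \<subseteq> verts ?L" for W
    using that by simp
  have "ising_Z ?L z 0 = (\<Sum>W\<in>Pow (verts ?L). if W = {} \<or> W = verts ?L then z ^ card W else 0)"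
    unfolding ising_Z_def by (intro sum.cong refl) (use c in \<open>auto simp: power_0_left\<close>)
  also have "\<dots> = (\<Sum>W\<in>{{}, verts ?L}. z ^ card W)"
    using fin by (subst sum.inter_filter[symmetric]) (auto intro!: sum.cong)
  also have "\<dots> = 1 + z ^ k"
  proof -
    have "verts ?L \<noteq> {}" "card (verts ?L) = k" using k inj by (auto simp: V card_image)
    then show ?thesis by simp
  qed
  finally show ?thesis .
qed

subsection \<open>The complete program\<close>

text \<open>The empty graph has its own branch: at \<open>n = 0\<close> the time allowance is one
  constant for all \<open>\<epsilon>\<close>, while the general branch takes longer as
  \<open>k0\<close>, and with it the precision, grows.\<close>

definition main_prog :: "nat \<Rightarrow> nat \<Rightarrow> (nat \<Rightarrow> nat) \<Rightarrow> nat \<Rightarrow> nat \<Rightarrow> com" where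
  "main_prog k0 c0 c D N =
    If_Then_Else (NLess (NLit 0) (R 0))
      (Seq (compute_K k0 c0) (Seq (set_coeffs c D N) (Seq read_edges (Seq init_tree
        (Seq build_tree (Seq fold_tree log_exp))))))
      (SetCReg 0 (COfNat (NLit 1)))"

definition coeff_series :: "complex \<Rightarrow> (nat \<Rightarrow> nat) \<Rightarrow> nat \<Rightarrow> complex fps" where
  "coeff_series \<xi> c D = Abs_fps (\<lambda>k. \<xi> * (of_nat (c k) / of_nat D))"

definition approx_series :: "(nat \<times> nat) list \<Rightarrow> complex \<Rightarrow> complex fps \<Rightarrow> nat \<Rightarrow> complex fps" where
  "approx_series es b z K = (\<Prod>u<length es. 1 + ratio_approx (list_adj es) (length es) b z K u (\<lambda>w. if w < u then 0 else 1))"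

definition output_value :: "(nat \<times> nat) list \<Rightarrow> complex \<Rightarrow> complex \<Rightarrow> (nat \<Rightarrow> nat) \<Rightarrow> nat \<Rightarrow> nat \<Rightarrow> complex" where
  "output_value es b \<xi> c D K = (1 + log_sum (approx_series es b (coeff_series \<xi> c D) K) K / of_nat (2 ^ K)) ^ (2 ^ K)"

lemma approx_series_nth_0:
  assumes "fps_nth z 0 = 0"
  shows "fps_nth (approx_series es b z K) 0 = 1"
proof -
  have "fps_nth (\<Prod>u<j. 1 + ratio_approx (list_adj es) (length es) b z K u (\<lambda>w. if w < u then 0 else 1)) 0 = 1" for j
    by (induction j) (simp_all add: ratio_approx_nth_0[OF assms])
  then show ?thesis by (simp add: approx_series_def)
qed

section \<open>Running times, cubic in a common size bound\<close>

lemma for_time_bound: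
  assumes "N \<le> S" "1 \<le> S" "T + 2 * ncost e + 20 \<le> B"
  shows "for_time N e T \<le> B * S"
proof -
  have "for_time N e T \<le> S * (T + ncost e + 10) + S * (ncost e + 10)"
    unfolding for_time_def using assms by (simp only: add.assoc) (intro add_mono mult_right_mono, auto)
  also have "\<dots> = S * (T + 2 * ncost e + 20)" by (simp add: algebra_simps)
  also have "\<dots> \<le> S * B" using assms by (intro mult_left_mono) auto
  finally show ?thesis by (simp add: mult.commute)
qed

context layout
begin

lemma new_block_time_bound:
  assumes "m \<le> S" "K + 1 \<le> S" "1 \<le> S" "ccost a \<le> 2" "ccost c \<le> 2"
  shows "new_block_time a c \<le> 160 * S"
proof -
  have "for_time m (R 1) 20 \<le> 42 * S" using assms by (intro for_time_bound) auto
  moreover have "for_time (K + 1) (NAdd (R 2) (NLit 1)) 20 \<le> 46 * S" using assms by (intro for_time_bound) auto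
  ultimately show ?thesis using assms unfolding new_block_time_def by linarith
qed

lemma expand_time_bound:
  assumes "m \<le> S" "K + 1 \<le> S" "1 \<le> S" "ccost pre \<le> 2" "ccost post \<le> 2" "ccost a \<le> 2" "ccost c \<le> 2" "tcost p \<le> 100"
  shows "expand_time p pre post a c \<le> 400 * S * S"
proof -
  have nb: "new_block_time a c \<le> 160 * S" using assms by (intro new_block_time_bound)
  show ?thesis unfolding expand_time_def
  proof (rule for_time_bound)
    show "1 + tcost p + (1 + (25 + ccost pre) + (1 + new_block_time a c + (25 + ccost post))) + 2 * ncost (R 1) + 20 \<le> 400 * S"
      using nb assms by simp
  qed (use assms in auto)
qed

lemma build_time_bound:
  assumes "m \<le> S" "K + 1 \<le> S" "1 \<le> S" "N \<le> S"
  shows "build_time N \<le> 1000 * S ^ 3"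
proof -
  have S2: "1 \<le> S * S" "S * S \<le> S * S * S" using assms by simp_all
  have 1: "expand_time true_test (COfNat (NLit 1)) (COfNat (NLit 0)) (COfNat (NLit 1)) (COfNat (NLit 0)) \<le> 400 * S * S"
    using assms by (intro expand_time_bound) (auto simp: true_test_def)
  have 2: "expand_time adj_test (CReg 2) (CReg 2) (CReg 0) (CReg 0) \<le> 400 * S * S"
    using assms by (intro expand_time_bound) (auto simp: adj_test_def vertex_x_def vertex_y_def Let_def)
  have "node_time + 20 \<le> 400 * S * S + 120" using 2 by (simp add: node_time_def)
  also have "\<dots> \<le> 520 * (S * S)" using S2 by linarith
  finally have "N * (node_time + 20) \<le> S * (520 * (S * S))" using assms by (intro mult_mono) auto
  then have "build_time N \<le> 400 * (S * S) + 520 * (S * S * S) + 30"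
    using 1 unfolding build_time_def by (simp add: mult_ac)
  also have "\<dots> \<le> 1000 * (S * S * S)" using S2 by linarith
  finally show ?thesis by (simp add: power3_eq_cube)
qed

lemma fold_time_bound:
  assumes "K + 1 \<le> S" "1 \<le> S" "N \<le> S"
  shows "fold_time N \<le> 400 * S ^ 3"
proof -
  have S2: "1 \<le> S * S" "S * S \<le> S * S * S" using assms by simp_all
  have "for_time K (R 13) 30 \<le> 52 * S" using assms by (intro for_time_bound) auto
  then have "for_time (K + 1) (NAdd (R 2) (NLit 1)) (100 + for_time K (R 13) 30) \<le> (200 * S) * S"
    using assms by (intro for_time_bound) auto
  then have "propagate_time + 20 \<le> 240 * (S * S)" using S2(1) unfolding propagate_time_def mult.assoc by linarith
  then have "N * (propagate_time + 20) \<le> S * (240 * (S * S))" using assms by (intro mult_mono) auto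
  then have "fold_time N \<le> 240 * (S * S * S) + 30" unfolding fold_time_def by (simp add: mult_ac)
  also have "\<dots> \<le> 400 * (S * S * S)" using S2 by linarith
  finally show ?thesis by (simp add: power3_eq_cube)
qed

lemma log_exp_time_bound:
  assumes "K + 1 \<le> S" "1 \<le> S"
  shows "log_exp_time \<le> 500 * S ^ 3"
proof -
  have S2: "1 \<le> S * S" "S * S \<le> S * S * S" "S \<le> S * S" using assms by simp_all
  have "for_time K (R 13) 30 \<le> 52 * S" "for_time K (R 2) 30 \<le> 52 * S" using assms by (intro for_time_bound; auto)+
  moreover from this have "for_time K (R 2) (100 + for_time K (R 13) 30) \<le> (200 * S) * S"
    using assms by (intro for_time_bound) auto
  ultimately have "log_exp_time \<le> 100 + 200 * (S * S) + 2 * (52 * S)" unfolding log_exp_time_def by (simp add: mult_ac)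
  also have "\<dots> \<le> 500 * (S * S * S)" using S2 by linarith
  finally show ?thesis by (simp add: power3_eq_cube)
qed

end

lemma edges_time_bound:
  assumes "n \<le> S" "1 \<le> S"
  shows "edges_time n \<le> 300 * S ^ 3"
proof -
  have S2: "1 \<le> S * S" "S * S \<le> S * S * S" using assms by simp_all
  have "for_time n (R 3) 60 \<le> 82 * S" using assms by (intro for_time_bound) auto
  then have "for_time n (R 0) (10 + for_time n (R 3) 60) \<le> (120 * S) * S"
    using assms by (intro for_time_bound) auto
  then have "edges_time n \<le> 30 + 120 * (S * S)" unfolding edges_time_def by (simp add: mult_ac)
  also have "\<dots> \<le> 300 * (S * S * S)" using S2 by linarith
  finally show ?thesis by (simp add: power3_eq_cube)
qed

lemma input_state_adjacency:
  assumes "i < n" "j < n"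
  shows "0 < nmem (input_state n G b \<xi>) (i * n + j) \<longleftrightarrow> {i, j} \<in> edges G"
proof -
  have "i' = i \<and> j' = j" if "i' < n" "j' < n" "i * n + j = i' * n + j'" for i' j'
  proof -
    have "(i * n + j) div n = i" "(i * n + j) mod n = j" using assms by simp_all
    moreover have "(i' * n + j') div n = i'" "(i' * n + j') mod n = j'" using that(1,2) by simp_all
    ultimately show ?thesis using that(3) by simp
  qed
  then show ?thesis using assms by (auto simp: input_state_def)
qed

text \<open>\<open>S\<close> dominates the number of vertices, \<open>K + 1\<close>, the number of
  edges and the number of tree nodes. Its cube suffices: each node runs a loop over all edges, and
  each pass copies at most a block. The factor 3000 collects the generous constants of the
  phases.\<close>

lemma ok_main_prog:
  assumes G: "simple_graph G" "verts G = {..<n}" "max_degree_at_most G \<Delta>" and n: "1 \<le> n"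
    and c: "c 0 = 0" "\<And>k. k > N \<Longrightarrow> c k = 0" "N \<le> k0"
    and S: "n \<le> S" "\<And>l m. 2 ^ l \<le> 2 * n \<Longrightarrow> m \<le> n ^ 2 \<Longrightarrow> k0 + c0 * l + 1 \<le> S \<and> m \<le> S \<and>
      1 + m * tree_size (2 * \<Delta>) (k0 + c0 * l) \<le> S"
  shows "ok (main_prog k0 c0 c D N) (input_state n G b \<xi>) (3000 * S ^ 3) (\<lambda>s'. \<exists>l es. n \<le> 2 ^ l \<and> edge_list G es \<and>
    creg s' 0 = output_value es b \<xi> c D (k0 + c0 * l))"
proof -
  let ?s0 = "input_state n G b \<xi>"
  let ?Q = "\<lambda>s'. \<exists>l es. n \<le> 2 ^ l \<and> edge_list G es \<and>
    creg s' 0 = output_value es b \<xi> c D (k0 + c0 * l)"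
  define z where "z = coeff_series \<xi> c D"
  have z0: "fps_nth z 0 = 0" using c by (simp add: z_def coeff_series_def)
  have S1: "1 \<le> S" using n S by simp
  have S3: "1 \<le> S ^ 3" "S \<le> S ^ 3" using S1 self_le_power[of S 3] by simp_all
  have "(2::nat) ^ 0 \<le> 2 * n" using n by simp
  then have k0: "k0 + 1 \<le> S" using S(2)[of 0 0] by simp
  let ?rest1 = "Seq init_tree (Seq build_tree (Seq fold_tree log_exp))"
  have main: "ok (Seq (set_coeffs c D N) (Seq read_edges ?rest1)) s1 (2700 * S ^ 3) ?Q"
    if l: "n \<le> 2 ^ l" "2 ^ l \<le> 2 * n" and s1: "s1 = ?s0\<lparr>nreg := (nreg ?s0)(2 := k0 + c0 * l, 5 := 2 ^ l)\<rparr>" for l s1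
  proof -
    define K where "K = k0 + c0 * l"
    have K: "K + 1 \<le> S" using S(2)[of l 0] l by (simp add: K_def)
    define s2 where "s2 = s1\<lparr>cmem := (\<lambda>x. if 1 \<le> x \<and> x \<le> N then creg s1 1 * (of_nat (c x) / of_nat D) else cmem s1 x)\<rparr>"
    have cm2: "cmem s2 x = (if 1 \<le> x \<and> x \<le> N then \<xi> * (of_nat (c x) / of_nat D) else 0)" for x
      by (simp add: s2_def s1 input_state_def)
    have r2: "nreg s2 0 = n" "nreg s2 2 = K" "nmem s2 = nmem ?s0" "creg s2 0 = b"
      by (simp_all add: s2_def s1 K_def input_state_def)
    have 1: "ok (set_coeffs c D N) s1 (20 * N + 10) (\<lambda>t. t = s2)"
      unfolding s2_def by (rule ok_set_coeffs)
    have 2: "ok read_edges s2 (edges_time n) (\<lambda>s'. \<exists>es. edge_list G es \<and>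
       nreg s' 1 = length es \<and> nreg s' 2 = K \<and> nreg s' 6 = 2 * K + 2 \<and> creg s' = creg s2 \<and>
       edge_table (cmem s2) (2 * K + 2) es (cmem s'))"
      unfolding edge_list_def
    proof (rule ok_conseq[OF ok_read_edges[where E = "edges G", OF r2(1,2)]])
      show "0 < nmem s2 (i * n + j) \<longleftrightarrow> {i, j} \<in> edges G" if "i < n" "j < n" for i j
        unfolding r2(3) by (rule input_state_adjacency[OF that])
      show "i < n" if "{i, j} \<in> edges G" for i j using that G by (auto simp: simple_graph_def)
    qed blast+
    have 3: "ok ?rest1 s3 (2300 * S ^ 3) ?Q"
      if "\<exists>es. edge_list G es \<and> nreg s3 1 = length es \<and> nreg s3 2 = K \<and> nreg s3 6 = 2 * K + 2 \<and> creg s3 = creg s2 \<and>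
         edge_table (cmem s2) (2 * K + 2) es (cmem s3)" for s3
    proof -
      from that obtain es where es: "edge_list G es" "nreg s3 1 = length es" "nreg s3 2 = K" "nreg s3 6 = 2 * K + 2"
        "creg s3 = creg s2" "edge_table (cmem s2) (2 * K + 2) es (cmem s3)" by blast
      define m where "m = length es"
      interpret layout m K b z "\<lambda>e. fst (es ! e)" "\<lambda>e. snd (es ! e)" .
      have "m \<le> n ^ 2" using edge_list_length[OF G(1,2) es(1)] by (simp add: m_def)
      then have mS: "m \<le> S" "1 + m * tree_size (2 * \<Delta>) K \<le> S" using S(2)[of l m] l by (simp_all add: K_def)
      have deg: "card {u. u < m \<and> adj v u} \<le> 2 * \<Delta>" if "v < m" for v
        using list_adj_degree[OF G(1) es(1) G(3)] that by (simp add: m_def)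
      have c3: "cmem s3 x = cmem s2 x" if "x < 2 * K + 2 \<or> 2 * K + 2 + 2 * m \<le> x" for x
        using es(6) that unfolding edge_table_def m_def by blast
      have init: "ok init_tree s3 (100 + for_time m (R 1) 20)
         (\<lambda>s'. bfs_state s' [(0, K + 1, \<lambda>_. 1, 0)] 0 \<and> nreg s' 9 = addr 0)"
      proof (rule ok_init_tree)
        show "nreg s3 1 = m" "nreg s3 2 = K" "nreg s3 6 = 2 * K + 2" "creg s3 0 = b"
          using es r2 by (simp_all add: m_def)
        show "cmem s3 k = fps_nth z k" if "k \<le> K" for k
        proof -
          have "cmem s3 k = cmem s2 k" using that by (intro c3) simp
          then show ?thesis using c(1) c(2)[of k] by (cases "k = 0") (auto simp: cm2 z_def coeff_series_def)
        qed
        show "cmem s3 (2 * K + 2 + 2 * e) = of_nat (fst (es ! e)) \<and> cmem s3 (2 * K + 2 + 2 * e + 1) = of_nat (snd (es ! e))"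
          if "e < m" for e using es(6) that by (simp add: edge_table_def m_def)
        show "cmem s3 x = 0" if "2 * K + 2 + 2 * m \<le> x" for x
        proof -
          have "cmem s3 x = cmem s2 x" using that by (intro c3) simp
          moreover have "N < x" using that c(3) by (simp add: K_def)
          ultimately show ?thesis by (simp add: cm2)
        qed
      qed
      let ?F = "approx_series es b z K"
      have F: "?F = (\<Prod>u<m. 1 + ratio_approx adj m b z K u (\<lambda>w. if w < u then 0 else 1))"
        by (simp add: approx_series_def m_def)
      have fin: "ok (Seq fold_tree log_exp) t (1 + 400 * S ^ 3 + log_exp_time) ?Q"
        if "\<exists>i. Suc i = length (bfs i) \<and> bfs_state t (bfs i) (Suc i) \<and> nreg t 9 = addr (Suc i)" for t
      proof -
        from that obtain i where i: "Suc i = length (bfs i)" "bfs_state t (bfs i) (Suc i)" "nreg t 9 = addr (Suc i)" by blast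
        have "length (bfs i) \<le> S" using bfs_size[OF deg, of i] i(1) mS by simp
        then have "fold_time (length (bfs i)) \<le> 400 * S ^ 3" using K S1 by (intro fold_time_bound)
        then have f: "ok fold_tree t (400 * S ^ 3) (\<lambda>s'. nreg s' 2 = K \<and> nreg s' 9 = addr 0 \<and>
           (\<forall>k\<le>K. cmem s' (addr 0 + k) = fps_nth ?F k))"
          using ok_fold_tree[OF z0 i] unfolding F by (elim ok_conseq) auto
        show ?thesis
        proof (rule ok_Seq[OF f])
          fix u :: state assume u: "nreg u 2 = K \<and> nreg u 9 = addr 0 \<and> (\<forall>k\<le>K. cmem u (addr 0 + k) = fps_nth ?F k)"
          have "ok log_exp u log_exp_time (\<lambda>s'. creg s' 0 = (1 + log_sum ?F K / of_nat (2 ^ K)) ^ (2 ^ K))"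
            using u addr_lower[of 0] by (intro ok_log_exp) (auto simp: approx_series_nth_0[OF z0])
          then show "ok log_exp u log_exp_time ?Q"
            by (rule ok_conseq) (use l es in \<open>auto simp: K_def z_def output_value_def\<close>)
        qed
      qed
      have "ok ?rest1 s3 (1 + (100 + for_time m (R 1) 20) + (1 + build_time (1 + m * tree_size (2 * \<Delta>) K) + (1 + 400 * S ^ 3 + log_exp_time))) ?Q"
      proof (rule ok_Seq[OF init])
        fix t assume "bfs_state t [(0, K + 1, \<lambda>_. 1, 0)] 0 \<and> nreg t 9 = addr 0"
        then show "ok (Seq build_tree (Seq fold_tree log_exp)) t (1 + build_time (1 + m * tree_size (2 * \<Delta>) K) + (1 + 400 * S ^ 3 + log_exp_time)) ?Q"
          using fin by (intro ok_Seq[OF ok_build_tree[OF deg]]) auto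
      qed
      moreover have "for_time m (R 1) 20 \<le> 42 * S" using mS S1 by (intro for_time_bound) auto
      moreover have "build_time (1 + m * tree_size (2 * \<Delta>) K) \<le> 1000 * S ^ 3" using mS K S1 by (intro build_time_bound)
      moreover have "log_exp_time \<le> 500 * S ^ 3" using K S1 by (intro log_exp_time_bound)
      ultimately show ?thesis
        by (elim ok_conseq; use S3 in \<open>linarith | blast\<close>)
    qed
    have "20 * N + 10 \<le> 30 * S" using c(3) k0 S1 by linarith
    moreover have "ok (Seq (set_coeffs c D N) (Seq read_edges ?rest1)) s1 (1 + (20 * N + 10) + (1 + edges_time n + 2300 * S ^ 3)) ?Q"
      by (rule ok_Seq_eq[OF 1 ok_Seq[OF 2 3]])
    moreover have "edges_time n \<le> 300 * S ^ 3" using S S1 by (intro edges_time_bound)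
    ultimately show ?thesis
      by (elim ok_conseq; use S3 in \<open>linarith | blast\<close>)
  qed
  have "ok (Seq (compute_K k0 c0) (Seq (set_coeffs c D N) (Seq read_edges ?rest1))) ?s0 (1 + (30 * n + 30) + 2700 * S ^ 3) ?Q"
  proof (rule ok_Seq[OF ok_compute_K[OF _ n]])
    show "nreg ?s0 0 = n" by (simp add: input_state_def)
  qed (use main in blast)
  then have "ok (Seq (compute_K k0 c0) (Seq (set_coeffs c D N) (Seq read_edges ?rest1))) ?s0 (2900 * S ^ 3) ?Q"
    by (rule ok_conseq; use S3 S(1) in \<open>linarith | blast\<close>)
  then have "ok (main_prog k0 c0 c D N) ?s0 (1 + tcost (NLess (NLit 0) (R 0)) + 2900 * S ^ 3) ?Q"
    unfolding main_prog_def using n by (intro ok_If) (auto simp: input_state_def)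
  then show ?thesis
    by (rule ok_conseq) (use S3 in auto)
qed

lemma ok_main_prog_empty:
  "ok (main_prog k0 c0 c D N) (input_state 0 G b \<xi>) 10 (\<lambda>s'. creg s' 0 = 1)"
proof -
  have "ok (main_prog k0 c0 c D N) (input_state 0 G b \<xi>) (1 + tcost (NLess (NLit 0) (R 0)) + 3) (\<lambda>s'. creg s' 0 = 1)"
    unfolding main_prog_def
  proof (rule ok_If)
    show "ok (SetCReg 0 (COfNat (NLit 1))) (input_state 0 G b \<xi>) 3 (\<lambda>s'. creg s' 0 = 1)"
      by (rule ok_SetCReg) auto
  qed (simp add: input_state_def)
  then show ?thesis by (rule ok_conseq) auto
qed

subsection \<open>Approximation error and running time\<close>

lemma wZ_poly: "poly (wZ A m [:b:] (\<lambda>_. p)) t = wZ A m b (\<lambda>_. poly p t)"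
  by (simp add: wZ_def poly_sum poly_power)

lemma wZ_fps_of_poly:
  "fps_of_poly (wZ A m [:b:] (\<lambda>_. p)) = wZ A m (fps_const b) (\<lambda>_. fps_of_poly p)"
  by (simp add: wZ_def fps_of_poly_sum fps_of_poly_mult fps_of_poly_power fps_of_poly_const)

lemma degree_wZ_le:
  fixes b :: complex
  assumes "degree p \<le> N"
  shows "degree (wZ A m [:b:] (\<lambda>_. p)) \<le> m * N"
  unfolding wZ_def
proof (rule degree_sum_le)
  fix W assume W: "W \<in> Pow {..<m}"
  have "degree ((\<Prod>u\<in>W. p) * [:b:] ^ cut_size A m W) \<le> degree (p ^ card W) + degree ([:b:] ^ cut_size A m W)"
    by (simp only: prod_constant degree_mult_le)
  also have "\<dots> \<le> degree p * card W + degree [:b:] * cut_size A m W"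
    by (intro add_mono degree_power_le)
  also have "\<dots> \<le> N * m"
    using assms W card_mono[of "{..<m}" W] by (simp add: mult_mono)
  finally show "degree ((\<Prod>u\<in>W. p) * [:b:] ^ cut_size A m W) \<le> m * N" by (simp add: mult.commute)
qed simp

text \<open>Newton's recurrence up to order \<open>K\<close> reads only the coefficients up to
  \<open>K\<close>.\<close>

lemma log_sum_cong:
  assumes "fps_nth f 0 = 1" "\<And>i. i \<le> K \<Longrightarrow> fps_nth f i = fps_nth g i"
  shows "log_sum f K = log_sum g K"
proof -
  have "fps_nth g 0 = 1" using assms(1) assms(2)[of 0] by simp
  have "fps_nth (log_deriv f) k = fps_nth (log_deriv g) k" if "k \<le> K" for k
    using that
  proof (induction k rule: less_induct)
    case (less k)
    have "(\<Sum>j=1..<k. fps_nth (log_deriv f) j * fps_nth f (k - j)) = (\<Sum>j=1..<k. fps_nth (log_deriv g) j * fps_nth g (k - j))"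
      using less assms(2) by (intro sum.cong) auto
    then show ?case
      using log_deriv_nth[OF assms(1), of k] log_deriv_nth[OF \<open>fps_nth g 0 = 1\<close>, of k] assms(2)[OF less.prems] by simp
  qed
  then show ?thesis unfolding log_sum_def by (intro sum.cong) auto
qed

text \<open>\<open>ratio_bound\<close> with degree \<open>2 * \<Delta>\<close> and constant weights.
  The radius \<open>\<rho> / C\<close> depends only on \<open>b\<close> and \<open>\<Delta>\<close>;
  the choice of \<open>\<rho>\<close> makes both \<open>\<rho>\<close> and
  \<open>cmod b * \<rho>\<close> at most \<open>1 / 2\<close>.\<close>

lemma ising_nonzero_near_0:
  assumes b: "b \<noteq> 0"
  shows "\<exists>r>0. \<forall>(G :: nat graph) w. simple_graph G \<longrightarrow> max_degree_at_most G \<Delta> \<longrightarrow> cmod w < r \<longrightarrow> ising_Z (line_graph G) w b \<noteq> 0"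
proof -
  define B where "B = max 1 (cmod (1 / b))"
  define \<rho> where "\<rho> = 1 / (2 * (1 + cmod b))"
  define C where "C = B ^ (2 * (2 * \<Delta>)) * (2 * (cmod b + 1)) ^ (2 * \<Delta>)"
  have B: "1 \<le> B" "cmod (1 / b) \<le> B" by (auto simp: B_def)
  have nb: "0 < 1 + cmod b" by (simp add: add_pos_nonneg)
  have \<rho>: "0 < \<rho>" "\<rho> \<le> 1 / 2" "cmod b * \<rho> \<le> 1 / 2"
    using nb by (auto simp: \<rho>_def field_simps)
  have C: "0 < C" using B nb by (simp add: C_def add.commute)
  have "ising_Z (line_graph G) w b \<noteq> 0"
    if G: "simple_graph G" "max_degree_at_most G \<Delta>" and w: "cmod w < \<rho> / C" for G :: "nat graph" and w
  proof -
    obtain es where es: "edge_list G es" using edge_list_exists[OF G(1)] by blast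
    define m where "m = length es"
    interpret layout m 0 b 0 "\<lambda>e. fst (es ! e)" "\<lambda>e. snd (es ! e)" .
    have "wZ adj m b (\<lambda>_. w) \<noteq> 0 \<and> (\<forall>v<m. \<exists>r. is_ratio adj m b (\<lambda>_. w) v r \<and> cmod r \<le> \<rho>)"
    proof (rule ratio_bound[OF b B _ \<rho>])
      show "card {u. u < m \<and> adj v u} \<le> 2 * \<Delta>" if "v < m" for v
        using list_adj_degree[OF G(1) es G(2)] that by (simp add: m_def)
      show "0 \<le> cmod w" by simp
      have "cmod w * C \<le> \<rho>" using w C by (simp add: field_simps)
      then show "cmod w * B ^ (2 * (2 * \<Delta>)) * (2 * (cmod b + 1)) ^ (2 * \<Delta>) \<le> \<rho>"
        by (simp add: C_def mult.assoc)
      show "cmod w \<le> cmod w * B ^ (2 * card {v. v < m \<and> adj u v \<and> w = 0})" for u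
        using mult_left_mono[OF one_le_power[OF B(1)], of "cmod w"] by simp
    qed
    then show ?thesis using ising_line_graph_eq_wZ[OF G(1) es] by (simp add: m_def)
  qed
  then show ?thesis using \<rho> C by (intro exI[of _ "\<rho> / C"]) auto
qed

text \<open>\<open>cis (pi / k)\<close> has k-th power -1, and its argument drops below
  \<open>\<theta>\<close> once \<open>k > pi / \<theta>\<close>.\<close>

lemma path_has_zero_in_sector:
  assumes "0 < \<theta>"
  shows "\<exists>k z. z \<in> arg_sector \<theta> \<and> ising_Z (line_graph (path_graph k)) z 0 = 0"
proof -
  obtain k :: nat where k: "pi / \<theta> < real k" using reals_Archimedean2 by blast
  have "0 < pi / \<theta>" using assms by simp
  then have k0: "0 < k" using k by (simp add: gr0I)
  define x where "x = pi / real k"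
  have x: "0 < x" "x \<le> pi" "x < \<theta>" using k k0 assms by (auto simp: x_def field_simps)
  have "real k * x = pi" using k0 by (simp add: x_def)
  then have "cis x ^ k = -1" unfolding Complex.DeMoivre by simp
  then have "ising_Z (line_graph (path_graph k)) (cis x) 0 = 0" using ising_path_zero[OF k0] by simp
  moreover have "Arg (cis x) = x" using x by (intro cis_Arg_unique) (auto simp: sgn_eq)
  then have "cis x \<in> arg_sector \<theta>" using x by (simp add: arg_sector_def)
  ultimately show ?thesis by blast
qed

text \<open>The first summand is the tail of the logarithm, the second the price of replacing the
  exponential by a power. As the degree is at most \<open>m * N\<close>, with m the number of edges,
  \<open>m * A\<close> bounds the truncated logarithm, and \<open>m * A / \<beta> ^ K\<close> bounds
  its tail.\<close>

lemma approximation_error: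
  fixes \<xi> b :: complex
  assumes G: "simple_graph G" and es: "edge_list G es" and b: "b \<noteq> 0" and \<beta>: "\<beta> > 1"
    and c: "c 0 = 0" "\<And>k. k > N \<Longrightarrow> c k = 0" "0 < D" "(\<Sum>k\<le>N. c k) = D"
    and nz: "\<And>t. cmod t \<le> \<beta> \<Longrightarrow> ising_Z (line_graph G) (\<xi> * (\<Sum>k\<le>N. of_nat (c k) / of_nat D * t ^ k)) b \<noteq> 0"
    and A: "A = real N / (\<beta> - 1)" and M: "2 * (real (length es) * A) \<le> 2 ^ K"
  shows "mult_approx (real (length es) * A / \<beta> ^ K + 2 * (real (length es) * A) ^ 2 / 2 ^ K)
    (output_value es b \<xi> c D K)
    (ising_Z (line_graph G) \<xi> b)"
proof -
  define m where "m = length es"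
  define z where "z = coeff_series \<xi> c D"
  interpret layout m 0 b 0 "\<lambda>e. fst (es ! e)" "\<lambda>e. snd (es ! e)" .
  define p where "p = (\<Sum>k\<le>N. monom (\<xi> * (of_nat (c k) / of_nat D)) k)"
  have pt: "poly p t = \<xi> * (\<Sum>k\<le>N. of_nat (c k) / of_nat D * t ^ k)" for t
    by (simp add: p_def poly_sum poly_monom sum_distrib_left mult.assoc)
  have pz: "fps_of_poly p = z"
    using c(2) by (intro fps_ext) (auto simp: p_def z_def coeff_series_def coeff_sum not_le)
  have z0: "fps_nth z 0 = 0" using c by (simp add: z_def coeff_series_def)
  have dp: "degree p \<le> N" unfolding p_def
    by (intro degree_sum_le) (auto intro: order_trans[OF degree_monom_le])
  define f where "f = wZ adj m [:b:] (\<lambda>_. p)"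
  have Z: "ising_Z (line_graph G) w b = wZ adj m b (\<lambda>_. w)" for w
    using ising_line_graph_eq_wZ[OF G es] by (simp add: m_def)
  have ft: "poly f t = ising_Z (line_graph G) (\<xi> * (\<Sum>k\<le>N. of_nat (c k) / of_nat D * t ^ k)) b" for t
    unfolding f_def wZ_poly Z pt ..
  have "(\<Sum>k\<le>N. of_nat (c k) / of_nat D * 1 ^ k) = (of_nat (\<Sum>k\<le>N. c k) / of_nat D :: complex)"
    by (simp add: sum_divide_distrib)
  then have f1: "poly f 1 = ising_Z (line_graph G) \<xi> b" using c by (simp add: ft)
  have "poly p 0 = 0" using c(1) by (simp add: pt power_0_left if_distrib[of "\<lambda>x. _ * x"] sum.delta cong: if_cong)
  then have f0: "poly f 0 = 1" unfolding f_def wZ_poly by (intro wZ_all_zero) simp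
  have deg: "degree f \<le> m * N" unfolding f_def by (rule degree_wZ_le[OF dp])
  obtain a where a: "exp a = poly f 1"
    "cmod (a - log_sum (fps_of_poly f) K) \<le> degree f * ((1 / \<beta>) ^ Suc K / (1 - 1 / \<beta>))"
    "cmod (log_sum (fps_of_poly f) K) \<le> degree f * (1 / (\<beta> - 1))"
    using log_sum_approx[OF f0 \<beta>, of K] nz unfolding ft by blast
  define x where "x = log_sum (fps_of_poly f) K"
  \<comment> \<open>Here the tree meets the analysis: its series agrees with the polynomial
    \<open>f\<close> up to order \<open>K\<close>, and the truncated logarithm sees nothing
    beyond.\<close>
  have xK: "log_sum (approx_series es b z K) K = x"
    unfolding x_def
  proof (rule log_sum_cong)
    show "fps_nth (approx_series es b z K) 0 = 1" by (rule approx_series_nth_0[OF z0])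
    show "fps_nth (approx_series es b z K) i = fps_nth (fps_of_poly f) i" if "i \<le> K" for i
      using wZ_fps_approx[OF b z0 that] unfolding f_def wZ_fps_of_poly pz approx_series_def m_def by simp
  qed
  have e1: "cmod (a - x) \<le> m * A / \<beta> ^ K"
  proof -
    have "cmod (a - x) \<le> degree f * ((1 / \<beta>) ^ Suc K / (1 - 1 / \<beta>))" using a(2) by (simp only: x_def)
    also have "(1 / \<beta>) ^ Suc K / (1 - 1 / \<beta>) = 1 / (\<beta> - 1) / \<beta> ^ K"
      using \<beta> by (simp add: power_divide field_simps)
    also have "degree f * (1 / (\<beta> - 1) / \<beta> ^ K) \<le> (m * N) * (1 / (\<beta> - 1) / \<beta> ^ K)"
      using deg \<beta> by (intro mult_right_mono) (auto simp flip: of_nat_mult)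
    finally show ?thesis by (simp add: A)
  qed
  have xA: "cmod x \<le> m * A"
  proof -
    have "cmod x \<le> degree f * (1 / (\<beta> - 1))" using a(3) by (simp only: x_def)
    also have "\<dots> \<le> (m * N) * (1 / (\<beta> - 1))"
      using deg \<beta> by (intro mult_right_mono) (auto simp flip: of_nat_mult)
    finally show ?thesis by (simp add: A)
  qed
  have "2 * cmod x \<le> real (2 ^ K)" using xA M by (simp add: m_def)
  then obtain d where d: "exp d = (1 + x / of_nat (2 ^ K)) ^ (2 ^ K)" "cmod (d - x) \<le> 2 * cmod x ^ 2 / real (2 ^ K)"
    using power_exp_approx[of "2 ^ K" x] by auto
  have "2 * cmod x ^ 2 / real (2 ^ K) \<le> 2 * (m * A) ^ 2 / 2 ^ K"
    using xA by (simp add: divide_right_mono power_mono)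
  then have e2: "cmod (x - d) \<le> 2 * (m * A) ^ 2 / 2 ^ K" using d(2) by (simp add: norm_minus_commute)
  have "cmod (a - d) \<le> cmod (a - x) + cmod (x - d)" using norm_triangle_ineq[of "a - x" "x - d"] by simp
  then have "cmod (a - d) \<le> m * A / \<beta> ^ K + 2 * (m * A) ^ 2 / 2 ^ K" using e1 e2 by linarith
  then show ?thesis
    unfolding mult_approx_def output_value_def using a(1) d(1) f1 xK
    by (intro exI[of _ a] exI[of _ d]) (simp add: m_def z_def)
qed

text \<open>\<open>c0\<close> makes the powers of both \<open>\<beta>\<close> and 2 grow at least
  16-fold whenever \<open>e\<close> or \<open>l\<close> increases by one. This is enough, because
  \<open>m ^ 2 \<le> n ^ 4 \<le> 16 ^ l\<close> and \<open>1 / \<epsilon> \<le> 16 ^ e\<close>; the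
  constants depending on \<open>A\<close> are absorbed by \<open>k1\<close>.\<close>

lemma error_budget:
  fixes A \<beta> \<epsilon> :: real
  assumes A: "0 \<le> A" and \<beta>: "1 < \<beta>" and \<epsilon>: "0 < \<epsilon>" "1 / \<epsilon> \<le> 2 ^ e"
    and c0: "16 \<le> \<beta> ^ c0" "4 \<le> c0" and k1: "2 * A \<le> \<beta> ^ k1" "2 * A \<le> 2 ^ k1" "4 * A ^ 2 \<le> 2 ^ k1"
    and n: "n \<le> 2 ^ l" "m \<le> n ^ 2" and K: "K = k1 + c0 * e + c0 * l"
  shows "2 * (real m * A) \<le> 2 ^ K" and "real m * A / \<beta> ^ K + 2 * (real m * A) ^ 2 / 2 ^ K \<le> \<epsilon>"
proof -
  have "m \<le> (2 ^ l) ^ 2" using n(2) power_mono[OF n(1), of 2] by linarith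
  then have "real m \<le> real ((2 ^ l) ^ 2)" by (simp only: of_nat_le_iff)
  then have m4: "real m \<le> 4 ^ l" by (simp add: power2_eq_square power_mult_distrib[symmetric])
  have m16: "real m \<le> 16 ^ l" "real m ^ 2 \<le> 16 ^ l"
  proof -
    have "(4::real) ^ l \<le> 16 ^ l" by (rule power_mono) auto
    then show "real m \<le> 16 ^ l" using m4 by linarith
    have "real m ^ 2 \<le> (4 ^ l) ^ 2" using m4 by (intro power_mono) auto
    also have "\<dots> = 16 ^ l" by (simp add: power2_eq_square power_mult_distrib[symmetric])
    finally show "real m ^ 2 \<le> 16 ^ l" .
  qed
  have e16: "1 / \<epsilon> \<le> 16 ^ e"
  proof -
    have "(2::real) ^ e \<le> 16 ^ e" by (rule power_mono) auto
    then show ?thesis using \<epsilon> by linarith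
  qed
  have e1: "(1::real) \<le> 16 ^ e" by simp
  have two: "(16::real) \<le> 2 ^ c0" using power_increasing[OF c0(2), of "2::real"] by simp
  have grow: "g ^ k1 * (16 ^ e * 16 ^ l) \<le> g ^ K" if "16 \<le> g ^ c0" "0 < g" for g :: real
  proof -
    have "g ^ K = g ^ k1 * ((g ^ c0) ^ e * (g ^ c0) ^ l)" by (simp add: K power_add power_mult mult.assoc)
    moreover have "(16::real) ^ e * 16 ^ l \<le> (g ^ c0) ^ e * (g ^ c0) ^ l"
      using that by (intro mult_mono power_mono) auto
    ultimately show ?thesis using that by simp
  qed
  have "2 * (real m * A) = (2 * A) * (1 * real m)" by simp
  also have "\<dots> \<le> 2 ^ k1 * (16 ^ e * 16 ^ l)"
    using k1 A m16 e1 by (intro mult_mono) auto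
  also have "\<dots> \<le> 2 ^ K" using two by (intro grow) auto
  finally show "2 * (real m * A) \<le> 2 ^ K" .
  have "2 * A * (1 / \<epsilon> * real m) \<le> \<beta> ^ k1 * (16 ^ e * 16 ^ l)"
    using k1 A m16 e16 \<epsilon> \<beta> by (intro mult_mono) auto
  also have "\<dots> \<le> \<beta> ^ K" using c0 \<beta> by (intro grow) auto
  finally have 1: "real m * A / \<beta> ^ K \<le> \<epsilon> / 2" using \<epsilon> \<beta> by (simp add: field_simps)
  have "4 * A ^ 2 * (1 / \<epsilon> * real m ^ 2) \<le> 2 ^ k1 * (16 ^ e * 16 ^ l)"
    using k1 A m16 e16 \<epsilon> by (intro mult_mono) auto
  also have "\<dots> \<le> 2 ^ K" using two by (intro grow) auto
  finally have "2 * (real m * A) ^ 2 / 2 ^ K \<le> \<epsilon> / 2" using \<epsilon> by (simp add: field_simps power_mult_distrib)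
  with 1 show "real m * A / \<beta> ^ K + 2 * (real m * A) ^ 2 / 2 ^ K \<le> \<epsilon>" by linarith
qed

text \<open>\<open>W\<close> is at least \<open>2 ^ K\<close> for \<open>K = k0 + c0 * l\<close>, so
  \<open>(2 * \<Delta> + 1) ^ K \<le> (2 ^ (2 * \<Delta>)) ^ K \<le> W ^ (2 * \<Delta>)\<close>. The
  edges cost \<open>W ^ 2\<close>, and a last factor \<open>W\<close> covers the added 1.\<close>

lemma size_budget:
  fixes n l m c0 k0 \<Delta> :: nat
  assumes n: "1 \<le> n" and l: "2 ^ l \<le> 2 * n" and m: "m \<le> n ^ 2" and c0: "1 \<le> c0"
  defines "W \<equiv> 2 ^ k0 * (2 * n) ^ c0"
  shows "k0 + c0 * l + 1 \<le> W ^ (2 * \<Delta> + 3) \<and> m \<le> W ^ (2 * \<Delta> + 3) \<and>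
    1 + m * tree_size (2 * \<Delta>) (k0 + c0 * l) \<le> W ^ (2 * \<Delta> + 3)" and "n \<le> W ^ (2 * \<Delta> + 3)"
proof -
  let ?K = "k0 + c0 * l"
  have "(2::nat) ^ ?K = 2 ^ k0 * (2 ^ l) ^ c0" by (simp add: power_add power_mult[symmetric] mult.commute)
  also have "\<dots> \<le> W" unfolding W_def using l by (intro mult_left_mono power_mono) auto
  finally have KW: "2 ^ ?K \<le> W" .
  have "(2 * n) ^ 1 \<le> (2 * n) ^ c0" using n c0 by (intro power_increasing) auto
  also have "\<dots> \<le> W" unfolding W_def by simp
  finally have nW: "2 * n \<le> W" by simp
  then have W2: "2 \<le> W" using n by linarith
  have Wpow: "W ^ i \<le> W ^ (2 * \<Delta> + 3)" if "i \<le> 2 * \<Delta> + 3" for i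
    using that W2 by (intro power_increasing) auto
  have "n \<le> W ^ 1" using nW by simp
  then show "n \<le> W ^ (2 * \<Delta> + 3)" using Wpow[of 1] by linarith
  have "?K + 1 \<le> 2 ^ ?K" unfolding Suc_eq_plus1[symmetric] by (intro Suc_leI less_exp)
  then have 1: "?K + 1 \<le> W ^ (2 * \<Delta> + 3)" using KW Wpow[of 1] by simp
  have "n ^ 2 \<le> W ^ 2" using nW by (intro power_mono) auto
  then have mW: "m \<le> W ^ 2" using m by linarith
  then have 2: "m \<le> W ^ (2 * \<Delta> + 3)" using Wpow[of 2] by linarith
  have "2 * \<Delta> + 1 \<le> 2 ^ (2 * \<Delta>)" unfolding Suc_eq_plus1[symmetric] by (intro Suc_leI less_exp)
  then have "(2 * \<Delta> + 1) ^ ?K \<le> (2 ^ (2 * \<Delta>)) ^ ?K" by (rule power_mono) simp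
  also have "\<dots> = (2 ^ ?K) ^ (2 * \<Delta>)" by (simp add: power_mult[symmetric] mult.commute)
  also have "\<dots> \<le> W ^ (2 * \<Delta>)" using KW by (rule power_mono) simp
  finally have "tree_size (2 * \<Delta>) ?K \<le> W ^ (2 * \<Delta>)" using tree_size_le[of "2 * \<Delta>" ?K] by linarith
  then have "m * tree_size (2 * \<Delta>) ?K \<le> W ^ 2 * W ^ (2 * \<Delta>)" using mW by (intro mult_mono) auto
  also have "\<dots> = W ^ (2 * \<Delta> + 2)" by (simp add: power_add power2_eq_square)
  finally have "1 + m * tree_size (2 * \<Delta>) ?K \<le> 2 * W ^ (2 * \<Delta> + 2)"
    using W2 one_le_power[of W "2 * \<Delta> + 2"] by linarith
  also have "\<dots> \<le> W * W ^ (2 * \<Delta> + 2)" using W2 by (rule mult_right_mono) simp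
  also have "\<dots> = W ^ (2 * \<Delta> + 3)" by (simp add: power_add numeral_3_eq_3 numeral_2_eq_2)
  finally have "1 + m * tree_size (2 * \<Delta>) ?K \<le> W ^ (2 * \<Delta> + 3)" .
  with 1 2 show "?K + 1 \<le> W ^ (2 * \<Delta> + 3) \<and> m \<le> W ^ (2 * \<Delta> + 3) \<and>
    1 + m * tree_size (2 * \<Delta>) ?K \<le> W ^ (2 * \<Delta> + 3)" by blast
qed

lemma power_two_between:
  fixes x :: real
  assumes "1 \<le> x"
  shows "\<exists>e::nat. x \<le> 2 ^ e \<and> 2 ^ e \<le> 2 * x"
proof -
  have "\<exists>e::nat. x \<le> 2 ^ e" using real_arch_pow[of 2 x] by (auto intro: less_imp_le)
  then obtain e :: nat where e: "x \<le> 2 ^ e" and least: "\<And>i. i < e \<Longrightarrow> \<not> x \<le> 2 ^ i"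
    using exists_least_iff[of "\<lambda>e. x \<le> 2 ^ e"] by blast
  have "2 ^ e \<le> 2 * x"
  proof (cases e)
    case (Suc i)
    then show ?thesis using least[of i] by simp
  qed (use assms in simp)
  then show ?thesis using e by blast
qed

lemma ok_imp_outputs_within:
  assumes "ok c s T Q" "real T \<le> B"
  shows "\<exists>s'. outputs_within c s B (creg s' 0) \<and> Q s'"
proof -
  obtain t s' where "runs c s t s'" "t \<le> T" "Q s'" using assms(1) unfolding ok_def by blast
  then show ?thesis
    using assms(2) unfolding outputs_within_def by (intro exI[of _ s']) force
qed

theorem corollary1p3:
  fixes \<Delta> :: nat and \<alpha> :: real and U :: "complex set" and b \<xi> :: complex
  assumes "2 \<le> \<Delta>" and "0 \<le> \<alpha>" and "\<alpha> < pi / 2"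
    and "open U" and "complex_of_real ` {1..} \<subseteq> U"
    and "\<And>(G :: nat graph) b' z.
           simple_graph G \<Longrightarrow> max_degree_at_most G \<Delta> \<Longrightarrow> b' \<in> U \<Longrightarrow>
           z \<in> arg_sector (pi - 2 * \<alpha>) \<Longrightarrow> ising_Z (line_graph G) z b' \<noteq> 0"
    and "b \<in> U" and "\<xi> \<in> arg_sector (pi - 2 * \<alpha>)"
  shows "\<exists>p :: real poly. \<forall>\<epsilon>>0. \<exists>c :: com. \<forall>n (G :: nat graph).
           simple_graph G \<and> verts G = {..<n} \<and> max_degree_at_most G \<Delta> \<longrightarrow>
           (\<exists>w. outputs_within c (input_state n G b \<xi>) (poly p (real n / min \<epsilon> 1)) w \<and>
                mult_approx \<epsilon> w (ising_Z (line_graph G) \<xi> b))"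
proof -
  define \<theta> where "\<theta> = pi - 2 * \<alpha>"
  have \<theta>: "0 < \<theta>" "\<theta> \<le> pi" using assms(2,3) by (auto simp: \<theta>_def)
  note zero_free = assms(6)[folded \<theta>_def]
  have b0: "b \<noteq> 0"
  proof
    assume "b = 0"
    obtain k z where kz: "z \<in> arg_sector \<theta>" "ising_Z (line_graph (path_graph k)) z 0 = 0"
      using path_has_zero_in_sector[OF \<theta>(1)] by blast
    have "max_degree_at_most (path_graph k) \<Delta>"
      using path_graph_degree[of k] assms(1) unfolding max_degree_at_most_def by fastforce
    then show False using zero_free[OF path_graph_simple _ assms(7) kz(1)] kz(2) \<open>b = 0\<close> by blast
  qed
  obtain r where r: "r > 0" "\<And>(G :: nat graph) w. simple_graph G \<Longrightarrow> max_degree_at_most G \<Delta> \<Longrightarrow> cmod w < r \<Longrightarrow>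
      ising_Z (line_graph G) w b \<noteq> 0"
    using ising_nonzero_near_0[OF b0, of \<Delta>] by blast
  obtain \<delta> where \<delta>: "\<delta> > 0" "\<And>w. \<bar>Im w\<bar> < \<delta> \<and> Re w > - \<delta> \<Longrightarrow> cmod (\<xi> * w) < r \<or> \<xi> * w \<in> arg_sector \<theta>"
    using sector_neighbourhood[OF assms(8)[folded \<theta>_def] \<theta>(2) r(1)] by blast
  obtain \<beta> c N D where \<beta>: "\<beta> > 1" and c: "c 0 = 0" "\<forall>k>N. c k = 0" "0 < D" "(\<Sum>k\<le>N. c k) = D"
    and strip: "\<forall>t. cmod t \<le> \<beta> \<longrightarrow> \<bar>Im (\<Sum>k\<le>N. of_nat (c k) / of_nat D * t ^ k)\<bar> < \<delta> \<and>
      Re (\<Sum>k\<le>N. of_nat (c k) / of_nat D * t ^ k) > - \<delta>"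
    using strip_map[OF \<delta>(1)] by blast
  have c2: "c k = 0" if "k > N" for k using c(2) that by blast
  \<comment> \<open>On the disc, \<open>\<xi>\<close> times the substitution is either smaller than
    \<open>r\<close> or in the sector, and each case has its own reason for being zero-free.\<close>
  have nz: "ising_Z (line_graph G) (\<xi> * (\<Sum>k\<le>N. of_nat (c k) / of_nat D * t ^ k)) b \<noteq> 0"
    if "simple_graph G" "max_degree_at_most G \<Delta>" "cmod t \<le> \<beta>" for G :: "nat graph" and t
    using \<delta>(2)[of "\<Sum>k\<le>N. of_nat (c k) / of_nat D * t ^ k"] strip that r(2)[OF that(1,2)]
      zero_free[OF that(1,2) assms(7)] by blast
  define A where "A = real N / (\<beta> - 1)"
  have A: "0 \<le> A" using \<beta> by (simp add: A_def)
  obtain c1 where c1: "16 < \<beta> ^ c1" using real_arch_pow[OF \<beta>] by blast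
  define c0 where "c0 = max 4 c1"
  have "\<beta> ^ c1 \<le> \<beta> ^ c0" using \<beta> by (intro power_increasing) (auto simp: c0_def)
  then have c0: "16 \<le> \<beta> ^ c0" "4 \<le> c0" using c1 by (auto simp: c0_def)
  obtain i1 where i1: "2 * A < \<beta> ^ i1" using real_arch_pow[OF \<beta>] by blast
  obtain i2 where i2: "max (2 * A) (4 * A ^ 2) < 2 ^ i2" using real_arch_pow[of 2 "max (2 * A) (4 * A ^ 2)"] by auto
  \<comment> \<open>Including \<open>N\<close> ensures that all coefficients of the substitution fit
    into the cells \<open>0, ..., K\<close>.\<close>
  define k1 where "k1 = max N (max i1 i2)"
  have "\<beta> ^ i1 \<le> \<beta> ^ k1" "(2::real) ^ i2 \<le> 2 ^ k1" using \<beta> by (auto simp: k1_def intro!: power_increasing)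
  then have k1: "2 * A \<le> \<beta> ^ k1" "2 * A \<le> 2 ^ k1" "4 * A ^ 2 \<le> 2 ^ k1"
    using i1 i2 by linarith+
  \<comment> \<open>The 3 comes from the cubic running time, the other factor from
    \<open>size_budget\<close>.\<close>
  define q where "q = 3 * (2 * \<Delta> + 3)"
  \<comment> \<open>The base 4 combines the two roundings up to powers of two,
    \<open>2 ^ e \<le> 2 / \<epsilon>'\<close> and \<open>2 ^ l \<le> 2 * n\<close>.\<close>
  define C :: real where "C = 3000 * (2 ^ k1 * 4 ^ c0) ^ q"
  \<comment> \<open>The constant 10 is the time spent on the empty graph, where the monomial
    vanishes.\<close>
  define p where "p = [:10:] + monom C (c0 * q)"
  have C: "0 \<le> C" by (simp add: C_def)
  have p: "poly p x = 10 + C * x ^ (c0 * q)" for x by (simp add: p_def poly_monom)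
  show ?thesis
  proof (intro exI[of _ p] allI impI)
    fix \<epsilon> :: real assume \<epsilon>: "\<epsilon> > 0"
    define \<epsilon>' where "\<epsilon>' = min \<epsilon> 1"
    have \<epsilon>': "0 < \<epsilon>'" "\<epsilon>' \<le> \<epsilon>" "1 \<le> 1 / \<epsilon>'" using \<epsilon> by (auto simp: \<epsilon>'_def)
    obtain e :: nat where e: "1 / \<epsilon>' \<le> 2 ^ e" "2 ^ e \<le> 2 * (1 / \<epsilon>')" using power_two_between[OF \<epsilon>'(3)] by blast
    \<comment> \<open>The only place where the precision enters the program, through the literal
      \<open>c0 * e\<close>. Everything in \<open>p\<close> was fixed before, so one polynomial
      serves all \<open>\<epsilon>\<close>.\<close>
    define k0 where "k0 = k1 + c0 * e"
    show "\<exists>c. \<forall>n (G :: nat graph). simple_graph G \<and> verts G = {..<n} \<and> max_degree_at_most G \<Delta> \<longrightarrow>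
           (\<exists>w. outputs_within c (input_state n G b \<xi>) (poly p (real n / min \<epsilon> 1)) w \<and>
                mult_approx \<epsilon> w (ising_Z (line_graph G) \<xi> b))"
    proof (intro exI[of _ "main_prog k0 c0 c D N"] allI impI)
      fix n and G :: "nat graph"
      assume "simple_graph G \<and> verts G = {..<n} \<and> max_degree_at_most G \<Delta>"
      then have G: "simple_graph G" "verts G = {..<n}" "max_degree_at_most G \<Delta>" by auto
      let ?T = "poly p (real n / min \<epsilon> 1)" and ?Z = "ising_Z (line_graph G) \<xi> b"
      show "\<exists>w. outputs_within (main_prog k0 c0 c D N) (input_state n G b \<xi>) ?T w \<and> mult_approx \<epsilon> w ?Z"
      proof (cases "n = 0")
        case True
        have "edges G = {}" using G True by (auto simp: simple_graph_def)
        then have Z: "?Z = 1" by (simp add: ising_Z_def line_graph_def edge_boundary_def)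
        have "real 10 \<le> ?T" using C True c0 by (simp add: p q_def)
        from ok_imp_outputs_within[OF ok_main_prog_empty this]
        have "outputs_within (main_prog k0 c0 c D N) (input_state n G b \<xi>) ?T 1" using True by fastforce
        moreover have "mult_approx \<epsilon> 1 1" using \<epsilon> by (auto simp: mult_approx_def intro!: exI[of _ 0])
        ultimately show ?thesis using Z by auto
      next
        case False
        then have n: "1 \<le> n" by simp
        define W where "W = 2 ^ k0 * (2 * n) ^ c0"
        let ?Y = "W ^ (2 * \<Delta> + 3)"
        have Y: "n \<le> ?Y" "\<And>l m. 2 ^ l \<le> 2 * n \<Longrightarrow> m \<le> n ^ 2 \<Longrightarrow> k0 + c0 * l + 1 \<le> ?Y \<and> m \<le> ?Y \<and>
            1 + m * tree_size (2 * \<Delta>) (k0 + c0 * l) \<le> ?Y"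
        proof -
          have "1 \<le> c0" using c0 by simp
          show "n \<le> ?Y" using size_budget(2)[of n 0 0 c0 k0 \<Delta>] n \<open>1 \<le> c0\<close> by (simp add: W_def)
          show "k0 + c0 * l + 1 \<le> ?Y \<and> m \<le> ?Y \<and> 1 + m * tree_size (2 * \<Delta>) (k0 + c0 * l) \<le> ?Y"
            if "2 ^ l \<le> 2 * n" "m \<le> n ^ 2" for l m
            using size_budget(1)[OF n that \<open>1 \<le> c0\<close>] unfolding W_def .
        qed
        let ?Q = "\<lambda>s'. \<exists>l es. n \<le> 2 ^ l \<and> edge_list G es \<and>
          creg s' 0 = output_value es b \<xi> c D (k0 + c0 * l)"
        have run: "ok (main_prog k0 c0 c D N) (input_state n G b \<xi>) (3000 * ?Y ^ 3) ?Q"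
        proof (rule ok_main_prog[where c = c, OF G n c(1)])
          show "N \<le> k0" by (simp add: k0_def k1_def)
        qed (fact c2 Y)+
        have "real (3000 * ?Y ^ 3) \<le> ?T"
        proof -
          have "real W = 2 ^ k1 * (2 ^ e) ^ c0 * (2 * real n) ^ c0"
            by (simp add: W_def k0_def power_add power_mult[symmetric] mult.commute)
          also have "\<dots> \<le> 2 ^ k1 * (2 * (1 / \<epsilon>')) ^ c0 * (2 * real n) ^ c0"
            using e \<epsilon>' by (intro mult_right_mono mult_left_mono power_mono) auto
          also have "\<dots> = 2 ^ k1 * (2 * (1 / \<epsilon>') * (2 * real n)) ^ c0"
            by (simp only: power_mult_distrib mult.assoc)
          also have "2 * (1 / \<epsilon>') * (2 * real n) = 4 * (real n / \<epsilon>')" by simp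
          finally have W: "real W \<le> 2 ^ k1 * 4 ^ c0 * (real n / \<epsilon>') ^ c0"
            by (simp only: power_mult_distrib mult.assoc)
          have "real (3000 * ?Y ^ 3) = 3000 * real W ^ q" by (simp add: q_def power_mult[symmetric] mult.commute)
          also have "\<dots> \<le> 3000 * (2 ^ k1 * 4 ^ c0 * (real n / \<epsilon>') ^ c0) ^ q"
            using W by (intro mult_left_mono power_mono) auto
          also have "\<dots> = C * (real n / \<epsilon>') ^ (c0 * q)" by (simp add: C_def power_mult_distrib power_mult mult.assoc)
          finally show ?thesis by (simp add: p \<epsilon>'_def)
        qed
        from ok_imp_outputs_within[OF run this] obtain s' :: state and l es where
          w: "outputs_within (main_prog k0 c0 c D N) (input_state n G b \<xi>) ?T (creg s' 0)" and
          l: "n \<le> 2 ^ l" and es: "edge_list G es" and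
          s': "creg s' 0 = output_value es b \<xi> c D (k0 + c0 * l)"
          by blast
        define K where "K = k0 + c0 * l"
        have m: "length es \<le> n ^ 2" by (rule edge_list_length[OF G(1,2) es])
        note budget = error_budget[OF A \<beta> \<epsilon>'(1) e(1) c0 k1(1-3) l m, of K]
        have K: "K = k1 + c0 * e + c0 * l" by (simp add: K_def k0_def)
        have "mult_approx (real (length es) * A / \<beta> ^ K + 2 * (real (length es) * A) ^ 2 / 2 ^ K) (creg s' 0) ?Z"
          unfolding s' K_def[symmetric]
        proof (rule approximation_error[where c = c, OF G(1) es b0 \<beta> c(1) _ c(3,4) _ A_def budget(1)[OF K]])
          show "c k = 0" if "k > N" for k using that by (rule c2)
        qed (rule nz[OF G(1,3)])
        then have "mult_approx \<epsilon> (creg s' 0) ?Z" using budget(2)[OF K] \<epsilon>'(2) unfolding mult_approx_def by (meson order_trans)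
        then show ?thesis using w by blast
      qed
    qed
  qed
qed

end
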